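(* Let $H\in C^2(\mathbb{T}^n\times\mathbb{R}^n)$ be strictly convex in $p$ and superlinear in $p$, and suppose there is $\gamma_1>0$ with $|D_xH(x,p)|\le\gamma_1(1+|H(x,p)|)$ for all $(x,p)$. Let $A\in C^2(\mathbb{T}^n)$ be a matrix-valued function with $A(x)$ symmetric positive semidefinite for every $x$. Let $f\in C^{1,1}_{\rm loc}(\mathbb{T}^n\times\mathbb{R})$ satisfy $\partial_rf>0$ on $\mathbb{T}^n\times\mathbb{R}$ and $f(x,0)=0$ for all $x\in\mathbb{T}^n$. Let $c_H$ be the ergodic constant of the ergodic problem $$H(x,Du)=\mathrm{tr}\big(A(x)D^2u\big)+c_H\quad\text{in }\mathbb{T}^n. \qquad (\mathrm{E})$$ Then for each viscosity solution $\hat u_0\in C(\mathbb{T}^n)$ of (E) there exists a potential $\hat V_0\in\mathrm{Lip}(\mathbb{T}^n)$ such that, for all sufficiently small $\lambda>0$, the equation $$f(x,\lambda u_\lambda)+H(x,Du_\lambda)+\lambda\hat V_0(x)=\mathrm{tr}\big(A(x)D^2u_\lambda\big)+c_H\quad\text{in }\mathbb{T}^n$$ admits a unique viscosity solution $u_\lambda\in\mathrm{Lip}(\mathbb{T}^n)$, and $u_\lambda$ converges uniformly to $\hat u_0$ as $\lambda\to0^+$ with rate $O(\lambda)$, namely $$\|u_\lambda-\hat u_0\|_{L^\infty(\mathbb{T}^n)}\le C\lambda$$ for a constant $C$ independent of $\lambda$.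
   Context: $\mathbb{T}^n=\mathbb{R}^n/\mathbb{Z}^n$. Superlinear in $p$ means $H(x,p)/|p|\to\infty$ as $|p|\to\infty$ uniformly in $x$. The ergodic constant $c_H\in\mathbb{R}$ is the unique constant for which (E) admits viscosity solutions. *)

theory Defs
  imports "HOL-Analysis.Analysis"
begin

text \<open>Functions on the torus \<open>\<real>\<^sup>n/\<int>\<^sup>n\<close> are represented by their \<open>\<int>\<^sup>n\<close>-periodic lifts to
  \<open>real ^ 'n\<close>. For data \<open>g :: real ^ 'n \<Rightarrow> 'a \<Rightarrow> 'b\<close> this is periodicity in the first argument.\<close>

definition torus_fun :: "(real ^ 'n \<Rightarrow> 'b) \<Rightarrow> bool"
  where "torus_fun g \<longleftrightarrow> (\<forall>x k. (\<forall>i. k $ i \<in> \<int>) \<longrightarrow> g (x + k) = g x)"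

definition torus_Lip :: "(real ^ 'n \<Rightarrow> real) \<Rightarrow> bool"
  where "torus_Lip u \<longleftrightarrow> torus_fun u \<and> (\<exists>L. L-lipschitz_on UNIV u)"

definition C2 :: "('a::real_normed_vector \<Rightarrow> 'b::real_normed_vector) \<Rightarrow> bool"
  where "C2 g \<longleftrightarrow>
    (\<exists>(g' :: 'a \<Rightarrow> ('a \<Rightarrow>\<^sub>L 'b)) (g'' :: 'a \<Rightarrow> ('a \<Rightarrow>\<^sub>L ('a \<Rightarrow>\<^sub>L 'b))).
      (\<forall>z. (g has_derivative blinfun_apply (g' z)) (at z)) \<and>
      (\<forall>z. (g' has_derivative blinfun_apply (g'' z)) (at z)) \<and>
      continuous_on UNIV g'')"

definition C11_loc :: "('a::real_normed_vector \<Rightarrow> 'b::real_normed_vector) \<Rightarrow> bool"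
  where "C11_loc g \<longleftrightarrow>
    (\<exists>g' :: 'a \<Rightarrow> ('a \<Rightarrow>\<^sub>L 'b).
      (\<forall>z. (g has_derivative blinfun_apply (g' z)) (at z)) \<and>
      (\<forall>z. \<exists>e>0. \<exists>L. L-lipschitz_on (ball z e) g'))"

definition grad :: "(real ^ 'n \<Rightarrow> real) \<Rightarrow> real ^ 'n \<Rightarrow> real ^ 'n"
  where "grad u x = (\<chi> i. frechet_derivative u (at x) (axis i 1))"

definition hess :: "(real ^ 'n \<Rightarrow> real) \<Rightarrow> real ^ 'n \<Rightarrow> real ^ 'n ^ 'n"
  where "hess u x = matrix (frechet_derivative (grad u) (at x))"

definition strictly_convex :: "(real ^ 'n \<Rightarrow> real) \<Rightarrow> bool"
  where "strictly_convex h \<longleftrightarrow>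
    (\<forall>p q t. p \<noteq> q \<longrightarrow> 0 < t \<longrightarrow> t < 1 \<longrightarrow>
      h ((1 - t) *\<^sub>R p + t *\<^sub>R q) < (1 - t) * h p + t * h q)"

definition superlinear_in_p :: "(real ^ 'n \<Rightarrow> real ^ 'n \<Rightarrow> real) \<Rightarrow> bool"
  where "superlinear_in_p H \<longleftrightarrow>
    (\<forall>M. \<forall>\<^sub>F p in at_infinity. \<forall>x. H x p / norm p \<ge> M)"

definition sym_psd :: "real ^ 'n ^ 'n \<Rightarrow> bool"
  where "sym_psd M \<longleftrightarrow> transpose M = M \<and> (\<forall>v. 0 \<le> v \<bullet> (M *v v))"

text \<open>Viscosity solutions of \<open>F(x, u, Du, D\<^sup>2u) = 0\<close> on the torus. Since extrema are local, the \<open>C\<^sup>2\<close>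
  test functions need not be periodic.\<close>

definition viscosity_sub ::
    "(real ^ 'n \<Rightarrow> real \<Rightarrow> real ^ 'n \<Rightarrow> real ^ 'n ^ 'n \<Rightarrow> real) \<Rightarrow> (real ^ 'n \<Rightarrow> real) \<Rightarrow> bool"
  where "viscosity_sub F u \<longleftrightarrow>
    (\<forall>\<phi> x. C2 \<phi> \<longrightarrow> (\<forall>\<^sub>F y in nhds x. u y - \<phi> y \<le> u x - \<phi> x) \<longrightarrow>
      F x (u x) (grad \<phi> x) (hess \<phi> x) \<le> 0)"

definition viscosity_super ::
    "(real ^ 'n \<Rightarrow> real \<Rightarrow> real ^ 'n \<Rightarrow> real ^ 'n ^ 'n \<Rightarrow> real) \<Rightarrow> (real ^ 'n \<Rightarrow> real) \<Rightarrow> bool"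
  where "viscosity_super F u \<longleftrightarrow>
    (\<forall>\<phi> x. C2 \<phi> \<longrightarrow> (\<forall>\<^sub>F y in nhds x. u x - \<phi> x \<le> u y - \<phi> y) \<longrightarrow>
      F x (u x) (grad \<phi> x) (hess \<phi> x) \<ge> 0)"

definition viscosity_solution ::
    "(real ^ 'n \<Rightarrow> real \<Rightarrow> real ^ 'n \<Rightarrow> real ^ 'n ^ 'n \<Rightarrow> real) \<Rightarrow> (real ^ 'n \<Rightarrow> real) \<Rightarrow> bool"
  where "viscosity_solution F u \<longleftrightarrow>
    torus_fun u \<and> continuous_on UNIV u \<and> viscosity_sub F u \<and> viscosity_super F u"

definition ergodic_solution ::
    "(real ^ 'n \<Rightarrow> real ^ 'n \<Rightarrow> real) \<Rightarrow> (real ^ 'n \<Rightarrow> real ^ 'n ^ 'n) \<Rightarrow> real \<Rightarrow>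
      (real ^ 'n \<Rightarrow> real) \<Rightarrow> bool"
  where "ergodic_solution H A c u \<longleftrightarrow>
    viscosity_solution (\<lambda>x r p X. H x p - (trace (A x ** X) + c)) u"

definition ergodic_constant ::
    "(real ^ 'n \<Rightarrow> real ^ 'n \<Rightarrow> real) \<Rightarrow> (real ^ 'n \<Rightarrow> real ^ 'n ^ 'n) \<Rightarrow> real"
  where "ergodic_constant H A = (THE c. \<exists>u. ergodic_solution H A c u)"

definition discounted_solution ::
    "(real ^ 'n \<Rightarrow> real \<Rightarrow> real) \<Rightarrow> (real ^ 'n \<Rightarrow> real ^ 'n \<Rightarrow> real) \<Rightarrow>
      (real ^ 'n \<Rightarrow> real ^ 'n ^ 'n) \<Rightarrow> real \<Rightarrow> (real ^ 'n \<Rightarrow> real) \<Rightarrow> real \<Rightarrow>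
      (real ^ 'n \<Rightarrow> real) \<Rightarrow> bool"
  where "discounted_solution f H A c V lam u \<longleftrightarrow>
    viscosity_solution
      (\<lambda>x r p X. f x (lam * r) + H x p + lam * V x - (trace (A x ** X) + c)) u"

end

theory Submission
  imports Defs
begin

text \<open>
  The potential is \<open>V0 x = - \<partial>\<^sub>r f x 0 * u0 x\<close>. Since \<open>f x (lam * r) = \<partial>\<^sub>r f x 0 * lam * r + O(lam\<^sup>2)\<close>, the
  functions \<open>u0 \<plusminus> C lam\<close> are a super- and a subsolution of the discounted equation for large \<open>C\<close>, and Perron's
  method yields a solution between them. Comparison and the Lipschitz bound come out of one doubling of variables: if
  \<open>u x - v y > L |x - y|\<close> somewhere, one maximises \<open>u x - v y\<close> minus a smoothed \<open>L |x - y|\<close> and adds \<open>(1 + s r)\<^sup>2\<close> times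
  the inequality for \<open>u\<close> to the one for \<open>v\<close>, where \<open>r\<close> is the distance of the maximising points. The trace terms
  are controlled by a coupling of factors of \<open>A x\<close> and \<open>A y\<close> of size \<open>O(r)\<close>, and superlinearity of \<open>H\<close> absorbs
  all errors once \<open>L\<close> is large.

  The second-order information at the maximum is extracted without Aleksandrov's theorem: sup-convolutions of
  subsolutions satisfy approximate mean value inequalities along random walks, and these inequalities can simply be
  added along coupled walks.
\<close>

section \<open>Functions with two continuous derivatives\<close>

text \<open>Since A may degenerate, no smoothing comes from the second-order term: all coercivity is
  that of H, and two trace terms can be compared only because the square root of a C^2 positive
  semidefinite matrix field is Lipschitz. The doubling has to serve an equation with a zero-order
  term and one without. It therefore asks only for a positive gap \<open>\<theta>\<close> between
  the zero-order terms wherever \<open>u a - v b \<ge> m\<close>, up to a multiple of the distance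
  of a and b. For the discounted equation the gap comes from the strict monotonicity of f. For the
  ergodic equation, where u and v are both \<open>u0\<close>, it comes from uniform continuity,
  which keeps a and b apart. The conclusion \<open>u x - v y \<le> L * norm (x - y)\<close> is
  comparison for x = y and a Lipschitz bound for u = v; applied to the two semicontinuous functions
  from Perron's method it makes them one Lipschitz solution. Walk operators are linear and monotone,
  so an inequality at a maximum can be averaged. The rate is linear because a shift by a multiple of
  lam changes the equation by order lam^2, the order of the Taylor error of f.\<close>

definition c2_with ::
    "(real ^ 'n \<Rightarrow> real) \<Rightarrow> (real ^ 'n \<Rightarrow> real ^ 'n) \<Rightarrow> (real ^ 'n \<Rightarrow> real ^ 'n ^ 'n) \<Rightarrow> bool"
  where "c2_with \<phi> g h \<longleftrightarrow>
    (\<forall>x. (\<phi> has_derivative (\<lambda>v. g x \<bullet> v)) (at x)) \<and>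
    (\<forall>x. (g has_derivative (\<lambda>v. h x *v v)) (at x)) \<and> continuous_on UNIV h"

lemma continuous_on_matrix_vector_mult [continuous_intros]:
  fixes M :: "'a::topological_space \<Rightarrow> real ^ 'n ^ 'm"
  assumes "continuous_on S M" "continuous_on S v"
  shows "continuous_on S (\<lambda>x. M x *v v x)"
  unfolding matrix_vector_mult_def by (intro continuous_intros assms)

lemma c2_with_imp_C2:
  fixes \<phi> :: "real ^ 'n \<Rightarrow> real"
  assumes "c2_with \<phi> g h"
  shows "C2 \<phi>"
proof -
  have h: "continuous_on UNIV h" using assms by (auto simp: c2_with_def)
  define G where "G x = blinfun_inner_right (g x)" for x
  define K where "K x = Blinfun (\<lambda>v. blinfun_inner_right (h x *v v))" for x
  have bl: "bounded_linear (\<lambda>v. blinfun_inner_right (h x *v v))" for x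
    by (rule bounded_linear_compose[OF bounded_linear_blinfun_inner_right matrix_vector_mul_bounded_linear])
  have K: "blinfun_apply (K x) v = blinfun_inner_right (h x *v v)" for x v
    unfolding K_def by (simp add: bounded_linear_Blinfun_apply[OF bl])
  have 1: "(\<phi> has_derivative blinfun_apply (G x)) (at x)" for x
    using assms by (auto simp: c2_with_def G_def)
  have 2: "(G has_derivative blinfun_apply (K x)) (at x)" for x
  proof -
    have "(g has_derivative (\<lambda>v. h x *v v)) (at x)" using assms by (auto simp: c2_with_def)
    from bounded_linear.has_derivative[OF bounded_linear_blinfun_inner_right this]
    have "(G has_derivative (\<lambda>v. blinfun_inner_right (h x *v v))) (at x)"
      by (simp add: G_def[abs_def])
    then show ?thesis by (simp add: K[abs_def])
  qed
  have 3: "continuous_on UNIV K"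
  proof (rule continuous_on_blinfun_componentwise)
    fix i :: "real ^ 'n" assume "i \<in> Basis"
    show "continuous_on UNIV (\<lambda>x. blinfun_apply (K x) i)"
      unfolding K
      by (rule bounded_linear.continuous_on[OF bounded_linear_blinfun_inner_right])
         (intro continuous_intros h)
  qed
  show ?thesis unfolding C2_def using 1 2 3 by blast
qed

text \<open>The row of the matrix is the gradient component and the column the direction of
  differentiation, so that \<open>h x *v v\<close> is the derivative of the gradient along
  v.\<close>

lemma C2_imp_c2_with:
  fixes \<phi> :: "real ^ 'n \<Rightarrow> real"
  assumes "\<And>z. (\<phi> has_derivative blinfun_apply (g' z)) (at z)"
    and "\<And>z. (g' has_derivative blinfun_apply (g'' z)) (at z)"
    and "continuous_on UNIV g''"
  shows "c2_with \<phi> (\<lambda>x. \<chi> i. g' x (axis i 1)) (\<lambda>x. \<chi> i j. g'' x (axis j 1) (axis i 1))"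
  unfolding c2_with_def
proof (intro conjI allI)
  fix x
  have e: "v = (\<Sum>i\<in>UNIV. v $ i *\<^sub>R axis i 1)" for v :: "real ^ 'n"
    by (metis basis_expansion scalar_mult_eq_scaleR)
  have lin: "blinfun_apply B v = (\<Sum>i\<in>UNIV. v $ i *\<^sub>R blinfun_apply B (axis i 1))"
    for B :: "(real ^ 'n) \<Rightarrow>\<^sub>L 'b::real_normed_vector" and v
    by (subst e) (simp add: blinfun.sum_right blinfun.scaleR_right)
  show "(\<phi> has_derivative (\<lambda>v. (\<chi> i. g' x (axis i 1)) \<bullet> v)) (at x)"
  proof -
    have "blinfun_apply (g' x) = (\<lambda>v. (\<chi> i. g' x (axis i 1)) \<bullet> v)"
      by (rule ext, subst lin) (simp add: inner_vec_def mult.commute)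
    with assms(1)[of x] show ?thesis by simp
  qed
  show "((\<lambda>x. \<chi> i. g' x (axis i 1)) has_derivative (\<lambda>v. (\<chi> i j. g'' x (axis j 1) (axis i 1)) *v v)) (at x)"
  proof -
    have "((\<lambda>x. \<chi> i. g' x (axis i 1)) has_derivative (\<lambda>v. \<chi> i. g'' x v (axis i 1))) (at x)"
      by (auto simp: has_derivative_componentwise_within[of "\<lambda>x. \<chi> i. g' x (axis i 1)"] Basis_vec_def inner_axis
          intro!: bounded_linear.has_derivative[OF blinfun.bounded_linear_left assms(2)])
    moreover have "(\<lambda>v. \<chi> i. g'' x v (axis i 1)) = (\<lambda>v. (\<chi> i j. g'' x (axis j 1) (axis i 1)) *v v)"
    proof (rule ext)
      fix v
      show "(\<chi> i. g'' x v (axis i 1)) = (\<chi> i j. g'' x (axis j 1) (axis i 1)) *v v"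
        apply (subst lin)
        by (simp add: matrix_vector_mult_def blinfun.sum_left blinfun.scaleR_left mult.commute)
    qed
    ultimately show ?thesis by simp
  qed
  show "continuous_on UNIV (\<lambda>x. \<chi> i j. g'' x (axis j 1) (axis i 1))"
    by (intro continuous_intros assms)
qed

text \<open>The viscosity definitions quantify over \<open>C2\<close>, whereas traces and walks need
  gradient and Hessian as explicit vector and matrix fields. This is the bridge used in
  \<open>viscosity_sub_iff\<close> and \<open>viscosity_super_iff\<close>.\<close>

lemma C2_iff_c2_with: "C2 \<phi> \<longleftrightarrow> (\<exists>g h. c2_with \<phi> g h)"
proof
  assume "C2 \<phi>"
  then show "\<exists>g h. c2_with \<phi> g h" unfolding C2_def using C2_imp_c2_with by blast
qed (auto intro: c2_with_imp_C2)

lemma c2_with_grad: assumes "c2_with \<phi> g h" shows "grad \<phi> = g"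
proof
  fix x
  have "(\<phi> has_derivative (\<lambda>v. g x \<bullet> v)) (at x)" using assms by (auto simp: c2_with_def)
  then have "frechet_derivative \<phi> (at x) = (\<lambda>v. g x \<bullet> v)"
    by (metis frechet_derivative_at)
  then show "grad \<phi> x = g x"
    by (simp add: grad_def inner_axis vec_eq_iff)
qed

lemma c2_with_hess: assumes "c2_with \<phi> g h" shows "hess \<phi> = h"
proof
  fix x
  have "(g has_derivative (\<lambda>v. h x *v v)) (at x)" using assms by (auto simp: c2_with_def)
  then have "frechet_derivative g (at x) = (\<lambda>v. h x *v v)"
    by (metis frechet_derivative_at)
  then show "hess \<phi> x = h x"
    by (simp add: hess_def c2_with_grad[OF assms])
qed

lemma c2_with_continuous:
  assumes "c2_with \<phi> g h"
  shows "continuous_on S \<phi>" "continuous_on S g" "continuous_on S h"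
proof -
  have "isCont \<phi> x" "isCont g x" for x
    using assms has_derivative_continuous unfolding c2_with_def by blast+
  then show "continuous_on S \<phi>" "continuous_on S g"
    by (simp_all add: continuous_at_imp_continuous_on)
  show "continuous_on S h" using assms continuous_on_subset unfolding c2_with_def by blast
qed

lemma c2_with_add:
  assumes "c2_with \<phi> g h" "c2_with \<phi>' g' h'"
  shows "c2_with (\<lambda>x. \<phi> x + \<phi>' x) (\<lambda>x. g x + g' x) (\<lambda>x. h x + h' x)"
  unfolding c2_with_def
proof (intro conjI allI)
  fix x
  show "((\<lambda>x. \<phi> x + \<phi>' x) has_derivative (\<lambda>v. (g x + g' x) \<bullet> v)) (at x)"
    using assms has_derivative_add[of \<phi> "\<lambda>v. g x \<bullet> v" "at x" \<phi>' "\<lambda>v. g' x \<bullet> v"]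
    by (simp add: c2_with_def inner_add_left)
  show "((\<lambda>x. g x + g' x) has_derivative (\<lambda>v. (h x + h' x) *v v)) (at x)"
    using assms has_derivative_add[of g "\<lambda>v. h x *v v" "at x" g' "\<lambda>v. h' x *v v"]
    by (simp add: c2_with_def matrix_vector_mult_add_rdistrib)
  show "continuous_on UNIV (\<lambda>x. h x + h' x)"
    using assms by (auto simp: c2_with_def intro!: continuous_intros)
qed

lemma c2_with_scale:
  assumes "c2_with \<phi> g h"
  shows "c2_with (\<lambda>x. c * \<phi> x) (\<lambda>x. c *\<^sub>R g x) (\<lambda>x. c *\<^sub>R h x)"
  unfolding c2_with_def
proof (intro conjI allI)
  fix x
  show "((\<lambda>x. c * \<phi> x) has_derivative (\<lambda>v. (c *\<^sub>R g x) \<bullet> v)) (at x)"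
    using assms has_derivative_mult_right[of \<phi> "\<lambda>v. g x \<bullet> v" "at x" c] by (simp add: c2_with_def)
  show "((\<lambda>x. c *\<^sub>R g x) has_derivative (\<lambda>v. (c *\<^sub>R h x) *v v)) (at x)"
    using assms has_derivative_scaleR_right[of g "\<lambda>v. h x *v v" "at x" c]
    by (simp add: c2_with_def scaleR_matrix_vector_assoc[symmetric])
  show "continuous_on UNIV (\<lambda>x. c *\<^sub>R h x)"
    using assms by (auto simp: c2_with_def intro!: continuous_intros)
qed

text \<open>Moves test functions: \<open>c = 1\<close> translates, \<open>c = -1\<close> serves the
  second of the doubled variables, and \<open>c = 1 / t\<close> undoes a blow-up at scale t.\<close>

lemma c2_with_affine:
  assumes "c2_with \<phi> g h"
  shows "c2_with (\<lambda>x. \<phi> (c *\<^sub>R x + a)) (\<lambda>x. c *\<^sub>R g (c *\<^sub>R x + a)) (\<lambda>x. c\<^sup>2 *\<^sub>R h (c *\<^sub>R x + a))"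
  unfolding c2_with_def
proof (intro conjI allI)
  fix x
  have aff: "((\<lambda>x. c *\<^sub>R x + a) has_derivative (\<lambda>v. c *\<^sub>R v)) (at x)"
    by (auto intro!: derivative_eq_intros)
  show "((\<lambda>x. \<phi> (c *\<^sub>R x + a)) has_derivative (\<lambda>v. (c *\<^sub>R g (c *\<^sub>R x + a)) \<bullet> v)) (at x)"
    using has_derivative_compose[OF aff, of \<phi> "\<lambda>v. g (c *\<^sub>R x + a) \<bullet> v"] assms
    by (auto simp: c2_with_def)
  have "((\<lambda>x. g (c *\<^sub>R x + a)) has_derivative (\<lambda>v. h (c *\<^sub>R x + a) *v (c *\<^sub>R v))) (at x)"
    using has_derivative_compose[OF aff, of g "\<lambda>v. h (c *\<^sub>R x + a) *v v"] assms
    by (auto simp: c2_with_def)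
  from has_derivative_scaleR_right[OF this, of c]
  show "((\<lambda>x. c *\<^sub>R g (c *\<^sub>R x + a)) has_derivative (\<lambda>v. (c\<^sup>2 *\<^sub>R h (c *\<^sub>R x + a)) *v v)) (at x)"
    by (simp add: power2_eq_square scaleR_matrix_vector_assoc[symmetric] matrix_vector_mult_scaleR)
next
  show "continuous_on UNIV (\<lambda>x. c\<^sup>2 *\<^sub>R h (c *\<^sub>R x + a))"
    by (intro continuous_intros continuous_on_compose2[OF c2_with_continuous(3)[OF assms, of UNIV]]) auto
qed

lemma c2_with_linear: "c2_with (\<lambda>x. c + p \<bullet> (x - a)) (\<lambda>x. p) (\<lambda>x. 0)"
  unfolding c2_with_def by (auto intro!: derivative_eq_intros)

lemma c2_with_sqnorm:
  "c2_with (\<lambda>x. (norm (x - a))\<^sup>2) (\<lambda>x. 2 *\<^sub>R (x - a)) (\<lambda>x::real^'n. 2 *\<^sub>R mat 1)"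
  unfolding c2_with_def power2_norm_eq_inner
  by (auto intro!: derivative_eq_intros
      simp: scaleR_matrix_vector_assoc[symmetric] inner_commute inner_diff_left inner_diff_right algebra_simps)

lemma c2_with_sum:
  assumes "finite I" "\<And>i. i \<in> I \<Longrightarrow> c2_with (\<phi> i) (g i) (h i)"
  shows "c2_with (\<lambda>x. \<Sum>i\<in>I. \<phi> i x) (\<lambda>x. \<Sum>i\<in>I. g i x) (\<lambda>x. \<Sum>i\<in>I. h i x)"
  using assms
proof (induction rule: finite_induct)
  case empty
  then show ?case using c2_with_linear[of 0 0 0] by simp
next
  case (insert i I)
  then show ?case using c2_with_add[of "\<phi> i" "g i" "h i"] by simp
qed

lemma c2_line:
  assumes "c2_with \<phi> g h"
  shows "((\<lambda>t. \<phi> (x + t *\<^sub>R v)) has_real_derivative (g (x + t *\<^sub>R v) \<bullet> v)) (at t)"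
    and "((\<lambda>t. g (x + t *\<^sub>R v) \<bullet> v) has_real_derivative (v \<bullet> (h (x + t *\<^sub>R v) *v v))) (at t)"
proof -
  have aff: "((\<lambda>t. x + t *\<^sub>R v) has_derivative (\<lambda>s. s *\<^sub>R v)) (at t)"
    by (auto intro!: derivative_eq_intros)
  show "((\<lambda>t. \<phi> (x + t *\<^sub>R v)) has_real_derivative (g (x + t *\<^sub>R v) \<bullet> v)) (at t)"
    using has_derivative_compose[OF aff, of \<phi> "\<lambda>w. g (x + t *\<^sub>R v) \<bullet> w"] assms
    by (auto simp: c2_with_def has_field_derivative_def mult_commute_abs)
  have "((\<lambda>t. g (x + t *\<^sub>R v)) has_derivative (\<lambda>s. h (x + t *\<^sub>R v) *v (s *\<^sub>R v))) (at t)"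
    using has_derivative_compose[OF aff, of g "\<lambda>w. h (x + t *\<^sub>R v) *v w"] assms
    by (auto simp: c2_with_def)
  from has_derivative_inner_left[OF this, of v]
  show "((\<lambda>t. g (x + t *\<^sub>R v) \<bullet> v) has_real_derivative (v \<bullet> (h (x + t *\<^sub>R v) *v v))) (at t)"
    by (simp add: has_field_derivative_def matrix_vector_mult_scaleR mult.commute inner_commute mult_commute_abs)
qed

lemma c2_taylor:
  assumes "c2_with \<phi> g h"
  obtains t where "0 < t" "t < 1"
    "\<phi> (x + v) = \<phi> x + g x \<bullet> v + (v \<bullet> (h (x + t *\<^sub>R v) *v v)) / 2"
proof -
  define f where "f m t = (if m = 0 then \<phi> (x + t *\<^sub>R v) else if m = 1 then g (x + t *\<^sub>R v) \<bullet> v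
     else v \<bullet> (h (x + t *\<^sub>R v) *v v))" for m :: nat and t
  have "\<forall>m t. m < 2 \<and> 0 \<le> t \<and> t \<le> 1 \<longrightarrow> (f m has_real_derivative f (Suc m) t) (at t)"
  proof (intro allI impI)
    fix m :: nat and t :: real assume "m < 2 \<and> 0 \<le> t \<and> t \<le> 1"
    then have "m = 0 \<or> m = 1" by auto
    then show "(f m has_real_derivative f (Suc m) t) (at t)"
      using c2_line[OF assms, of x v t] by (auto simp: f_def[abs_def])
  qed
  then have "\<exists>t>0. t < 1 \<and> f 0 1 = (\<Sum>m<2. f m 0 / fact m * 1 ^ m) + f 2 t / fact 2 * 1 ^ 2"
    by (intro Maclaurin) auto
  then obtain t where "0 < t" "t < 1" "f 0 1 = (\<Sum>m<2. f m 0 / fact m * 1 ^ m) + f 2 t / fact 2 * 1 ^ 2"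
    by blast
  then show ?thesis by (intro that[of t]) (auto simp: f_def eval_nat_numeral)
qed


section \<open>Coupling of positive semidefinite matrices\<close>

lemma c2_local_max:
  assumes "c2_with \<phi> g h" "\<forall>\<^sub>F y in nhds x. \<phi> y \<le> \<phi> x"
  shows "g x = 0" "v \<bullet> (h x *v v) \<le> 0"
proof -
  obtain d where d: "d > 0" "\<And>y. dist y x < d \<Longrightarrow> \<phi> y \<le> \<phi> x"
    using assms(2) by (auto simp: eventually_nhds_metric)
  have g: "g x \<bullet> w = 0" for w
  proof -
    define d' where "d' = d / (norm w + 1)"
    have d': "d' > 0" using d(1) by (simp add: d'_def add_nonneg_pos)
    have *: "\<bar>t\<bar> * norm w < d" if "\<bar>t\<bar> < d'" for t
    proof -
      have "\<bar>t\<bar> * norm w \<le> \<bar>t\<bar> * (norm w + 1)" by (simp add: mult_left_mono)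
      also have "\<dots> < d' * (norm w + 1)" using that by (simp add: add_nonneg_pos)
      also have "\<dots> = d" by (simp add: d'_def add_nonneg_pos less_imp_neq[symmetric])
      finally show ?thesis .
    qed
    have "g (x + 0 *\<^sub>R w) \<bullet> w = 0"
      by (rule DERIV_local_max[OF c2_line(1)[OF assms(1)] d'])
         (use * d(2) in \<open>auto simp: dist_norm\<close>)
    then show ?thesis by simp
  qed
  from g[of "g x"] show "g x = 0" by simp
  show "v \<bullet> (h x *v v) \<le> 0"
  proof (rule ccontr)
    assume "\<not> v \<bullet> (h x *v v) \<le> 0"
    then have pos: "v \<bullet> (h x *v v) > 0" by simp
    have "continuous_on UNIV (\<lambda>y. v \<bullet> (h y *v v))"
      by (intro continuous_intros c2_with_continuous(3)[OF assms(1)])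
    then have "((\<lambda>y. v \<bullet> (h y *v v)) \<longlongrightarrow> v \<bullet> (h x *v v)) (nhds x)"
      using tendsto_at_iff_tendsto_nhds[of "\<lambda>y. v \<bullet> (h y *v v)" x]
      by (simp add: continuous_on_eq_continuous_at continuous_at)
    then have "\<forall>\<^sub>F y in nhds x. v \<bullet> (h y *v v) > 0"
      using pos by (rule order_tendstoD(1))
    then obtain e where e: "e > 0" "\<And>y. dist y x < e \<Longrightarrow> v \<bullet> (h y *v v) > 0"
      by (auto simp: eventually_nhds_metric)
    \<comment> \<open>The segment from x to \<open>x + s *\<^sub>R v\<close> stays where x is
      maximal and where the second derivative along v is positive, so the Lagrange remainder
      produces a larger value.\<close>
    define s where "s = min d e / (2 * (norm v + 1))"
    have s: "s > 0" using d(1) e(1) by (simp add: s_def add_nonneg_pos)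
    have "s * norm v \<le> s * (norm v + 1)" using s by simp
    also have "\<dots> = min d e / 2"
    proof -
      have "norm v + 1 \<noteq> 0" by (smt (verit) norm_ge_zero)
      then show ?thesis unfolding s_def by (simp add: divide_simps)
    qed
    finally have sn: "s * norm v < min d e" using d(1) e(1) by linarith
    obtain t where t: "0 < t" "t < 1"
      "\<phi> (x + s *\<^sub>R v) = \<phi> x + g x \<bullet> (s *\<^sub>R v) + ((s *\<^sub>R v) \<bullet> (h (x + t *\<^sub>R s *\<^sub>R v) *v (s *\<^sub>R v))) / 2"
      using c2_taylor[OF assms(1)] by blast
    have "t * (s * norm v) \<le> 1 * (s * norm v)"
      by (rule mult_right_mono) (use t s in auto)
    moreover have "dist (x + t *\<^sub>R s *\<^sub>R v) x = t * (s * norm v)" using t s by (simp add: dist_norm)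
    ultimately have "dist (x + t *\<^sub>R s *\<^sub>R v) x < e" using sn by linarith
    then have "v \<bullet> (h (x + t *\<^sub>R s *\<^sub>R v) *v v) > 0" using e by blast
    then have "\<phi> (x + s *\<^sub>R v) > \<phi> x"
      using t(3) \<open>g x = 0\<close> s by (simp add: matrix_vector_mult_scaleR)
    moreover have "\<phi> (x + s *\<^sub>R v) \<le> \<phi> x" using d(2) sn s by (simp add: dist_norm)
    ultimately show False by simp
  qed
qed

section \<open>Eigenbases and square roots of symmetric matrices\<close>

lemma sym_inner_commute:
  fixes M :: "real ^ 'n ^ 'n"
  assumes "transpose M = M"
  shows "x \<bullet> (M *v y) = (M *v x) \<bullet> y"
  by (metis assms dot_lmul_matrix transpose_matrix_vector)

text \<open>A maximiser of the quadratic form on the unit sphere of V is an eigenvector. The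
  invariant subspace V is general because \<open>sym_eigenbasis\<close> uses the orthogonal
  complement of the eigenvectors found so far.\<close>

lemma sym_has_eigenvector:
  fixes M :: "real ^ 'n ^ 'n"
  assumes M: "transpose M = M" and V: "subspace V" "V \<noteq> {0}" "\<And>x. x \<in> V \<Longrightarrow> M *v x \<in> V"
  shows "\<exists>x l. x \<in> V \<and> norm x = 1 \<and> M *v x = l *\<^sub>R x"
proof -
  have "0 \<in> V" using V(1) by (rule subspace_0)
  then obtain z where z: "z \<in> V" "z \<noteq> 0" using V(2) by blast
  let ?S = "V \<inter> sphere 0 1"
  have "compact ?S" using closed_subspace[OF V(1)] by (simp add: closed_Int_compact)
  moreover have "z /\<^sub>R norm z \<in> ?S" using z subspace_mul[OF V(1)] by auto
  moreover have "continuous_on ?S (\<lambda>x. x \<bullet> (M *v x))" by (intro continuous_intros)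
  ultimately obtain x where x: "x \<in> ?S" "\<And>y. y \<in> ?S \<Longrightarrow> y \<bullet> (M *v y) \<le> x \<bullet> (M *v x)"
    using continuous_attains_sup[of ?S "\<lambda>x. x \<bullet> (M *v x)"] by blast
  define l where "l = x \<bullet> (M *v x)"
  have nx: "x \<in> V" "x \<bullet> x = 1" using x(1) by (auto simp: norm_eq_1)
  have le: "y \<bullet> (M *v y) \<le> l * (y \<bullet> y)" if "y \<in> V" for y
  proof (cases "y = 0")
    case False
    have "y /\<^sub>R norm y \<in> ?S" using False that subspace_mul[OF V(1)] by auto
    from x(2)[OF this] have "(y \<bullet> (M *v y)) / (norm y)\<^sup>2 \<le> l"
      by (simp add: l_def matrix_vector_mult_scaleR power2_eq_square divide_simps)
    then show ?thesis using False
      by (simp add: divide_simps dot_square_norm split: if_splits)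
  qed simp
  define w where "w = M *v x - l *\<^sub>R x"
  have w: "w \<in> V" using nx V by (simp add: w_def subspace_diff subspace_mul)
  \<comment> \<open>The residual w of the eigenvector equation is used as the direction of
    perturbation: maximality at x makes this quadratic polynomial in t nonpositive, and its linear
    coefficient is twice the squared length of w.\<close>
  have key: "2 * t * (w \<bullet> w) + t\<^sup>2 * (w \<bullet> (M *v w) - l * (w \<bullet> w)) \<le> 0" for t
  proof -
    have 1: "(x + t *\<^sub>R w) \<bullet> (M *v (x + t *\<^sub>R w)) = l + 2 * t * (w \<bullet> (M *v x)) + t\<^sup>2 * (w \<bullet> (M *v w))"
      using sym_inner_commute[OF M, of x w]
      by (simp add: matrix_vector_right_distrib matrix_vector_mult_scaleR inner_add_left inner_add_right
          l_def power2_eq_square algebra_simps inner_commute)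
    have 2: "(x + t *\<^sub>R w) \<bullet> (x + t *\<^sub>R w) = 1 + 2 * t * (w \<bullet> x) + t\<^sup>2 * (w \<bullet> w)"
      using nx by (simp add: inner_add_left inner_add_right power2_eq_square algebra_simps inner_commute)
    have "x + t *\<^sub>R w \<in> V" using nx w V by (simp add: subspace_add subspace_mul)
    from le[OF this] have "(x + t *\<^sub>R w) \<bullet> (M *v (x + t *\<^sub>R w)) \<le> l * ((x + t *\<^sub>R w) \<bullet> (x + t *\<^sub>R w))" .
    then have "l + 2 * t * (w \<bullet> (M *v x)) + t\<^sup>2 * (w \<bullet> (M *v w)) \<le> l * (1 + 2 * t * (w \<bullet> x) + t\<^sup>2 * (w \<bullet> w))"
      by (subst (asm) 1, subst (asm) 2)
    moreover have "w \<bullet> w = w \<bullet> (M *v x) - l * (w \<bullet> x)" by (subst (2) w_def) (simp add: inner_diff_right)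
    ultimately show ?thesis
      by (simp only: ring_distribs) (simp add: algebra_simps)
  qed
  have "w \<bullet> w = 0"
  proof (rule ccontr)
    assume "w \<bullet> w \<noteq> 0"
    then have p: "w \<bullet> w > 0" by simp
    define b where "b = \<bar>w \<bullet> (M *v w) - l * (w \<bullet> w)\<bar> + 1"
    have b: "b > 0" "w \<bullet> (M *v w) - l * (w \<bullet> w) \<ge> - b" by (auto simp: b_def)
    \<comment> \<open>With this t the quadratic term can cancel at most half of the linear
      one.\<close>
    define t where "t = (w \<bullet> w) / b"
    have t: "t > 0" using p b by (simp add: t_def)
    have "t\<^sup>2 * (w \<bullet> (M *v w) - l * (w \<bullet> w)) \<ge> t\<^sup>2 * (- b)" using b by (intro mult_left_mono) auto
    moreover have "t\<^sup>2 * b = t * (w \<bullet> w)" using b by (simp add: t_def power2_eq_square)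
    ultimately have "2 * t * (w \<bullet> w) - t * (w \<bullet> w) \<le> 0" using key[of t] by simp
    moreover have "t * (w \<bullet> w) > 0" using t p by simp
    ultimately show False by simp
  qed
  then have "M *v x = l *\<^sub>R x" by (simp add: w_def)
  then show ?thesis using x(1) by auto
qed

text \<open>Take an orthonormal set of eigenvectors of maximal cardinality. If it did not span, its
  orthogonal complement would be a nontrivial invariant subspace and would supply one more.\<close>

lemma sym_eigenbasis:
  fixes M :: "real ^ 'n ^ 'n"
  assumes M: "transpose M = M"
  shows "\<exists>f l. (\<forall>i j. f i \<bullet> f j = (if i = j then 1 else 0)) \<and> (\<forall>i::'n. M *v f i = l i *\<^sub>R f i)"
proof -
  define P where "P B \<longleftrightarrow> pairwise orthogonal B \<and> (\<forall>b\<in>B. norm b = 1 \<and> (\<exists>l. M *v b = l *\<^sub>R b))" for B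
  have ind: "independent B" if "P B" for B
  proof -
    have "0 \<notin> B" using that by (metis P_def norm_zero zero_neq_one)
    then show ?thesis using that pairwise_orthogonal_independent[of B] by (simp add: P_def)
  qed
  have bound: "finite B \<and> card B \<le> CARD('n)" if "P B" for B
    using independent_bound[OF ind[OF that]] by simp
  have "P {}" by (simp add: P_def)
  then have "\<exists>B. P B \<and> (\<forall>C. P C \<longrightarrow> card C \<le> card B)"
    using ex_has_greatest_nat[of P "{}" card "Suc CARD('n)"] bound by fastforce
  then obtain B where B: "P B" "\<And>C. P C \<Longrightarrow> card C \<le> card B" by blast
  have sp: "span B = UNIV"
  proof (rule ccontr)
    assume ne: "span B \<noteq> UNIV"
    define V where "V = {x. \<forall>b\<in>B. b \<bullet> x = 0}"
    have V: "subspace V"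
      by (auto simp: V_def subspace_def inner_add_right)
    obtain a where a: "a \<noteq> 0" "\<And>x. x \<in> span B \<Longrightarrow> a \<bullet> x = 0"
      using span_not_UNIV_orthogonal[OF ne] by blast
    then have "a \<in> V" by (auto simp: V_def span_base inner_commute)
    then have "V \<noteq> {0}" using a by auto
    have inv: "M *v x \<in> V" if "x \<in> V" for x
      unfolding V_def
    proof safe
      fix b assume b: "b \<in> B"
      then obtain l where "M *v b = l *\<^sub>R b" using B(1) by (auto simp: P_def)
      then show "b \<bullet> (M *v x) = 0" using that b by (simp add: sym_inner_commute[OF M] V_def)
    qed
    obtain x l where x: "x \<in> V" "norm x = 1" "M *v x = l *\<^sub>R x"
      using sym_has_eigenvector[OF M V \<open>V \<noteq> {0}\<close> inv] by blast
    have "x \<notin> B"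
    proof
      assume "x \<in> B"
      then have "x \<bullet> x = 0" using x(1) by (auto simp: V_def)
      then show False using x(2) by auto
    qed
    moreover have "P (insert x B)"
      using x B(1) by (auto simp: P_def V_def pairwise_insert orthogonal_def inner_commute)
    ultimately show False using B(2)[of "insert x B"] bound[OF B(1)] by auto
  qed
  have "card B = CARD('n)"
    using dim_span_eq_card_independent[OF ind[OF B(1)]] sp by simp
  then obtain f where f: "bij_betw f (UNIV :: 'n set) B"
    using bound[OF B(1)] finite_same_card_bij[of "UNIV :: 'n set" B] by auto
  then have fB: "f i \<in> B" for i by (auto simp: bij_betw_def)
  have "\<forall>i. \<exists>l. M *v f i = l *\<^sub>R f i" using fB B(1) by (auto simp: P_def)
  then obtain l where "\<forall>i. M *v f i = l i *\<^sub>R f i" by metis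
  moreover have "f i \<bullet> f j = (if i = j then 1 else 0)" for i j
  proof (cases "i = j")
    case True
    then show ?thesis using fB[of j] B(1) by (auto simp: P_def norm_eq_1)
  next
    case False
    then have "f i \<noteq> f j" using f by (auto simp: bij_betw_def inj_on_def)
    then show ?thesis using fB[of i] fB[of j] B(1) False by (auto simp: P_def pairwise_def orthogonal_def)
  qed
  ultimately show ?thesis by blast
qed

definition orthonormal :: "('n \<Rightarrow> real ^ 'n) \<Rightarrow> bool"
  where "orthonormal f \<longleftrightarrow> (\<forall>i j. f i \<bullet> f j = (if i = j then 1 else 0))"

lemma orthonormal_expand:
  fixes f :: "'n::finite \<Rightarrow> real ^ 'n"
  assumes "orthonormal f"
  shows "(\<Sum>i\<in>UNIV. (x \<bullet> f i) *\<^sub>R f i) = x"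
proof -
  have on: "f i \<bullet> f j = (if i = j then 1 else 0)" for i j using assms by (simp add: orthonormal_def)
  have inj: "inj f"
    by (rule injI) (metis on zero_neq_one)
  have n: "norm (f i) = 1" for i using on[of i i] by (simp add: norm_eq_1)
  have po: "pairwise orthogonal (range f)"
    unfolding pairwise_def orthogonal_def using on by fastforce
  have "0 \<notin> range f" using n by (metis imageE norm_zero zero_neq_one)
  then have ind: "independent (range f)" using pairwise_orthogonal_independent[OF po] by simp
  have "card (range f) = CARD('n)" using inj by (simp add: card_image)
  then have "span (range f) = UNIV"
    using card_eq_dim[of "range f" UNIV] ind by auto
  then have "(\<Sum>b\<in>range f. (x \<bullet> b) *\<^sub>R b) = x"
    using orthonormal_basis_expand[OF po, of x] n by auto
  then show ?thesis by (simp add: sum.reindex[OF inj])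
qed

lemma orthonormal_norm2:
  fixes f :: "'n::finite \<Rightarrow> real ^ 'n"
  assumes "orthonormal f"
  shows "x \<bullet> x = (\<Sum>i\<in>UNIV. (x \<bullet> f i)\<^sup>2)"
  by (subst (2) orthonormal_expand[OF assms, symmetric]) (simp add: inner_sum_right power2_eq_square)

lemma orthonormal_axis: "orthonormal (\<lambda>i. axis i 1)"
  by (simp add: orthonormal_def inner_axis_axis)

text \<open>The square root keeps the eigenvectors. They stay in the conclusion because
  \<open>psd_coupling\<close> compares two roots in their two different eigenbases.\<close>

lemma psd_sqrt:
  fixes M :: "real ^ 'n ^ 'n"
  assumes "sym_psd M"
  shows "\<exists>S f s. transpose S = S \<and> S ** S = M \<and> orthonormal f \<and> (\<forall>i. s i \<ge> 0) \<and>
    (\<forall>i. S *v f i = s i *\<^sub>R f i)"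
proof -
  have M: "transpose M = M" "\<And>v. 0 \<le> v \<bullet> (M *v v)" using assms by (auto simp: sym_psd_def)
  obtain f l where f: "\<And>i j. f i \<bullet> f j = (if i = j then 1 else 0)" "\<And>i::'n. M *v f i = l i *\<^sub>R f i"
    using sym_eigenbasis[OF M(1)] by blast
  have on: "orthonormal f" using f(1) by (simp add: orthonormal_def)
  have l: "l i \<ge> 0" for i using M(2)[of "f i"] f by simp
  define s where "s i = sqrt (l i)" for i
  define S where "S = (\<chi> a b. \<Sum>i\<in>UNIV. s i * f i $ a * f i $ b)"
  have Sv: "S *v v = (\<Sum>i\<in>UNIV. (s i * (f i \<bullet> v)) *\<^sub>R f i)" for v
  proof -
    have "(S *v v) $ a = (\<Sum>i\<in>UNIV. (s i * (f i \<bullet> v)) *\<^sub>R f i) $ a" for a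
    proof -
      have "(S *v v) $ a = (\<Sum>b\<in>UNIV. \<Sum>i\<in>UNIV. s i * f i $ a * f i $ b * v $ b)"
        by (simp add: S_def matrix_vector_mult_def sum_distrib_right)
      also have "\<dots> = (\<Sum>i\<in>UNIV. \<Sum>b\<in>UNIV. s i * f i $ a * f i $ b * v $ b)"
        by (rule sum.swap)
      also have "\<dots> = (\<Sum>i\<in>UNIV. (s i * (f i \<bullet> v)) *\<^sub>R f i) $ a"
        by (simp add: inner_vec_def sum_distrib_left sum_distrib_right algebra_simps)
      finally show ?thesis .
    qed
    then show ?thesis by (simp add: vec_eq_iff)
  qed
  have Sf: "S *v f j = s j *\<^sub>R f j" for j
  proof -
    have "S *v f j = (\<Sum>i\<in>UNIV. if i = j then s j *\<^sub>R f j else 0)"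
      unfolding Sv f(1) by (rule sum.cong) auto
    then show ?thesis by simp
  qed
  have "transpose S = S" by (simp add: S_def transpose_def vec_eq_iff mult.commute mult.left_commute)
  moreover have "S ** S = M"
  proof -
    have "(S ** S) *v v = M *v v" for v
    proof -
      have "(S ** S) *v f i = M *v f i" for i
        using l by (simp add: matrix_vector_mul_assoc[symmetric] Sf f(2) matrix_vector_mult_scaleR s_def)
      then have "(S ** S) *v (\<Sum>i\<in>UNIV. (v \<bullet> f i) *\<^sub>R f i) = M *v (\<Sum>i\<in>UNIV. (v \<bullet> f i) *\<^sub>R f i)"
        by (simp add: linear_sum[OF matrix_vector_mul_linear] matrix_vector_mult_scaleR)
      then show ?thesis by (simp add: orthonormal_expand[OF on])
    qed
    then show ?thesis by (simp add: matrix_eq)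
  qed
  moreover have "\<forall>i. s i \<ge> 0" using l by (simp add: s_def)
  ultimately show ?thesis using on Sf by blast
qed

text \<open>M is the sum of the rank-one matrices built from the \<open>\<xi> i\<close>, expressed
  by duality with the trace. In this form the second-order term is the generator of a random walk
  with steps along \<open>\<xi> i\<close>.\<close>

definition factors :: "real ^ 'n ^ 'n \<Rightarrow> ('n \<Rightarrow> real ^ 'n) \<Rightarrow> bool"
  where "factors M \<xi> \<longleftrightarrow> (\<forall>X. trace (M ** X) = (\<Sum>i\<in>UNIV. \<xi> i \<bullet> (X *v \<xi> i)))"

lemma factors_square:
  fixes S :: "real ^ 'n ^ 'n"
  assumes "transpose S = S"
  shows "factors (S ** S) (\<lambda>i. S *v axis i 1)"
  unfolding factors_def
proof
  fix X :: "real ^ 'n ^ 'n"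
  have "trace ((S ** S) ** X) = trace ((S ** X) ** S)"
    by (metis matrix_mul_assoc trace_mul_sym)
  also have "\<dots> = (\<Sum>i\<in>UNIV. axis i 1 \<bullet> (((S ** X) ** S) *v axis i 1))"
    by (simp add: trace_def inner_axis' matrix_vector_mul_component inner_axis row_def column_def)
  also have "\<dots> = (\<Sum>i\<in>UNIV. (S *v axis i 1) \<bullet> (X *v (S *v axis i 1)))"
    by (simp add: matrix_vector_mul_assoc[symmetric] sym_inner_commute[OF assms])
  finally show "trace ((S ** S) ** X) = (\<Sum>i\<in>UNIV. (S *v axis i 1) \<bullet> (X *v (S *v axis i 1)))" .
qed

lemma trace_psd_nonneg:
  assumes "sym_psd M" "\<And>v. 0 \<le> v \<bullet> (X *v v)"
  shows "0 \<le> trace (M ** X)"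
proof -
  obtain S where S: "transpose S = S" "S ** S = M" using psd_sqrt[OF assms(1)] by blast
  show ?thesis using factors_square[OF S(1)] S(2) assms(2) by (simp add: factors_def sum_nonneg)
qed

text \<open>The factors are the columns of the square roots \<open>S\<close>, \<open>T\<close>. Entries of \<open>S - T\<close> in the mixed basis of eigenvectors
  \<open>f\<close> of \<open>S\<close> and \<open>g\<close> of \<open>T\<close> are \<open>(s - t) (f \<bullet> g)\<close>, so only scalar square roots have to be compared.\<close>

lemma psd_coupling:
  fixes P Q :: "real ^ 'n ^ 'n"
  assumes "sym_psd P" "sym_psd Q" and \<kappa>: "\<kappa> \<ge> 0"
    and close: "\<And>e. \<bar>e \<bullet> (P *v e) - e \<bullet> (Q *v e)\<bar> \<le>
      \<kappa> * norm e * sqrt (e \<bullet> (P *v e)) + \<kappa>\<^sup>2 * (norm e)\<^sup>2"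
  shows "\<exists>\<xi> \<eta>. factors P \<xi> \<and> factors Q \<eta> \<and>
    (\<Sum>i\<in>UNIV. (norm (\<xi> i - \<eta> i))\<^sup>2) \<le> (real CARD('n) * (real CARD('n) + 3))\<^sup>2 * \<kappa>\<^sup>2"
proof -
  obtain S f s where S: "transpose S = S" "S ** S = P" and f: "orthonormal f" and s: "\<And>i. s i \<ge> 0"
    and Sf: "\<And>i. S *v f i = s i *\<^sub>R f i" using psd_sqrt[OF assms(1)] by blast
  obtain T g t where T: "transpose T = T" "T ** T = Q" and g: "orthonormal g" and t: "\<And>i. t i \<ge> 0"
    and Tg: "\<And>i. T *v g i = t i *\<^sub>R g i" using psd_sqrt[OF assms(2)] by blast
  define D where "D = S - T"
  define n where "n = real CARD('n)"
  have n: "n \<ge> 1" unfolding n_def by (simp add: Suc_le_eq)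
  have D: "transpose D = D" using S(1) T(1) by (simp add: D_def transpose_def vec_eq_iff)
  have nf: "norm (f i) = 1" "norm (g i) = 1" for i
    using f g by (simp_all add: orthonormal_def norm_eq_1)
  define \<mu> where "\<mu> i j = f i \<bullet> (D *v g j)" for i j
  have fg: "\<bar>f i \<bullet> g j\<bar> \<le> 1" for i j using Cauchy_Schwarz_ineq2[of "f i" "g j"] nf by simp
  have \<mu>: "\<mu> i j = (s i - t j) * (f i \<bullet> g j)" for i j
  proof -
    have "f i \<bullet> (S *v g j) = s i * (f i \<bullet> g j)" by (simp add: sym_inner_commute[OF S(1)] Sf)
    then show ?thesis
      by (simp add: \<mu>_def D_def matrix_vector_mult_diff_rdistrib inner_diff_right Tg algebra_simps)
  qed
  have \<mu>_le: "\<bar>\<mu> i j\<bar> \<le> s i + t j" for i j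
  proof -
    have "\<bar>\<mu> i j\<bar> = \<bar>s i - t j\<bar> * \<bar>f i \<bullet> g j\<bar>" by (simp add: \<mu> abs_mult)
    also have "\<dots> \<le> \<bar>s i - t j\<bar> * 1" using fg by (intro mult_left_mono) auto
    also have "\<dots> \<le> s i + t j" using s[of i] t[of j] by simp
    finally show ?thesis .
  qed
  have PS: "e \<bullet> (P *v e) = (norm (S *v e))\<^sup>2" for e
    by (simp add: S(2)[symmetric] matrix_vector_mul_assoc[symmetric] sym_inner_commute[OF S(1), of e] power2_norm_eq_inner)
  \<comment> \<open>It suffices to bound the largest mixed entry. There the unknown
    \<open>norm (D *v g j)\<close> is controlled by the entry itself, which closes the
    estimate.\<close>
  obtain i0 j0 where max: "\<And>i j. \<bar>\<mu> i j\<bar> \<le> \<bar>\<mu> i0 j0\<bar>"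
  proof -
    let ?M = "range (\<lambda>q. \<bar>\<mu> (fst q) (snd q)\<bar>)"
    have "Max ?M \<in> ?M" by (rule Max_in) auto
    then obtain p where "Max ?M = \<bar>\<mu> (fst p) (snd p)\<bar>"
      by (rule imageE)
    moreover have "\<bar>\<mu> i j\<bar> \<le> Max ?M" for i j
      by (rule Max_ge) (auto intro: range_eqI[where x="(i, j)"])
    ultimately show ?thesis using that by metis
  qed
  define m where "m = \<bar>\<mu> i0 j0\<bar>"
  have Dg: "norm (D *v g j) \<le> n * m" for j
  proof -
    have "norm (D *v g j) = norm (\<Sum>i\<in>UNIV. ((D *v g j) \<bullet> f i) *\<^sub>R f i)"
      by (simp add: orthonormal_expand[OF f])
    also have "\<dots> \<le> (\<Sum>i\<in>UNIV. \<bar>\<mu> i j\<bar>)"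
      by (rule sum_norm_le) (simp add: nf \<mu>_def inner_commute)
    also have "\<dots> \<le> (\<Sum>i\<in>(UNIV::'n set). m)" by (rule sum_mono) (simp add: m_def max)
    finally show ?thesis by (simp add: n_def)
  qed
  define z where "z = s i0 + t j0"
  have mz: "m \<le> z" using \<mu>_le by (simp add: m_def z_def)
  have m0: "m \<ge> 0" by (simp add: m_def)
  \<comment> \<open>From \<open>P - Q = S ** D + D ** T\<close> the mixed entry of
    \<open>P - Q\<close> is the entry of D multiplied by the sum z of the two eigenvalues. This is
    the lower half of the estimate.\<close>
  have "f i0 \<bullet> ((P - Q) *v g j0) = z * \<mu> i0 j0"
  proof -
    have "f i0 \<bullet> (P *v g j0) = (s i0)\<^sup>2 * (f i0 \<bullet> g j0)"
      by (simp add: S(2)[symmetric] matrix_vector_mul_assoc[symmetric] sym_inner_commute[OF S(1)] Sf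
          matrix_vector_mult_scaleR power2_eq_square)
    moreover have "f i0 \<bullet> (Q *v g j0) = (t j0)\<^sup>2 * (f i0 \<bullet> g j0)"
      by (simp add: T(2)[symmetric] matrix_vector_mul_assoc[symmetric] Tg
          matrix_vector_mult_scaleR power2_eq_square)
    ultimately show ?thesis
      by (simp add: \<mu> z_def matrix_vector_mult_diff_rdistrib inner_diff_right power2_eq_square algebra_simps)
  qed
  \<comment> \<open>The hypothesis \<open>close\<close> speaks of quadratic forms only, so the mixed
    entry is recovered by polarisation with \<open>f i0 + g j0\<close> and
    \<open>f i0 - g j0\<close>. On these vectors S is small because \<open>S *v g j0\<close> differs
    from \<open>T *v g j0\<close> by \<open>D *v g j0\<close>.\<close>
  moreover have "\<bar>f i0 \<bullet> ((P - Q) *v g j0)\<bar> \<le> \<kappa> * (z + n * m) + 2 * \<kappa>\<^sup>2"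
  proof -
    let ?R = "\<lambda>e. e \<bullet> ((P - Q) *v e)"
    have PQ: "transpose (P - Q) = P - Q"
      using assms(1,2) by (simp add: sym_psd_def transpose_def vec_eq_iff)
    have "?R (f i0 + g j0) - ?R (f i0 - g j0) = 4 * (f i0 \<bullet> ((P - Q) *v g j0))"
      using sym_inner_commute[OF PQ, of "f i0" "g j0"]
      by (simp add: matrix_vector_right_distrib matrix_vector_mult_diff_distrib inner_add_left inner_add_right
          inner_diff_left inner_diff_right inner_commute)
    moreover have "\<bar>?R e\<bar> \<le> \<kappa> * 2 * (z + n * m) + \<kappa>\<^sup>2 * 4"
      if e: "norm e \<le> 2" "norm (S *v e) \<le> z + n * m" for e
    proof -
      have "\<bar>?R e\<bar> \<le> \<kappa> * norm e * norm (S *v e) + \<kappa>\<^sup>2 * (norm e)\<^sup>2"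
        using close[of e] by (simp add: PS matrix_vector_mult_diff_rdistrib inner_diff_right)
      moreover have "\<kappa> * norm e * norm (S *v e) \<le> \<kappa> * 2 * (z + n * m)"
        using e \<kappa> by (intro mult_mono) auto
      moreover have "(norm e)\<^sup>2 \<le> 2\<^sup>2" using e by (intro power_mono) auto
      then have "\<kappa>\<^sup>2 * (norm e)\<^sup>2 \<le> \<kappa>\<^sup>2 * 4" by (intro mult_left_mono) auto
      ultimately show ?thesis by linarith
    qed
    moreover have "norm (f i0 + g j0) \<le> 2" "norm (f i0 - g j0) \<le> 2"
      using norm_triangle_ineq[of "f i0" "g j0"] norm_triangle_ineq4[of "f i0" "g j0"] nf by auto
    moreover have "norm (S *v f i0) \<le> s i0" "norm (S *v g j0) \<le> t j0 + n * m"
    proof -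
      show "norm (S *v f i0) \<le> s i0" using s nf by (simp add: Sf)
      have "S *v g j0 = T *v g j0 + D *v g j0" by (simp add: D_def matrix_vector_mult_diff_rdistrib)
      then show "norm (S *v g j0) \<le> t j0 + n * m"
        using norm_triangle_ineq[of "T *v g j0" "D *v g j0"] Dg[of j0] t[of j0] nf by (simp add: Tg)
    qed
    then have "norm (S *v (f i0 + g j0)) \<le> z + n * m" "norm (S *v (f i0 - g j0)) \<le> z + n * m"
      using norm_triangle_ineq[of "S *v f i0" "S *v g j0"] norm_triangle_ineq4[of "S *v f i0" "S *v g j0"]
      by (auto simp: z_def matrix_vector_right_distrib matrix_vector_mult_diff_distrib)
    ultimately have "\<bar>?R (f i0 + g j0)\<bar> \<le> \<kappa> * 2 * (z + n * m) + \<kappa>\<^sup>2 * 4"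
      "\<bar>?R (f i0 - g j0)\<bar> \<le> \<kappa> * 2 * (z + n * m) + \<kappa>\<^sup>2 * 4"
      "?R (f i0 + g j0) - ?R (f i0 - g j0) = 4 * (f i0 \<bullet> ((P - Q) *v g j0))" by blast+
    then show ?thesis by linarith
  qed
  ultimately have zm: "z * m \<le> \<kappa> * (z + n * m) + 2 * \<kappa>\<^sup>2"
    using mz m0 by (simp add: abs_mult m_def)
  \<comment> \<open>In \<open>n + 3\<close> the parts n, 1 and 2 come from the terms with
    \<open>n * m\<close>, z and \<open>2 * \<kappa>\<^sup>2\<close> in \<open>zm\<close>. For larger
    m, \<open>m \<le> z\<close> gives
    \<open>z * (m - (n + 1) * \<kappa>) > 2 * \<kappa> * z\<close>, which is too much.\<close>
  have mb: "m \<le> (n + 3) * \<kappa>"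
  proof (rule ccontr)
    assume "\<not> m \<le> (n + 3) * \<kappa>"
    then have a: "m > (n + 3) * \<kappa>" by simp
    then have mp: "m > 0" using \<kappa> n by (smt (verit) mult_nonneg_nonneg)
    have "\<kappa> * (n * m) \<le> \<kappa> * (n * z)" using mz \<kappa> n by (intro mult_left_mono) auto
    then have "z * (m - (n + 1) * \<kappa>) \<le> 2 * \<kappa>\<^sup>2" using zm by (simp add: algebra_simps)
    moreover have "m - (n + 1) * \<kappa> > 2 * \<kappa>" using a by (simp add: algebra_simps)
    then have "z * (m - (n + 1) * \<kappa>) > z * (2 * \<kappa>)" using mz mp by simp
    moreover have "z \<ge> \<kappa>"
    proof -
      have "(n + 3) * \<kappa> \<ge> 1 * \<kappa>" using n \<kappa> by (intro mult_right_mono) auto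
      then show ?thesis using a mz by simp
    qed
    then have "z * (2 * \<kappa>) \<ge> \<kappa> * (2 * \<kappa>)" using \<kappa> by (intro mult_right_mono) auto
    ultimately show False by (simp add: power2_eq_square)
  qed
  \<comment> \<open>The Frobenius norm does not depend on the orthonormal bases: columns in the
    standard basis are traded for the entries in the bases f and g.\<close>
  have "(\<Sum>k\<in>UNIV. (norm (D *v axis k 1))\<^sup>2) = (\<Sum>k\<in>UNIV. \<Sum>j\<in>UNIV. ((D *v axis k 1) \<bullet> g j)\<^sup>2)"
    by (simp add: power2_norm_eq_inner orthonormal_norm2[OF g])
  also have "\<dots> = (\<Sum>j\<in>UNIV. \<Sum>k\<in>UNIV. ((D *v axis k 1) \<bullet> g j)\<^sup>2)" by (rule sum.swap)
  also have "\<dots> = (\<Sum>j\<in>UNIV. \<Sum>k\<in>UNIV. ((D *v g j) \<bullet> axis k 1)\<^sup>2)"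
  proof -
    have "(D *v axis k 1) \<bullet> g j = (D *v g j) \<bullet> axis k 1" for j k
      using sym_inner_commute[OF D, of "g j" "axis k 1"] inner_commute[of "D *v axis k 1" "g j"] by linarith
    then show ?thesis by simp
  qed
  also have "\<dots> = (\<Sum>j\<in>UNIV. (norm (D *v g j))\<^sup>2)"
    by (simp add: power2_norm_eq_inner orthonormal_norm2[OF orthonormal_axis])
  also have "\<dots> = (\<Sum>j\<in>UNIV. \<Sum>i\<in>UNIV. (\<mu> i j)\<^sup>2)"
    by (simp add: power2_norm_eq_inner orthonormal_norm2[OF f] \<mu>_def inner_commute)
  also have "\<dots> \<le> (\<Sum>j\<in>(UNIV::'n set). \<Sum>i\<in>(UNIV::'n set). ((n + 3) * \<kappa>)\<^sup>2)"
  proof (intro sum_mono)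
    fix i j
    have "\<bar>\<mu> i j\<bar> \<le> \<bar>(n + 3) * \<kappa>\<bar>" using max[of i j] mb by (simp add: m_def)
    then show "(\<mu> i j)\<^sup>2 \<le> ((n + 3) * \<kappa>)\<^sup>2" by (simp add: abs_le_square_iff)
  qed
  also have "\<dots> = (n * (n + 3))\<^sup>2 * \<kappa>\<^sup>2" by (simp add: n_def power_mult_distrib power2_eq_square)
  finally have "(\<Sum>k\<in>UNIV. (norm (S *v axis k 1 - T *v axis k 1))\<^sup>2) \<le> (n * (n + 3))\<^sup>2 * \<kappa>\<^sup>2"
    by (simp add: D_def matrix_vector_mult_diff_rdistrib)
  moreover have "factors P (\<lambda>i. S *v axis i 1)" "factors Q (\<lambda>i. T *v axis i 1)"
    using factors_square[OF S(1)] factors_square[OF T(1)] by (simp_all add: S(2) T(2))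
  ultimately show ?thesis unfolding n_def by blast
qed


section \<open>Mollification\<close>

lemma norm_matrix_vector_le: "norm (M *v v) \<le> norm M * norm v"
  for M :: "real ^ 'n ^ 'm" and v :: "real ^ 'n"
proof -
  have "norm (M *v v) = L2_set (\<lambda>i. norm ((M *v v) $ i)) UNIV" by (simp add: norm_vec_def)
  also have "\<dots> \<le> L2_set (\<lambda>i. norm (M $ i) * norm v) UNIV"
    by (rule L2_set_mono) (auto simp: matrix_vector_mul_component Cauchy_Schwarz_ineq2)
  also have "\<dots> = norm M * norm v"
    by (simp add: L2_set_left_distrib norm_vec_def[of M])
  finally show ?thesis .
qed

lemma abs_quadratic_form_le: "\<bar>v \<bullet> (M *v v)\<bar> \<le> norm M * (norm v)\<^sup>2"
  for M :: "real ^ 'n ^ 'n"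
proof -
  have "\<bar>v \<bullet> (M *v v)\<bar> \<le> norm v * norm (M *v v)" by (rule Cauchy_Schwarz_ineq2)
  also have "\<dots> \<le> norm v * (norm M * norm v)" by (intro mult_left_mono norm_matrix_vector_le) auto
  finally show ?thesis by (simp add: power2_eq_square mult_ac)
qed

text \<open>A convolution with reflected kernel, so derivatives shifted to k acquire a minus sign.
  The cube contains the unit ball, on which the kernels below are supported.\<close>

definition conv :: "(real ^ 'n \<Rightarrow> real) \<Rightarrow> (real ^ 'n \<Rightarrow> 'b::euclidean_space) \<Rightarrow> real ^ 'n \<Rightarrow> 'b"
  where "conv F k x = integral (cbox (- 1) 1) (\<lambda>y. F (x + y) *\<^sub>R k y)"

lemma conv_integrable:
  fixes F :: "real ^ 'n \<Rightarrow> real" and k :: "real ^ 'n \<Rightarrow> 'b::banach"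
  assumes "continuous_on UNIV F" "continuous_on UNIV k"
  shows "(\<lambda>y. F (x + y) *\<^sub>R k y) integrable_on cbox a b"
proof (rule integrable_continuous)
  have "continuous_on (cbox a b) (\<lambda>y. F (x + y))"
    by (rule continuous_on_compose2[OF assms(1)]) (auto intro!: continuous_intros)
  then show "continuous_on (cbox a b) (\<lambda>y. F (x + y) *\<^sub>R k y)"
    by (rule continuous_on_scaleR[OF _ continuous_on_subset[OF assms(2)]]) auto
qed

lemma conv_linear:
  fixes k :: "real ^ 'n \<Rightarrow> 'b::euclidean_space" and L :: "'b \<Rightarrow> 'c::euclidean_space"
  assumes "continuous_on UNIV F" "continuous_on UNIV k" "bounded_linear L"
  shows "L (conv F k x) = conv F (\<lambda>y. L (k y)) x"
  using integral_linear[OF conv_integrable[OF assms(1,2)] assms(3), where x1=x and a1="-1" and b1=1] linear_simps(5)[OF assms(3)]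
  by (simp add: conv_def o_def)

lemma conv_lipschitz:
  fixes k :: "real ^ 'n \<Rightarrow> 'b::euclidean_space"
  assumes F: "N-lipschitz_on UNIV F" and k: "continuous_on UNIV k" "\<And>y. y \<in> cbox (-1) 1 \<Longrightarrow> norm (k y) \<le> B"
  shows "(N * B * measure lborel (cbox (-1) (1::real^'n)))-lipschitz_on UNIV (conv F k)"
proof (rule lipschitz_onI)
  have N: "N \<ge> 0" using F lipschitz_on_nonneg by blast
  have cF: "continuous_on UNIV F" using F lipschitz_on_continuous_on by blast
  have "norm (k 0) \<le> B" by (rule k(2)) (simp add: mem_box_cart)
  then have B: "B \<ge> 0" using norm_ge_zero order_trans by blast
  show "0 \<le> N * B * measure lborel (cbox (-1) (1::real^'n))" using N B by simp
  fix x x' :: "real ^ 'n"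
  have "conv F k x - conv F k x' = integral (cbox (-1) 1) (\<lambda>y. (F (x + y) - F (x' + y)) *\<^sub>R k y)"
    unfolding conv_def
    by (simp add: integral_diff[symmetric] conv_integrable[OF cF k(1)] scaleR_diff_left)
  also have "norm \<dots> \<le> (N * dist x x' * B) * measure lborel (cbox (-1) (1::real^'n))"
  proof (rule has_integral_bound)
    show "0 \<le> N * dist x x' * B" using N B by simp
    have "(\<lambda>y. F (x + y) *\<^sub>R k y - F (x' + y) *\<^sub>R k y) integrable_on cbox (-1) 1"
      by (intro integrable_diff conv_integrable cF k)
    then show "((\<lambda>y. (F (x + y) - F (x' + y)) *\<^sub>R k y) has_integral
      integral (cbox (-1) 1) (\<lambda>y. (F (x + y) - F (x' + y)) *\<^sub>R k y)) (cbox (-1) 1)"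
      by (simp add: scaleR_diff_left integrable_integral)
    fix y :: "real ^ 'n" assume y: "y \<in> cbox (-1) 1"
    have "\<bar>F (x + y) - F (x' + y)\<bar> \<le> N * dist x x'"
      using lipschitz_onD[OF F, of "x + y" "x' + y"] by (simp add: dist_norm)
    then have "\<bar>F (x + y) - F (x' + y)\<bar> * norm (k y) \<le> N * dist x x' * B"
      using k(2)[OF y] N by (intro mult_mono) auto
    then show "norm ((F (x + y) - F (x' + y)) *\<^sub>R k y) \<le> N * dist x x' * B" by simp
  qed
  finally show "dist (conv F k x) (conv F k x') \<le> N * B * measure lborel (cbox (-1) (1::real^'n)) * dist x x'"
    by (simp add: dist_norm mult_ac)
qed

text \<open>F is merely continuous, so the dependence on x is moved to the kernel by the
  substitution of \<open>y - x\<close>, and one differentiates under the integral. This needs a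
  domain of integration that does not move with x.\<close>

lemma conv_has_derivative:
  fixes k :: "real ^ 'n \<Rightarrow> 'b::euclidean_space" and k' :: "real ^ 'n \<Rightarrow> ((real ^ 'n) \<Rightarrow>\<^sub>L 'b)"
  assumes F: "continuous_on UNIV F"
    and k: "\<And>y. (k has_derivative blinfun_apply (k' y)) (at y)" "continuous_on UNIV k'"
    and supp: "\<And>y. norm y > 1 \<Longrightarrow> k y = 0"
  shows "(conv F k has_derivative (\<lambda>v. conv F (\<lambda>y. - blinfun_apply (k' y) v) x0)) (at x0)"
proof -
  have ck: "continuous_on UNIV k"
    using k(1) has_derivative_continuous continuous_at_imp_continuous_on by blast
  have k0: "k y = 0" "k' y = 0" if "y \<notin> cbox (-1) 1" for y
  proof -
    have "\<exists>i. \<not> (- 1 \<le> y $ i \<and> y $ i \<le> 1)" using that by (simp add: mem_box_cart)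
    then obtain i where "\<not> \<bar>y $ i\<bar> \<le> 1" by (auto simp: abs_le_iff)
    then have ny: "norm y > 1" using component_le_norm_cart[of y i] by linarith
    then show "k y = 0" by (rule supp)
    have "open {y::real^'n. norm y > 1}" by (intro open_Collect_less continuous_intros)
    moreover have "((\<lambda>z. 0::'b) has_derivative (\<lambda>_. 0)) (at y)" by simp
    ultimately have "(k has_derivative (\<lambda>_. 0)) (at y)"
      using has_derivative_transform_within_open[of "\<lambda>z. 0::'b" "\<lambda>_. 0" y UNIV "{y. norm y > 1}" k] ny supp
      by simp
    then have "blinfun_apply (k' y) = (\<lambda>_. 0)" using has_derivative_unique k(1) by blast
    then show "k' y = 0" by (simp add: blinfun_eqI)
  qed
  \<comment> \<open>Half-width 2 accommodates every unit cube centred at a point of the unit ball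
    around \<open>x0\<close>.\<close>
  define a b where "a = x0 - 2 *\<^sub>R (1::real^'n)" and "b = x0 + 2 *\<^sub>R (1::real^'n)"
  have incl: "cbox (x - 1) (x + 1) \<subseteq> cbox a b" if "x \<in> ball x0 1" for x
  proof
    fix y assume y: "y \<in> cbox (x - 1) (x + 1)"
    show "y \<in> cbox a b"
      unfolding mem_box_cart
    proof
      fix i
      have "\<bar>(x0 - x) $ i\<bar> \<le> 1" using component_le_norm_cart[of "x0 - x" i] that by (simp add: dist_norm)
      then show "a $ i \<le> y $ i \<and> y $ i \<le> b $ i" using y by (auto simp: mem_box_cart a_def b_def dest!: spec[of _ i])
    qed
  qed
  have conv_eq: "integral (cbox a b) (\<lambda>y. F y *\<^sub>R m (y - x)) = integral (cbox (-1) 1) (\<lambda>y. F (x + y) *\<^sub>R m y)"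
    if x: "x \<in> ball x0 1" and m: "continuous_on UNIV m" "\<And>y. y \<notin> cbox (-1) 1 \<Longrightarrow> m y = 0"
    for x and m :: "real ^ 'n \<Rightarrow> 'c::banach"
  proof -
    have "(\<lambda>y. F y *\<^sub>R m (y - x)) integrable_on cbox (x - 1) (x + 1)"
      by (intro integrable_continuous continuous_intros continuous_on_subset[OF F]
          continuous_on_compose2[OF m(1)]) auto
    then have "((\<lambda>y. F y *\<^sub>R m (y - x)) has_integral
        integral (cbox (x - 1) (x + 1)) (\<lambda>y. F y *\<^sub>R m (y - x))) (cbox a b)"
      by (intro has_integral_on_superset[OF integrable_integral _ incl[OF x]])
         (auto simp: m(2) mem_box_cart algebra_simps)
    moreover have "integral (cbox (-1) 1) (\<lambda>y. F (y + x) *\<^sub>R m (y + x - x)) =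
        integral (cbox (x - 1) (x + 1)) (\<lambda>y. F y *\<^sub>R m (y - x))"
      using integral_shift_cbox[of "x - 1" x "x + 1" "\<lambda>y. F y *\<^sub>R m (y - x)"] by simp
    ultimately show ?thesis by (simp add: integral_unique add.commute)
  qed
  have D: "((\<lambda>x. integral (cbox a b) (\<lambda>y. F y *\<^sub>R k (y - x))) has_derivative
      integral (cbox a b) (\<lambda>y. - (F y *\<^sub>R k' (y - x0)))) (at x0 within ball x0 1)"
  proof (rule leibniz_rule)
    fix x t :: "real ^ 'n"
    have sh: "((\<lambda>x. t - x) has_derivative (\<lambda>v. - v)) (at x within ball x0 1)"
      by (auto intro!: derivative_eq_intros)
    show "((\<lambda>x. F t *\<^sub>R k (t - x)) has_derivative blinfun_apply (- (F t *\<^sub>R k' (t - x)))) (at x within ball x0 1)"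
      by (rule has_derivative_eq_rhs[OF has_derivative_scaleR_right[OF has_derivative_compose[OF sh k(1)]]])
         (simp add: fun_eq_iff blinfun.minus_left blinfun.minus_right blinfun.scaleR_left)
  next
    fix x show "(\<lambda>y. F y *\<^sub>R k (y - x)) integrable_on cbox a b"
      by (intro integrable_continuous continuous_intros continuous_on_subset[OF F]
          continuous_on_compose2[OF ck]) auto
  next
    show "continuous_on (ball x0 1 \<times> cbox a b) (\<lambda>(x, t). - (F t *\<^sub>R k' (t - x)))"
      unfolding split_beta
      by (intro continuous_intros continuous_on_compose2[OF F]
          continuous_on_compose2[OF k(2)]) auto
  qed auto
  have "((\<lambda>x. integral (cbox a b) (\<lambda>y. F y *\<^sub>R k (y - x))) has_derivative
      integral (cbox a b) (\<lambda>y. - (F y *\<^sub>R k' (y - x0)))) (at x0)"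
    using D at_within_open[of x0 "ball x0 1"] by simp
  then have "(conv F k has_derivative integral (cbox a b) (\<lambda>y. - (F y *\<^sub>R k' (y - x0)))) (at x0)"
    by (rule has_derivative_transform_within_open[where s="ball x0 1"])
       (auto simp: conv_def conv_eq[OF _ ck k0(1)])
  moreover have "integral (cbox a b) (\<lambda>y. - (F y *\<^sub>R k' (y - x0))) =
      integral (cbox (-1) 1) (\<lambda>y. F (x0 + y) *\<^sub>R (- k' y))"
    using conv_eq[of x0 "\<lambda>y. - k' y"] k(2) k0(2) by (simp add: continuous_on_minus)
  moreover have A: "blinfun_apply (integral (cbox (-1) 1) (\<lambda>y. F (x0 + y) *\<^sub>R (- k' y))) v =
      conv F (\<lambda>y. - blinfun_apply (k' y) v) x0" for v
  proof -
    have "(\<lambda>y. F (x0 + y) *\<^sub>R (- k' y)) integrable_on cbox (-1) 1"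
      by (intro integrable_continuous continuous_intros continuous_on_compose2[OF F]
          continuous_on_subset[OF k(2)]) auto
    from integral_linear[OF this blinfun.bounded_linear_left[of v]]
    show ?thesis by (simp add: conv_def o_def blinfun.scaleR_left blinfun.minus_left)
  qed
  ultimately have "(conv F k has_derivative
      blinfun_apply (integral (cbox (-1) 1) (\<lambda>y. F (x0 + y) *\<^sub>R (- k' y)))) (at x0)"
    by (simp only:)
  then show ?thesis by (rule has_derivative_eq_rhs) (rule ext, rule A)
qed

lemma has_derivative_lipschitz_bound:
  fixes f :: "'a::real_normed_vector \<Rightarrow> real"
  assumes "N-lipschitz_on UNIV f" "(f has_derivative D) (at x)"
  shows "\<bar>D v\<bar> \<le> N * norm v"
proof -
  have "((\<lambda>t. x + t *\<^sub>R v) has_derivative (\<lambda>s. s *\<^sub>R v)) (at 0)"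
    by (auto intro!: derivative_eq_intros)
  moreover have "(f has_derivative D) (at (x + 0 *\<^sub>R v))" using assms(2) by simp
  ultimately have "((\<lambda>t. f (x + t *\<^sub>R v)) has_derivative (\<lambda>s. D (s *\<^sub>R v))) (at 0)"
    by (rule has_derivative_compose)
  then have "((\<lambda>t. f (x + t *\<^sub>R v)) has_real_derivative D v) (at 0)"
    using bounded_linear.linear[OF has_derivative_bounded_linear[OF assms(2)]]
    by (simp add: has_field_derivative_def linear_cmul mult_commute_abs)
  then have "((\<lambda>t. (f (x + t *\<^sub>R v) - f x) / t) \<longlongrightarrow> D v) (at 0)"
    by (simp add: DERIV_def)
  then have "((\<lambda>t. \<bar>(f (x + t *\<^sub>R v) - f x) / t\<bar>) \<longlongrightarrow> \<bar>D v\<bar>) (at 0)"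
    by (rule tendsto_rabs)
  moreover have "\<bar>(f (x + t *\<^sub>R v) - f x) / t\<bar> \<le> N * norm v" if "t \<noteq> 0" for t
    using lipschitz_onD[OF assms(1), of "x + t *\<^sub>R v" x] that
    by (simp add: dist_norm divide_simps mult_ac)
  then have "\<forall>\<^sub>F t in at 0. \<bar>(f (x + t *\<^sub>R v) - f x) / t\<bar> \<le> N * norm v"
    by (auto simp: eventually_at_filter)
  ultimately show ?thesis by (rule tendsto_upperbound) simp
qed

lemma DERIV_pos_part_power:
  assumes "n \<ge> 1"
  shows "((\<lambda>r::real. (max 0 r) ^ Suc n) has_real_derivative real (Suc n) * (max 0 r) ^ n) (at r)"
proof -
  consider "r > 0" | "r < 0" | "r = 0" by linarith
  then show ?thesis
  proof cases
    case 1
    then have "\<forall>\<^sub>F x in nhds r. x ^ Suc n = (max 0 x) ^ Suc n"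
      by (intro eventually_nhds_in_open[of "{0<..}", THEN eventually_mono]) (auto simp: max_def)
    moreover have "((\<lambda>r. r ^ Suc n) has_real_derivative real (Suc n) * r ^ n) (at r)"
      by (rule derivative_eq_intros refl)+ simp
    ultimately show ?thesis using 1 DERIV_cong_ev by (fastforce simp: max_def)
  next
    case 2
    then have "\<forall>\<^sub>F x in nhds r. 0 = (max 0 x) ^ Suc n"
      by (intro eventually_nhds_in_open[of "{..<0}", THEN eventually_mono]) (auto simp: max_def)
    moreover have "((\<lambda>r. 0) has_real_derivative 0) (at r)" by simp
    ultimately have "((\<lambda>r. (max 0 r) ^ Suc n) has_real_derivative 0) (at r)"
      using DERIV_cong_ev[of r r "\<lambda>r. 0" "\<lambda>r. (max 0 r) ^ Suc n" 0 0] by simp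
    moreover have "real (Suc n) * max 0 r ^ n = 0" using 2 assms by (simp add: max_def)
    ultimately show ?thesis by (simp only:)
  next
    case 3
    have "((\<lambda>h. (max 0 h) ^ Suc n / h) \<longlongrightarrow> 0) (at (0::real))"
    proof (rule Lim_null_comparison)
      show "((\<lambda>h::real. \<bar>h\<bar> ^ n) \<longlongrightarrow> 0) (at 0)"
      proof -
        have "((\<lambda>h::real. \<bar>h\<bar> ^ n) \<longlongrightarrow> \<bar>0\<bar> ^ n) (at 0)" by (intro tendsto_intros)
        moreover have "\<bar>0::real\<bar> ^ n = 0" using assms by (simp add: power_0_left)
        ultimately show ?thesis by (simp only:)
      qed
      show "\<forall>\<^sub>F h in at 0. norm ((max 0 h) ^ Suc n / h) \<le> \<bar>h::real\<bar> ^ n"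
        by (rule always_eventually) (auto simp: max_def abs_mult power_abs)
    qed
    moreover have "real (Suc n) * max 0 r ^ n = 0" using 3 assms by (simp add: max_def)
    moreover from calculation have "((\<lambda>r::real. (max 0 r) ^ Suc n) has_real_derivative 0) (at r)"
      using 3 by (simp add: DERIV_def)
    ultimately show ?thesis by (simp only:)
  qed
qed


text \<open>The exponent 3 is the smallest natural one for which the positive part is C^2 across the
  unit sphere. The function is not normalised; \<open>mollify_unit\<close> divides by its
  integral.\<close>

definition bump :: "real ^ 'n \<Rightarrow> real"
  where "bump y = (max 0 (1 - y \<bullet> y)) ^ 3"

definition bump1 :: "real ^ 'n \<Rightarrow> real ^ 'n"
  where "bump1 y = (- 6 * (max 0 (1 - y \<bullet> y))\<^sup>2) *\<^sub>R y"

definition bump2 :: "real ^ 'n \<Rightarrow> real ^ 'n ^ 'n"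
  where "bump2 y = (24 * max 0 (1 - y \<bullet> y)) *\<^sub>R (\<chi> i j. y $ i * y $ j) - (6 * (max 0 (1 - y \<bullet> y))\<^sup>2) *\<^sub>R mat 1"

lemma pos_part_power_has_derivative:
  assumes "n \<ge> 1"
  shows "((\<lambda>y::real^'n. (max 0 (1 - y \<bullet> y)) ^ Suc n) has_derivative
    (\<lambda>v. - 2 * real (Suc n) * (max 0 (1 - y \<bullet> y)) ^ n * (y \<bullet> v))) (at y)"
proof -
  have "((\<lambda>y::real^'n. 1 - y \<bullet> y) has_derivative (\<lambda>v. - 2 * (y \<bullet> v))) (at y)"
    by (auto intro!: derivative_eq_intros simp: inner_commute)
  from has_derivative_compose[OF this DERIV_pos_part_power[OF assms, unfolded has_field_derivative_def]]
  show ?thesis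
    by (rule has_derivative_eq_rhs) (auto simp: fun_eq_iff algebra_simps)
qed

lemma bump_has_derivative: "(bump has_derivative (\<lambda>v. bump1 y \<bullet> v)) (at y)"
  using pos_part_power_has_derivative[of 2 y]
  by (simp add: bump_def[abs_def] bump1_def eval_nat_numeral mult_ac)

lemma bump1_has_derivative:
  fixes y :: "real ^ 'n"
  shows "(bump1 has_derivative (\<lambda>v. bump2 y *v v)) (at y)"
proof -
  have m: "(\<chi> i j. y $ i * y $ j) *v v = (y \<bullet> v) *\<^sub>R y" for v :: "real ^ 'n"
    by (simp add: matrix_vector_mult_def vec_eq_iff inner_vec_def sum_distrib_left sum_distrib_right mult_ac)
  have 1: "((\<lambda>y::real^'n. (max 0 (1 - y \<bullet> y))\<^sup>2) has_derivative (\<lambda>v. - 4 * max 0 (1 - y \<bullet> y) * (y \<bullet> v))) (at y)"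
    using pos_part_power_has_derivative[of 1 y] by (simp add: eval_nat_numeral)
  have "((\<lambda>y::real^'n. (- 6 * (max 0 (1 - y \<bullet> y))\<^sup>2) *\<^sub>R y) has_derivative
    (\<lambda>v. (- 6 * (max 0 (1 - y \<bullet> y))\<^sup>2) *\<^sub>R v + (- 6 * (- 4 * max 0 (1 - y \<bullet> y) * (y \<bullet> v))) *\<^sub>R y)) (at y)"
    by (rule has_derivative_scaleR[OF has_derivative_mult_right[OF 1] has_derivative_ident])
  then show ?thesis
    by (simp add: bump1_def[abs_def] bump2_def matrix_vector_mult_diff_rdistrib m
        scaleR_matrix_vector_assoc[symmetric] mult_ac)
qed

lemma bump_continuous:
  "continuous_on S bump" "continuous_on S bump1" "continuous_on S bump2"
  unfolding bump_def[abs_def] bump1_def[abs_def] bump2_def[abs_def] by (intro continuous_intros)+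

lemma bump_support:
  assumes "norm y > 1" shows "bump y = 0" "bump1 y = 0"
proof -
  have "y \<bullet> y > 1" using assms by (simp add: dot_square_norm one_less_power)
  then show "bump y = 0" "bump1 y = 0" by (simp_all add: bump_def bump1_def max_def)
qed

lemma conv_bump_c2:
  fixes F :: "real ^ 'n \<Rightarrow> real"
  assumes N: "N-lipschitz_on UNIV F"
  shows "c2_with (conv F bump) (conv F (\<lambda>y. - bump1 y)) (conv F bump2)"
  unfolding c2_with_def
proof (intro conjI allI)
  have F: "continuous_on UNIV F" using N lipschitz_on_continuous_on by blast
  fix x
  have 1: "(bump has_derivative blinfun_apply (blinfun_inner_right (bump1 y))) (at y)" for y :: "real ^ 'n"
    by (simp add: bump_has_derivative)
  have "(conv F bump has_derivative (\<lambda>v. conv F (\<lambda>y. - (bump1 y \<bullet> v)) x)) (at x)"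
    using conv_has_derivative[OF F 1
      bounded_linear.continuous_on[OF bounded_linear_blinfun_inner_right bump_continuous(2)] bump_support(1), of x]
    by simp
  moreover have "conv F (\<lambda>y. - (bump1 y \<bullet> v)) x = conv F (\<lambda>y. - bump1 y) x \<bullet> v" for v
    using conv_linear[OF F, of "\<lambda>y. - bump1 y" "\<lambda>w. w \<bullet> v" x]
    by (simp add: continuous_on_minus bump_continuous bounded_linear_inner_left)
  ultimately show "(conv F bump has_derivative (\<lambda>v. conv F (\<lambda>y. - bump1 y) x \<bullet> v)) (at x)" by simp
  define K where "K y = Blinfun (\<lambda>v. - (bump2 y *v v))" for y :: "real ^ 'n"
  have K: "blinfun_apply (K y) = (\<lambda>v. - (bump2 y *v v))" for y
    unfolding K_def by (rule bounded_linear_Blinfun_apply)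
      (intro bounded_linear_minus matrix_vector_mul_bounded_linear)
  have cK: "continuous_on UNIV K"
    by (rule continuous_on_blinfun_componentwise) (auto simp: K intro!: continuous_intros bump_continuous)
  have "((\<lambda>y. - bump1 y) has_derivative blinfun_apply (K y)) (at y)" for y
    unfolding K by (intro has_derivative_minus bump1_has_derivative)
  from conv_has_derivative[OF F this cK, of x]
  have "(conv F (\<lambda>y. - bump1 y) has_derivative (\<lambda>v. conv F (\<lambda>y. bump2 y *v v) x)) (at x)"
    by (simp add: bump_support(2) K)
  moreover have "conv F (\<lambda>y. bump2 y *v v) x = conv F bump2 x *v v" for v
  proof -
    have "bounded_linear (\<lambda>M::real^'n^'n. M *v v)"
      by (rule linear_conv_bounded_linear[THEN iffD1], rule linearI)
         (auto simp: matrix_vector_mult_add_rdistrib scaleR_matrix_vector_assoc)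
    from conv_linear[OF F bump_continuous(3) this, of x] show ?thesis by simp
  qed
  ultimately show "(conv F (\<lambda>y. - bump1 y) has_derivative (\<lambda>v. conv F bump2 x *v v)) (at x)" by simp
next
  have "compact (bump2 ` cbox (-1) (1::real^'n))"
    by (rule compact_continuous_image[OF bump_continuous(3) compact_cbox])
  then have "bounded (bump2 ` cbox (-1) (1::real^'n))" by (rule compact_imp_bounded)
  then obtain B where "\<forall>z\<in>bump2 ` cbox (-1) (1::real^'n). norm z \<le> B" unfolding bounded_iff by metis
  then have "\<And>y::real^'n. y \<in> cbox (-1) 1 \<Longrightarrow> norm (bump2 y) \<le> B" by simp
  from conv_lipschitz[OF N bump_continuous(3) this] show "continuous_on UNIV (conv F bump2)"
    using lipschitz_on_continuous_on by blast
qed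


lemma matrix_norm_le_entries:
  fixes M :: "real ^ 'n ^ 'n"
  assumes "\<And>i j. \<bar>M $ i $ j\<bar> \<le> B"
  shows "norm M \<le> real CARD('n) * (real CARD('n) * B)"
proof -
  have "norm M \<le> (\<Sum>i\<in>UNIV. norm (M $ i))" by (simp add: norm_vec_def L2_set_le_sum)
  also have "\<dots> \<le> (\<Sum>i\<in>(UNIV::'n set). \<Sum>j\<in>(UNIV::'n set). B)"
  proof (rule sum_mono)
    fix i
    have "norm (M $ i) \<le> (\<Sum>j\<in>UNIV. \<bar>M $ i $ j\<bar>)" by (rule norm_le_l1_cart)
    also have "\<dots> \<le> (\<Sum>j\<in>(UNIV::'n set). B)" by (rule sum_mono) (rule assms)
    finally show "norm (M $ i) \<le> (\<Sum>j\<in>(UNIV::'n set). B)" .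
  qed
  finally show ?thesis by simp
qed

text \<open>All derivatives fall on a fixed kernel, so they inherit Lipschitz bounds that are linear
  in N with factors depending on the dimension only. Linearity in N is what allows the rescaling in
  \<open>mollify\<close>.\<close>

lemma mollify_unit:
  "\<exists>K\<ge>0. \<forall>F::real ^ 'n \<Rightarrow> real. \<forall>N. N-lipschitz_on UNIV F \<longrightarrow>
    (\<exists>\<phi> g h. c2_with \<phi> g h \<and> (\<forall>x. F x \<le> \<phi> x \<and> \<phi> x \<le> F x + 2 * N) \<and>
      (\<forall>x. norm (g x) \<le> K * N) \<and> (\<forall>x. norm (h x) \<le> K * N) \<and> (K * N)-lipschitz_on UNIV h)"
proof -
  define c where "c = measure lborel (cbox (-1) (1::real^'n))"
  have c0: "c \<ge> 0" by (simp add: c_def)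
  let ?Q = "cbox (-1) (1::real^'n)"
  have bdd: "\<exists>B\<ge>0. \<forall>y\<in>?Q. norm (k y) \<le> B"
    if "continuous_on UNIV k" for k :: "real ^ 'n \<Rightarrow> 'c::real_normed_vector"
  proof -
    have "bounded (k ` ?Q)"
      using that by (intro compact_imp_bounded compact_continuous_image compact_cbox) (rule continuous_on_subset, auto)
    then obtain B where "\<forall>y\<in>?Q. norm (k y) \<le> B" unfolding bounded_iff by blast
    then have "\<forall>y\<in>?Q. norm (k y) \<le> max 0 B" by (auto intro: max.coboundedI2)
    then show ?thesis by (intro exI[of _ "max 0 B"]) auto
  qed
  obtain B0 where B0: "B0 \<ge> 0" "\<And>y::real^'n. y \<in> ?Q \<Longrightarrow> norm (bump y) \<le> B0"
    using bdd[OF bump_continuous(1)] by blast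
  obtain B1 where B1: "B1 \<ge> 0" "\<And>y::real^'n. y \<in> ?Q \<Longrightarrow> norm (- bump1 y) \<le> B1"
    using bdd[OF continuous_on_minus[OF bump_continuous(2)]] by blast
  obtain B2 where B2: "B2 \<ge> 0" "\<And>y::real^'n. y \<in> ?Q \<Longrightarrow> norm (bump2 y) \<le> B2"
    using bdd[OF bump_continuous(3)] by blast
  define Z where "Z = integral ?Q bump"
  have int: "bump integrable_on ?Q" by (rule integrable_continuous[OF bump_continuous(1)])
  have bump0: "bump y \<ge> 0" for y :: "real ^ 'n" by (simp add: bump_def)
  have "Z \<noteq> 0"
  proof
    assume "Z = 0"
    then have I: "(bump has_integral 0) ?Q" using int by (simp add: Z_def has_integral_iff)
    have "bump (0::real^'n) = 0"
      by (rule has_integral_0_cbox_imp_0[OF bump_continuous(1) bump0 I])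
         (auto simp: mem_box_cart interval_ne_empty_cart)
    then show False by (simp add: bump_def)
  qed
  moreover have "Z \<ge> 0" unfolding Z_def by (rule integral_nonneg[OF int]) (rule bump0)
  ultimately have Z: "Z > 0" by simp
  define n where "n = real CARD('n)"
  have n: "n \<ge> 0" by (simp add: n_def)
  define K where "K = (B0 + n * (n * B1) + B1 + B2) * c / Z"
  have K: "K \<ge> 0" using B0 B1 B2 c0 Z n by (simp add: K_def)
  show ?thesis
  proof (intro exI[of _ K] conjI K allI impI)
    fix F :: "real ^ 'n \<Rightarrow> real" and N assume F: "N-lipschitz_on UNIV F"
    have N: "N \<ge> 0" using F lipschitz_on_nonneg by blast
    have cF: "continuous_on UNIV F" using F lipschitz_on_continuous_on by blast
    define \<phi> where "\<phi> x = inverse Z * conv F bump x" for x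
    define g where "g x = inverse Z *\<^sub>R conv F (\<lambda>y. - bump1 y) x" for x
    define h where "h x = inverse Z *\<^sub>R conv F bump2 x" for x
    have c2: "c2_with \<phi> g h"
      using c2_with_scale[OF conv_bump_c2[OF F], of "inverse Z"] by (simp add: \<phi>_def[abs_def] g_def[abs_def] h_def[abs_def])
    have lip\<phi>: "(N * B0 * c / Z)-lipschitz_on UNIV \<phi>"
      using lipschitz_on_cmult[OF conv_lipschitz[OF F bump_continuous(1) B0(2)], of "inverse Z"] Z
      by (simp add: \<phi>_def[abs_def] c_def divide_inverse mult_ac)
    have lipg: "(N * B1 * c / Z)-lipschitz_on UNIV g"
      using lipschitz_on_cmult[OF conv_lipschitz[OF F continuous_on_minus[OF bump_continuous(2)] B1(2)], of "inverse Z"] Z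
      by (simp add: g_def[abs_def] c_def divide_inverse mult_ac)
    have liph: "(N * B2 * c / Z)-lipschitz_on UNIV h"
      using lipschitz_on_cmult[OF conv_lipschitz[OF F bump_continuous(3) B2(2)], of "inverse Z"] Z
      by (simp add: h_def[abs_def] c_def divide_inverse mult_ac)
    have KN: "t * c / Z * N \<le> K * N" if "t \<le> B0 + n * (n * B1) + B1 + B2" for t
      using that c0 Z N by (simp add: K_def divide_right_mono mult_right_mono)
    have close: "\<bar>\<phi> x - F x\<bar> \<le> N" for x
    proof -
      have I: "(\<lambda>y. F (x + y) *\<^sub>R bump y) integrable_on ?Q" by (rule conv_integrable[OF cF bump_continuous(1)])
      have "conv F bump x - F x * Z = integral ?Q (\<lambda>y. F (x + y) *\<^sub>R bump y - F x * bump y)"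
        unfolding conv_def Z_def using I int
        integrable_cmul[OF int, of "F x"] by (subst integral_diff) auto
      also have "\<bar>\<dots>\<bar> \<le> integral ?Q (\<lambda>y. N * bump y)"
      proof -
        have "norm (integral ?Q (\<lambda>y. F (x + y) *\<^sub>R bump y - F x * bump y)) \<le> integral ?Q (\<lambda>y. N * bump y)"
        proof (rule integral_norm_bound_integral)
          show "(\<lambda>y. F (x + y) *\<^sub>R bump y - F x * bump y) integrable_on ?Q"
            using I integrable_cmul[OF int, of "F x"] by (intro integrable_diff) simp_all
          show "(\<lambda>y. N * bump y) integrable_on ?Q" using integrable_cmul[OF int, of N] by simp
          fix y :: "real ^ 'n"
          show "norm (F (x + y) *\<^sub>R bump y - F x * bump y) \<le> N * bump y"
          proof (cases "norm y > 1")
            case True then show ?thesis by (simp add: bump_support)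
          next
            case False
            have "\<bar>F (x + y) - F x\<bar> \<le> N * norm y" using lipschitz_onD[OF F, of "x + y" x] by (simp add: dist_norm)
            also have "\<dots> \<le> N * 1" using False N by (intro mult_left_mono) auto
            finally have "\<bar>F (x + y) - F x\<bar> * bump y \<le> N * bump y" using bump0[of y] by (intro mult_right_mono) auto
            then show ?thesis using bump0[of y] by (simp add: abs_mult left_diff_distrib[symmetric])
          qed
        qed
        then show ?thesis by simp
      qed
      also have "\<dots> = N * Z" by (simp add: Z_def)
      finally have "\<bar>conv F bump x - F x * Z\<bar> \<le> N * Z" .
      moreover have "conv F bump x = \<phi> x * Z" using Z by (simp add: \<phi>_def)
      ultimately have "\<bar>\<phi> x - F x\<bar> * Z \<le> N * Z" using Z by (simp add: left_diff_distrib[symmetric] abs_mult)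
      then show ?thesis using Z by simp
    qed
    show "\<exists>\<phi> g h. c2_with \<phi> g h \<and> (\<forall>x. F x \<le> \<phi> x \<and> \<phi> x \<le> F x + 2 * N) \<and>
      (\<forall>x. norm (g x) \<le> K * N) \<and> (\<forall>x. norm (h x) \<le> K * N) \<and> (K * N)-lipschitz_on UNIV h"
    \<comment> \<open>The kernel lives in the unit ball, hence the average deviates from F by at
      most N; adding N turns it into a majorant.\<close>
    proof (intro exI[of _ "\<lambda>x. \<phi> x + N"] exI[of _ g] exI[of _ h] conjI allI)
      show "c2_with (\<lambda>x. \<phi> x + N) g h"
        using c2_with_add[OF c2 c2_with_linear[of N 0 0]] by simp
      fix x
      show "F x \<le> \<phi> x + N" "\<phi> x + N \<le> F x + 2 * N" using close[of x] by linarith+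
      have "(\<phi> has_derivative (\<lambda>v. g x \<bullet> v)) (at x)" using c2 by (simp add: c2_with_def)
      from has_derivative_lipschitz_bound[OF lip\<phi> this, of "g x"]
      have "g x \<bullet> g x \<le> N * B0 * c / Z * norm (g x)" by linarith
      then have "norm (g x) * norm (g x) \<le> (B0 * c / Z * N) * norm (g x)"
        by (simp add: dot_square_norm power2_eq_square mult_ac)
      then have "norm (g x) \<le> B0 * c / Z * N"
        using mult_right_le_imp_le[of "norm (g x)" "norm (g x)" "B0 * c / Z * N"] B0(1) c0 Z N
        by (cases "norm (g x) > 0") auto
      also have "\<dots> \<le> K * N" using KN B1 B2 n by simp
      finally show "norm (g x) \<le> K * N" .
      have "\<bar>h x $ i $ j\<bar> \<le> N * B1 * c / Z" for i j
      proof -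
        have "(N * B1 * c / Z)-lipschitz_on UNIV (\<lambda>x. g x $ i)"
          using lipschitz_on_compose2[OF lipg, of 1 "\<lambda>v. v $ i"] component_le_norm_cart
          by (auto simp: lipschitz_on_def dist_norm simp flip: vector_minus_component intro: order_trans)
        moreover have "((\<lambda>x. g x $ i) has_derivative (\<lambda>v. (h x *v v) $ i)) (at x)"
          by (rule bounded_linear.has_derivative[OF bounded_linear_vec_nth]) (use c2 in \<open>simp add: c2_with_def\<close>)
        ultimately have "\<bar>(h x *v axis j 1) $ i\<bar> \<le> N * B1 * c / Z * norm (axis j (1::real) :: real^'n)"
          by (rule has_derivative_lipschitz_bound)
        then show ?thesis by (simp add: matrix_vector_mul_component inner_axis)
      qed
      then have "norm (h x) \<le> n * (n * (N * B1 * c / Z))" unfolding n_def by (rule matrix_norm_le_entries)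
      also have "\<dots> = (n * (n * B1)) * c / Z * N" by (simp add: field_simps)
      also have "\<dots> \<le> K * N" using KN[of "n * (n * B1)"] B0 B1 B2 by simp
      finally show "norm (h x) \<le> K * N" .
    next
      have "N * B2 * c / Z \<le> K * N" using KN[of B2] B0 B1 n by (simp add: mult_ac)
      then show "(K * N)-lipschitz_on UNIV h" using lipschitz_on_le[OF liph] by simp
    qed
  qed
qed

text \<open>\<open>K\<close> precedes \<open>F\<close> because the smoothing is applied to the difference quotients of one function at all
  small scales.\<close>

lemma mollify:
  assumes "N \<ge> 0" "\<eta> > 0"
  shows "\<exists>K\<ge>0. \<forall>F::real ^ 'n \<Rightarrow> real. N-lipschitz_on UNIV F \<longrightarrow>
    (\<exists>\<phi> g h. c2_with \<phi> g h \<and> (\<forall>x. F x \<le> \<phi> x \<and> \<phi> x \<le> F x + \<eta>) \<and>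
      (\<forall>x. norm (g x) \<le> K) \<and> (\<forall>x. norm (h x) \<le> K) \<and> K-lipschitz_on UNIV h)"
proof -
  obtain K0 where K0: "K0 \<ge> 0" "\<And>F::real ^ 'n \<Rightarrow> real. \<And>N. N-lipschitz_on UNIV F \<Longrightarrow>
    (\<exists>\<phi> g h. c2_with \<phi> g h \<and> (\<forall>x. F x \<le> \<phi> x \<and> \<phi> x \<le> F x + 2 * N) \<and>
      (\<forall>x. norm (g x) \<le> K0 * N) \<and> (\<forall>x. norm (h x) \<le> K0 * N) \<and> (K0 * N)-lipschitz_on UNIV h)"
    using mollify_unit by blast
  \<comment> \<open>The rescaled function \<open>\<lambda>x. F (\<delta> *\<^sub>R x)\<close> has
    Lipschitz constant \<open>N * \<delta>\<close>, so \<open>mollify_unit\<close> is applied to it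
    with error at most \<open>\<eta>\<close>.\<close>
  define \<delta> where "\<delta> = \<eta> / (2 * (N + 1))"
  have \<delta>: "\<delta> > 0" using assms by (simp add: \<delta>_def)
  have N\<delta>: "2 * (N * \<delta>) \<le> \<eta>" using assms by (simp add: \<delta>_def field_simps)
  define i where "i = inverse \<delta>"
  have i: "i > 0" "\<delta> * i = 1" using \<delta> by (simp_all add: i_def)
  \<comment> \<open>Scaling back multiplies gradient, Hessian and the Lipschitz constant of the
    Hessian by the first, second and third power of \<open>i\<close>.\<close>
  define K where "K = K0 * (N * \<delta>) * (i + i\<^sup>2 + i\<^sup>2 * i)"
  have K: "K \<ge> 0" using K0 assms \<delta> i by (simp add: K_def)
  have le: "t * (K0 * (N * \<delta>)) \<le> K" if "t \<le> i + i\<^sup>2 + i\<^sup>2 * i" for t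
    using mult_right_mono[OF that, of "K0 * (N * \<delta>)"] K0 assms \<delta> by (simp add: K_def mult_ac)
  show ?thesis
  proof (intro exI[of _ K] conjI K allI impI)
    fix F :: "real ^ 'n \<Rightarrow> real" assume F: "N-lipschitz_on UNIV F"
    have "(N * \<delta>)-lipschitz_on UNIV (\<lambda>x. F (\<delta> *\<^sub>R x))"
    proof (rule lipschitz_onI)
      fix x y
      have "dist (F (\<delta> *\<^sub>R x)) (F (\<delta> *\<^sub>R y)) \<le> N * dist (\<delta> *\<^sub>R x) (\<delta> *\<^sub>R y)"
        using lipschitz_onD[OF F] by blast
      also have "\<dots> = N * \<delta> * dist x y" using \<delta> by (simp add: dist_norm scaleR_diff_right[symmetric])
      finally show "dist (F (\<delta> *\<^sub>R x)) (F (\<delta> *\<^sub>R y)) \<le> N * \<delta> * dist x y" .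
    qed (use assms \<delta> in auto)
    from K0(2)[OF this] obtain \<phi> g h where c2: "c2_with \<phi> g h"
      and b: "\<And>x. F (\<delta> *\<^sub>R x) \<le> \<phi> x \<and> \<phi> x \<le> F (\<delta> *\<^sub>R x) + 2 * (N * \<delta>)"
      and g: "\<And>x. norm (g x) \<le> K0 * (N * \<delta>)" and h: "\<And>x. norm (h x) \<le> K0 * (N * \<delta>)"
      and hl: "(K0 * (N * \<delta>))-lipschitz_on UNIV h" by blast
    show "\<exists>\<phi> g h. c2_with \<phi> g h \<and> (\<forall>x. F x \<le> \<phi> x \<and> \<phi> x \<le> F x + \<eta>) \<and>
      (\<forall>x. norm (g x) \<le> K) \<and> (\<forall>x. norm (h x) \<le> K) \<and> K-lipschitz_on UNIV h"
    proof (intro exI conjI allI)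
      show "c2_with (\<lambda>x. \<phi> (i *\<^sub>R x)) (\<lambda>x. i *\<^sub>R g (i *\<^sub>R x)) (\<lambda>x. i\<^sup>2 *\<^sub>R h (i *\<^sub>R x))"
        using c2_with_affine[OF c2, of i 0] by simp
      fix x
      show "F x \<le> \<phi> (i *\<^sub>R x)" "\<phi> (i *\<^sub>R x) \<le> F x + \<eta>"
        using b[of "i *\<^sub>R x"] i(2) N\<delta> by (simp_all add: mult.commute)
      have "norm (i *\<^sub>R g (i *\<^sub>R x)) \<le> i * (K0 * (N * \<delta>))" using g i by simp
      also have "\<dots> \<le> K" using i by (intro le) simp
      finally show "norm (i *\<^sub>R g (i *\<^sub>R x)) \<le> K" .
      have "norm (i\<^sup>2 *\<^sub>R h (i *\<^sub>R x)) \<le> i\<^sup>2 * (K0 * (N * \<delta>))" using h i by (simp add: mult_left_mono)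
      also have "\<dots> \<le> K" using i by (intro le) simp
      finally show "norm (i\<^sup>2 *\<^sub>R h (i *\<^sub>R x)) \<le> K" .
    next
      show "K-lipschitz_on UNIV (\<lambda>x. i\<^sup>2 *\<^sub>R h (i *\<^sub>R x))"
      proof (rule lipschitz_onI[OF _ K])
        fix x y
        have "dist (i\<^sup>2 *\<^sub>R h (i *\<^sub>R x)) (i\<^sup>2 *\<^sub>R h (i *\<^sub>R y)) = i\<^sup>2 * dist (h (i *\<^sub>R x)) (h (i *\<^sub>R y))"
          by (simp add: dist_norm scaleR_diff_right[symmetric])
        also have "\<dots> \<le> i\<^sup>2 * (K0 * (N * \<delta>) * dist (i *\<^sub>R x) (i *\<^sub>R y))"
          using lipschitz_onD[OF hl] by (intro mult_left_mono) auto
        also have "\<dots> = (i\<^sup>2 * i) * (K0 * (N * \<delta>)) * dist x y"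
          using i by (simp add: dist_norm scaleR_diff_right[symmetric] mult_ac)
        also have "\<dots> \<le> K * dist x y" using i by (intro mult_right_mono le) auto
        finally show "dist (i\<^sup>2 *\<^sub>R h (i *\<^sub>R x)) (i\<^sup>2 *\<^sub>R h (i *\<^sub>R y)) \<le> K * dist x y" .
      qed
    qed
  qed
qed


section \<open>Random walks\<close>

text \<open>The transition operator of the walk whose step is plus or minus one of the
  \<open>\<xi> i\<close>, all equally likely. Values may lie in any real vector space because
  gradients and Hessians are averaged along with the function.\<close>

definition walk :: "('n::finite \<Rightarrow> 'a::real_vector) \<Rightarrow> ('a \<Rightarrow> 'b::real_vector) \<Rightarrow> 'a \<Rightarrow> 'b"
  where "walk \<xi> \<phi> x = (1 / (2 * real CARD('n))) *\<^sub>R (\<Sum>i\<in>UNIV. \<phi> (x + \<xi> i) + \<phi> (x - \<xi> i))"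

lemma walk_mono_pt:
  fixes \<phi> \<psi> :: "'a::real_vector \<Rightarrow> real"
  assumes "\<And>i. \<phi> (x + \<xi> i) \<le> \<psi> (x + \<xi> i)" "\<And>i. \<phi> (x - \<xi> i) \<le> \<psi> (x - \<xi> i)"
  shows "walk \<xi> \<phi> x \<le> walk \<xi> \<psi> x"
  unfolding walk_def by (simp add: divide_right_mono sum_mono add_mono assms)

lemma walk_mono:
  fixes \<phi> \<psi> :: "'a::real_vector \<Rightarrow> real"
  assumes "\<And>x. \<phi> x \<le> \<psi> x"
  shows "walk \<xi> \<phi> x \<le> walk \<xi> \<psi> x"
  by (rule walk_mono_pt; rule assms)

lemma walk_iter_mono:
  fixes \<phi> \<psi> :: "'a::real_vector \<Rightarrow> real"
  assumes "\<And>x. \<phi> x \<le> \<psi> x"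
  shows "(walk \<xi> ^^ k) \<phi> x \<le> (walk \<xi> ^^ k) \<psi> x"
  using assms by (induction k arbitrary: x) (auto intro: walk_mono)

text \<open>The walk cannot get farther than \<open>real k * B\<close> in k steps, so inequalities
  valid on that ball, such as a Taylor estimate, suffice.\<close>

lemma walk_mono_local:
  fixes \<phi> \<psi> :: "'a::real_normed_vector \<Rightarrow> real"
  assumes "\<And>i. norm (\<xi> i) \<le> B" "\<And>y. norm (y - x) \<le> real k * B \<Longrightarrow> \<phi> y \<le> \<psi> y"
  shows "(walk \<xi> ^^ k) \<phi> x \<le> (walk \<xi> ^^ k) \<psi> x"
  using assms(2)
proof (induction k arbitrary: x)
  case (Suc k)
  have *: "(walk \<xi> ^^ k) \<phi> z \<le> (walk \<xi> ^^ k) \<psi> z" if "norm (z - x) \<le> B" for z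
  proof (rule Suc.IH)
    fix y assume "norm (y - z) \<le> real k * B"
    then have "norm (y - x) \<le> real k * B + B"
      using norm_triangle_ineq[of "y - z" "z - x"] that by simp
    then show "\<phi> y \<le> \<psi> y" by (intro Suc.prems) (simp add: algebra_simps)
  qed
  have "(walk \<xi> ^^ k) \<phi> (x + \<xi> i) \<le> (walk \<xi> ^^ k) \<psi> (x + \<xi> i)"
    "(walk \<xi> ^^ k) \<phi> (x - \<xi> i) \<le> (walk \<xi> ^^ k) \<psi> (x - \<xi> i)" for i
    using assms(1)[of i] by (auto intro!: *)
  then have "walk \<xi> ((walk \<xi> ^^ k) \<phi>) x \<le> walk \<xi> ((walk \<xi> ^^ k) \<psi>) x" by (rule walk_mono_pt)
  then show ?case by simp
qed simp

lemma walk_add1: "walk \<xi> (\<lambda>x. \<phi> x + \<psi> x) x = walk \<xi> \<phi> x + walk \<xi> \<psi> x"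
  by (simp add: walk_def sum.distrib algebra_simps)

lemma walk_add: "(walk \<xi> ^^ k) (\<lambda>x. \<phi> x + \<psi> x) x = (walk \<xi> ^^ k) \<phi> x + (walk \<xi> ^^ k) \<psi> x"
proof (induction k arbitrary: x)
  case (Suc k)
  have "(walk \<xi> ^^ k) (\<lambda>x. \<phi> x + \<psi> x) = (\<lambda>x. (walk \<xi> ^^ k) \<phi> x + (walk \<xi> ^^ k) \<psi> x)"
    using Suc by auto
  then show ?case by (simp add: walk_add1)
qed simp

text \<open>On quadratic functions the walk is exact: each step adds the mean of P over the steps.
  With steps scaled by \<open>sqrt (real CARD('n) / real k)\<close> the k steps together add the sum
  of the \<open>P (\<xi> i)\<close>, whatever k is. Linear functions are the case P = 0.\<close>

lemma walk_quadratic: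
  fixes Q :: "'a::real_vector \<Rightarrow> real" and \<xi> :: "'n::finite \<Rightarrow> 'a"
  assumes "\<And>x v. Q (x + v) + Q (x - v) = 2 * Q x + 2 * P v"
  shows "(walk \<xi> ^^ k) Q x = Q x + real k * ((\<Sum>i\<in>UNIV. P (\<xi> i)) / real CARD('n))"
proof (induction k arbitrary: x)
  case (Suc k)
  define s where "s = (\<Sum>i\<in>UNIV. P (\<xi> i)) / real CARD('n)"
  have "(walk \<xi> ^^ k) Q = (\<lambda>x. Q x + real k * s)" using Suc by (auto simp: s_def)
  then have "(walk \<xi> ^^ Suc k) Q x = (1 / (2 * real CARD('n))) * (\<Sum>i\<in>UNIV. 2 * (Q x + P (\<xi> i) + real k * s))"
    using assms by (simp add: walk_def algebra_simps)
  also have "\<dots> = (1 / (2 * real CARD('n))) * (2 * (real CARD('n) * Q x + real CARD('n) * s + real CARD('n) * (real k * s)))"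
    by (simp add: sum.distrib sum_distrib_left[symmetric] s_def)
  also have "\<dots> = Q x + real (Suc k) * s"
    by (simp add: divide_simps) (simp add: algebra_simps)
  finally show ?case by (simp add: s_def)
qed simp

lemma walk_const: "(walk \<xi> ^^ k) (\<lambda>x. c::real) x = c"
  using walk_quadratic[of "\<lambda>_. c" "\<lambda>_. 0"] by simp

text \<open>Projects a walk in a product space to its marginals and to the difference of its
  components.\<close>

lemma walk_compose:
  assumes "\<And>x i. T (x + \<xi> i) = T x + \<eta> i" "\<And>x i. T (x - \<xi> i) = T x - \<eta> i"
  shows "(walk \<xi> ^^ k) (\<lambda>x. \<phi> (T x)) x = (walk \<eta> ^^ k) \<phi> (T x)"
proof (induction k arbitrary: x)
  case (Suc k)
  have "(walk \<xi> ^^ k) (\<lambda>x. \<phi> (T x)) = (\<lambda>x. (walk \<eta> ^^ k) \<phi> (T x))" using Suc by auto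
  moreover have "walk \<xi> (\<lambda>x. \<psi> (T x)) x = walk \<eta> \<psi> (T x)" for \<psi>
    by (simp add: walk_def assms)
  ultimately show ?case by simp
qed simp

lemma walk_convex:
  fixes F :: "'a::real_vector \<Rightarrow> real"
  assumes "convex_on UNIV F"
  shows "F x \<le> (walk \<xi> ^^ k) F x"
proof (induction k arbitrary: x)
  case (Suc k)
  have m: "2 * F x \<le> F (x + v) + F (x - v)" for v
  proof -
    have "F ((1 - 1/2) *\<^sub>R (x + v) + (1/2) *\<^sub>R (x - v)) \<le> (1 - 1/2) * F (x + v) + (1/2) * F (x - v)"
      by (rule convex_onD[OF assms]) auto
    moreover have "(1 - 1/2) *\<^sub>R (x + v) + (1/2) *\<^sub>R (x - v) = x"
      by (simp add: algebra_simps flip: scaleR_add_left)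
    ultimately show ?thesis by simp
  qed
  have "F x = (1 / (2 * real CARD('b))) * (\<Sum>i\<in>(UNIV::'b set). 2 * F x)" by simp
  also have "\<dots> \<le> walk \<xi> F x"
    unfolding walk_def by (simp only: real_scaleR_def, intro mult_left_mono sum_mono m) auto
  also have "\<dots> \<le> walk \<xi> ((walk \<xi> ^^ k) F) x" by (rule walk_mono) (rule Suc)
  finally show ?case by simp
qed simp

definition c2_bounded ::
    "real \<Rightarrow> (real ^ 'n \<Rightarrow> real) \<Rightarrow> (real ^ 'n \<Rightarrow> real ^ 'n) \<Rightarrow> (real ^ 'n \<Rightarrow> real ^ 'n ^ 'n) \<Rightarrow> bool"
  where "c2_bounded K \<phi> g h \<longleftrightarrow> c2_with \<phi> g h \<and> (\<forall>x. norm (g x) \<le> K) \<and> (\<forall>x. norm (h x) \<le> K) \<and>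
    K-lipschitz_on UNIV h"

lemma walk_norm_le:
  fixes f :: "'a::real_vector \<Rightarrow> 'b::real_normed_vector"
  assumes "\<And>x. norm (f x) \<le> K"
  shows "norm (walk \<xi> f x) \<le> K"
proof -
  have "norm (\<Sum>i\<in>(UNIV::'c set). f (x + \<xi> i) + f (x - \<xi> i)) \<le> (\<Sum>i\<in>(UNIV::'c set). 2 * K)"
    by (rule sum_norm_le) (use norm_triangle_le add_mono[OF assms assms] in fastforce)
  then show ?thesis by (simp add: walk_def divide_simps mult_ac)
qed

lemma walk_diff_le:
  fixes f :: "'a::real_normed_vector \<Rightarrow> 'b::real_normed_vector" and \<xi> :: "'n::finite \<Rightarrow> 'a"
  assumes "K-lipschitz_on UNIV f" "\<And>i. norm (\<xi> i) \<le> B"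
  shows "norm (walk \<xi> f x - f x) \<le> K * B"
proof -
  have K: "K \<ge> 0" using assms(1) lipschitz_on_nonneg by blast
  have "walk \<xi> f x - f x = (1 / (2 * real CARD('n))) *\<^sub>R (\<Sum>i\<in>UNIV. (f (x + \<xi> i) - f x) + (f (x - \<xi> i) - f x))"
  proof -
    have "(\<Sum>i\<in>UNIV. (f (x + \<xi> i) - f x) + (f (x - \<xi> i) - f x)) =
        (\<Sum>i\<in>UNIV. f (x + \<xi> i) + f (x - \<xi> i)) - (\<Sum>i\<in>(UNIV::'n set). 2 *\<^sub>R f x)"
      unfolding sum_subtractf[symmetric] by (rule sum.cong) (auto simp: scaleR_2)
    also have "(\<Sum>i\<in>(UNIV::'n set). 2 *\<^sub>R f x) = (2 * real CARD('n)) *\<^sub>R f x"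
      by (simp add: sum_constant_scaleR)
    finally show ?thesis by (simp add: walk_def scaleR_diff_right)
  qed
  also have "norm \<dots> \<le> (1 / (2 * real CARD('n))) * (\<Sum>i\<in>(UNIV::'n set). K * B + K * B)"
  proof -
    have "norm (f (x + v) - f x) \<le> K * B" if "norm v \<le> B" for v
    proof -
      have "norm (f (x + v) - f x) \<le> K * norm v"
        using lipschitz_onD[OF assms(1), of "x + v" x] by (simp add: dist_norm)
      also have "\<dots> \<le> K * B" using that K by (rule mult_left_mono)
      finally show ?thesis .
    qed
    from this[of "\<xi> i" for i] this[of "- \<xi> i" for i] assms(2)
    have "norm ((f (x + \<xi> i) - f x) + (f (x - \<xi> i) - f x)) \<le> K * B + K * B" for i
      by (intro norm_triangle_le add_mono) auto
    then have "norm (\<Sum>i\<in>UNIV. (f (x + \<xi> i) - f x) + (f (x - \<xi> i) - f x)) \<le> (\<Sum>i\<in>(UNIV::'n set). K * B + K * B)"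
      by (intro sum_norm_le)
    then show ?thesis unfolding norm_scaleR by (intro mult_mono) auto
  qed
  also have "\<dots> = K * B" by simp
  finally show ?thesis .
qed

text \<open>Averages of translates inherit each bound with the same K, so a single constant serves
  all iterates.\<close>

lemma c2_bounded_walk:
  assumes "c2_bounded K \<phi> g h"
  shows "c2_bounded K (walk \<xi> \<phi>) (walk \<xi> g) (walk \<xi> h)"
  unfolding c2_bounded_def
proof (intro conjI allI)
  let ?c = "1 / (2 * real CARD('b))"
  have c2: "c2_with \<phi> g h" and K: "\<And>x. norm (g x) \<le> K" "\<And>x. norm (h x) \<le> K" and hl: "K-lipschitz_on UNIV h"
    using assms by (auto simp: c2_bounded_def)
  have "c2_with (\<lambda>x. \<phi> (x + \<xi> i) + \<phi> (x - \<xi> i)) (\<lambda>x. g (x + \<xi> i) + g (x - \<xi> i)) (\<lambda>x. h (x + \<xi> i) + h (x - \<xi> i))" for i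
    using c2_with_add[OF c2_with_affine[OF c2, of 1 "\<xi> i"] c2_with_affine[OF c2, of 1 "- \<xi> i"]] by simp
  from c2_with_scale[OF c2_with_sum[OF finite_class.finite_UNIV this], of ?c]
  show "c2_with (walk \<xi> \<phi>) (walk \<xi> g) (walk \<xi> h)"
    by (simp add: walk_def[abs_def])
  fix x
  show "norm (walk \<xi> g x) \<le> K" "norm (walk \<xi> h x) \<le> K" using walk_norm_le K by blast+
next
  have hl: "K-lipschitz_on UNIV h" using assms by (auto simp: c2_bounded_def)
  show "K-lipschitz_on UNIV (walk \<xi> h)"
  proof (rule lipschitz_onI)
    show "K \<ge> 0" using hl lipschitz_on_nonneg by blast
    fix x y
    have "walk \<xi> h x - walk \<xi> h y = walk \<xi> (\<lambda>z. h (z + (x - y)) - h z) y"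
      by (simp add: walk_def scaleR_diff_right[symmetric] sum_subtractf[symmetric] algebra_simps)
    also have "norm \<dots> \<le> K * norm (x - y)"
    proof (rule walk_norm_le)
      fix z show "norm (h (z + (x - y)) - h z) \<le> K * norm (x - y)"
        using lipschitz_onD[OF hl, of "z + (x - y)" z] by (simp add: dist_norm)
    qed
    finally show "dist (walk \<xi> h x) (walk \<xi> h y) \<le> K * dist x y" by (simp add: dist_norm)
  qed
qed

lemma c2_bounded_walk_iter:
  "c2_bounded K \<phi> g h \<Longrightarrow> c2_bounded K ((walk \<xi> ^^ k) \<phi>) ((walk \<xi> ^^ k) g) ((walk \<xi> ^^ k) h)"
  by (induction k) (auto intro: c2_bounded_walk)

text \<open>A Taylor expansion in which the Hessian at intermediate points is replaced by
  \<open>walk \<xi> h x\<close>, the Hessian after the step. Both replacements cost at most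
  \<open>K * B\<close>. The Hessian after the step is needed because the maximum principle in
  \<open>walk_mean_value\<close> tests with the later iterate.\<close>

lemma walk_step_ge:
  fixes \<xi> :: "'n::finite \<Rightarrow> real ^ 'm"
  assumes "c2_bounded K \<phi> g h" "\<And>i. norm (\<xi> i) \<le> B"
  shows "walk \<xi> \<phi> x - \<phi> x \<ge> (1 / (2 * real CARD('n))) *
    (\<Sum>i\<in>UNIV. \<xi> i \<bullet> (walk \<xi> h x *v \<xi> i) - 2 * K * B * (norm (\<xi> i))\<^sup>2)"
proof -
  have c2: "c2_with \<phi> g h" and hl: "K-lipschitz_on UNIV h" using assms(1) by (auto simp: c2_bounded_def)
  have K: "K \<ge> 0" using hl lipschitz_on_nonneg by blast
  have diff: "v \<bullet> (M *v v) \<ge> v \<bullet> (M' *v v) - D * (norm v)\<^sup>2" if "norm (M - M') \<le> D" for v and M M' :: "real^'m^'m" and D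
  proof -
    have "\<bar>v \<bullet> ((M - M') *v v)\<bar> \<le> norm (M - M') * (norm v)\<^sup>2" by (rule abs_quadratic_form_le)
    also have "\<dots> \<le> D * (norm v)\<^sup>2" using that by (rule mult_right_mono) simp
    finally show ?thesis by (simp add: matrix_vector_mult_diff_rdistrib inner_diff_right)
  qed
  have T: "\<phi> (x + v) \<ge> \<phi> x + g x \<bullet> v + (v \<bullet> (walk \<xi> h x *v v) - 2 * K * B * (norm v)\<^sup>2) / 2"
    if v: "norm v \<le> B" for v
  proof -
    obtain t where t: "0 < t" "t < 1" "\<phi> (x + v) = \<phi> x + g x \<bullet> v + (v \<bullet> (h (x + t *\<^sub>R v) *v v)) / 2"
      using c2_taylor[OF c2] by blast
    have "norm (t *\<^sub>R v) \<le> B"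
      using t v mult_right_mono[of t 1 "norm v"] by simp
    then have "norm (h (x + t *\<^sub>R v) - h x) \<le> K * B"
      using lipschitz_onD[OF hl, of "x + t *\<^sub>R v" x] K mult_left_mono[of "norm (t *\<^sub>R v)" B K]
      by (simp add: dist_norm)
    moreover have "norm (h x - walk \<xi> h x) \<le> K * B"
      using walk_diff_le[where x=x, OF hl assms(2)] by (simp add: norm_minus_commute)
    ultimately have "norm (h (x + t *\<^sub>R v) - walk \<xi> h x) \<le> 2 * K * B"
      using norm_triangle_ineq[of "h (x + t *\<^sub>R v) - h x" "h x - walk \<xi> h x"] by simp
    from diff[OF this, of v] show ?thesis by (simp add: t(3))
  qed
  have "\<phi> (x + \<xi> i) + \<phi> (x - \<xi> i) \<ge> 2 * \<phi> x + (\<xi> i \<bullet> (walk \<xi> h x *v \<xi> i) - 2 * K * B * (norm (\<xi> i))\<^sup>2)" for i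
  proof -
    have "walk \<xi> h x *v (- \<xi> i) = - (walk \<xi> h x *v \<xi> i)"
      using matrix_vector_mult_scaleR[of "walk \<xi> h x" "-1" "\<xi> i"] by simp
    then show ?thesis using T[of "\<xi> i"] T[of "- \<xi> i"] assms(2)[of i] by (simp add: field_simps)
  qed
  then have "(\<Sum>i\<in>UNIV. \<phi> (x + \<xi> i) + \<phi> (x - \<xi> i)) \<ge>
      (\<Sum>i\<in>(UNIV::'n set). 2 * \<phi> x + (\<xi> i \<bullet> (walk \<xi> h x *v \<xi> i) - 2 * K * B * (norm (\<xi> i))\<^sup>2))"
    by (intro sum_mono)
  then have "walk \<xi> \<phi> x \<ge> (1 / (2 * real CARD('n))) * (\<Sum>i\<in>(UNIV::'n set). 2 * \<phi> x + (\<xi> i \<bullet> (walk \<xi> h x *v \<xi> i) - 2 * K * B * (norm (\<xi> i))\<^sup>2))"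
    unfolding walk_def real_scaleR_def by (intro mult_left_mono) auto
  also have "(1 / (2 * real CARD('n))) * (\<Sum>i\<in>(UNIV::'n set). 2 * \<phi> x + (\<xi> i \<bullet> (walk \<xi> h x *v \<xi> i) - 2 * K * B * (norm (\<xi> i))\<^sup>2))
      = \<phi> x + (1 / (2 * real CARD('n))) * (\<Sum>i\<in>(UNIV::'n set). (\<xi> i \<bullet> (walk \<xi> h x *v \<xi> i) - 2 * K * B * (norm (\<xi> i))\<^sup>2))"
    by (subst sum.distrib) (simp add: distrib_left)
  finally show ?thesis by simp
qed


section \<open>Lipschitz truncation of convex functions\<close>

definition inf_conv :: "real \<Rightarrow> ('a::real_normed_vector \<Rightarrow> real) \<Rightarrow> 'a \<Rightarrow> real"
  where "inf_conv N q h = (INF z. q z + N * norm (h - z))"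

lemma inf_conv_le:
  assumes "\<And>z. 0 \<le> q z" "N \<ge> 0"
  shows "inf_conv N q h \<le> q z + N * norm (h - z)"
  unfolding inf_conv_def
  by (rule cINF_lower) (use assms in \<open>auto intro!: bdd_belowI[of _ 0]\<close>)

lemma inf_conv_greatest:
  assumes "\<And>z. c \<le> q z + N * norm (h - z)"
  shows "c \<le> inf_conv N q h"
  unfolding inf_conv_def by (rule cINF_greatest) (use assms in auto)

lemma inf_conv_lipschitz:
  assumes "\<And>z. 0 \<le> q z" "N \<ge> 0"
  shows "N-lipschitz_on UNIV (inf_conv N q)"
proof (rule lipschitz_onI)
  have "inf_conv N q x - N * norm (x - y) \<le> inf_conv N q y" for x y
  proof (rule inf_conv_greatest)
    fix z
    have "inf_conv N q x \<le> q z + N * norm (x - z)" by (rule inf_conv_le[OF assms])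
    moreover have "N * norm (x - z) \<le> N * (norm (x - y) + norm (y - z))"
      using assms(2) norm_triangle_ineq[of "x - y" "y - z"] by (intro mult_left_mono) auto
    ultimately show "inf_conv N q x - N * norm (x - y) \<le> q z + N * norm (y - z)"
      by (simp add: distrib_left)
  qed
  from this[of _ _] show "dist (inf_conv N q x) (inf_conv N q y) \<le> N * dist x y" for x y
    by (smt (verit) dist_norm norm_minus_commute real_norm_def)
qed (rule assms)

lemma inf_conv_convex:
  fixes q :: "'a::real_normed_vector \<Rightarrow> real"
  assumes "convex_on UNIV q" "\<And>z. 0 \<le> q z" "N \<ge> 0"
  shows "convex_on UNIV (inf_conv N q)"
proof (rule convex_onI)
  fix t :: real and x y :: 'a assume t: "0 < t" "t < 1"
  let ?F = "inf_conv N q" and ?p = "(1 - t) *\<^sub>R x + t *\<^sub>R y"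
  have 1: "?F ?p \<le> (1 - t) * (q z1 + N * norm (x - z1)) + t * (q z2 + N * norm (y - z2))" for z1 z2
  proof -
    let ?z = "(1 - t) *\<^sub>R z1 + t *\<^sub>R z2"
    have "?F ?p \<le> q ?z + N * norm (?p - ?z)" by (rule inf_conv_le[OF assms(2,3)])
    moreover have "q ?z \<le> (1 - t) * q z1 + t * q z2" by (rule convex_onD[OF assms(1)]) (use t in auto)
    moreover have "norm (?p - ?z) \<le> (1 - t) * norm (x - z1) + t * norm (y - z2)"
    proof -
      have "?p - ?z = (1 - t) *\<^sub>R (x - z1) + t *\<^sub>R (y - z2)" by (simp add: algebra_simps)
      then show ?thesis using norm_triangle_ineq[of "(1 - t) *\<^sub>R (x - z1)" "t *\<^sub>R (y - z2)"] t by simp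
    qed
    then have "N * norm (?p - ?z) \<le> N * ((1 - t) * norm (x - z1) + t * norm (y - z2))"
      using assms(3) by (rule mult_left_mono)
    ultimately show ?thesis by (simp add: algebra_simps)
  qed
  have "(?F ?p - t * (q z2 + N * norm (y - z2))) / (1 - t) \<le> ?F x" for z2
    by (rule inf_conv_greatest) (use 1 t in \<open>simp add: divide_simps mult_ac algebra_simps\<close>)
  then have 2: "?F ?p \<le> (1 - t) * ?F x + t * (q z2 + N * norm (y - z2))" for z2
    using t by (simp add: pos_divide_le_eq mult.commute algebra_simps)
  have "(?F ?p - (1 - t) * ?F x) / t \<le> ?F y"
    by (rule inf_conv_greatest) (use 2 t in \<open>simp add: pos_divide_le_eq mult.commute algebra_simps\<close>)
  then show "?F ?p \<le> (1 - t) * ?F x + t * ?F y"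
    using t by (simp add: pos_divide_le_eq mult.commute algebra_simps)
qed simp

text \<open>A convex function between 0 and \<open>C * (norm h)\<^sup>2\<close> on the ball of
  radius \<open>2 * R\<close> cannot descend from h faster than with slope \<open>4 * C * R\<close>,
  so cutting slopes at that value changes nothing on the ball of radius R. The truncation supplies
  the global Lipschitz constant that mollification requires.\<close>

lemma inf_conv_eq:
  fixes q :: "'a::real_normed_vector \<Rightarrow> real"
  assumes q: "convex_on UNIV q" "\<And>z. 0 \<le> q z" and C: "C \<ge> 0" "R > 0"
    and le: "\<And>h. norm h \<le> 2 * R \<Longrightarrow> q h \<le> C * (norm h)\<^sup>2" and h: "norm h \<le> R"
  shows "q h \<le> inf_conv (4 * C * R) q h"
proof (rule inf_conv_greatest)
  fix z
  let ?N = "4 * C * R"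
  show "q h \<le> q z + ?N * norm (h - z)"
  proof (cases "h = z")
    case False
    define d where "d = norm (h - z)"
    have d: "d > 0" using False by (simp add: d_def)
    \<comment> \<open>Prolonging the segment from z to h by the length R beyond h stays in the ball
      where q is bounded above, and puts h between z and y.\<close>
    define y where "y = h + (R / d) *\<^sub>R (h - z)"
    have "norm y \<le> norm h + norm ((R / d) *\<^sub>R (h - z))" unfolding y_def by (rule norm_triangle_ineq)
    also have "norm ((R / d) *\<^sub>R (h - z)) = R" using d C by (simp add: d_def)
    finally have y: "norm y \<le> 2 * R" using h by simp
    define s where "s = d / (R + d)"
    have s: "0 < s" "s < 1" using d C by (auto simp: s_def)
    have hs: "h = (1 - s) *\<^sub>R z + s *\<^sub>R y"
    proof -
      have "s * (R / d) = 1 - s" using d C by (simp add: s_def field_simps)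
      then have "s *\<^sub>R y = s *\<^sub>R h + (1 - s) *\<^sub>R (h - z)" by (simp add: y_def scaleR_add_right)
      then show ?thesis by (simp add: algebra_simps)
    qed
    have "q h \<le> (1 - s) * q z + s * q y"
      using convex_onD[OF q(1), of s z y] s hs by simp
    moreover have "(1 - s) * q z \<le> q z" using q(2)[of z] s by (simp add: mult_left_le_one_le)
    moreover have "s * q y \<le> ?N * d"
    proof -
      have "q y \<le> C * (2 * R)\<^sup>2" using le[OF y] y C by (meson order_trans mult_left_mono power_mono norm_ge_zero)
      then have "s * q y \<le> s * (C * (2 * R)\<^sup>2)" using s by (intro mult_left_mono) auto
      also have "s \<le> d / R" using d C by (simp add: s_def divide_left_mono)
      then have "s * (C * (2 * R)\<^sup>2) \<le> d / R * (C * (2 * R)\<^sup>2)" using C by (intro mult_right_mono) auto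
      also have "\<dots> = ?N * d" using C by (simp add: power2_eq_square)
      finally show ?thesis .
    qed
    ultimately show ?thesis by (simp add: d_def)
  qed (use C in simp)
qed

text \<open>A convex function that is a viscosity subsolution of \<open>\<Sum>\<^sub>i \<xi>\<^sub>i \<bullet> D\<^sup>2q \<xi>\<^sub>i = b\<close> satisfies the mean value
  inequality of the random walk with steps proportional to \<open>\<plusminus>\<xi>\<^sub>i\<close>: the iterates of the walk applied to a
  mollification of \<open>q\<close> form a discrete heat flow with smooth members, which serve as test functions where \<open>q\<close>
  exceeds the flow the most.\<close>

lemma walk_mean_value:
  fixes \<xi> :: "'m::finite \<Rightarrow> real ^ 'n"
  assumes "C \<ge> 0" "\<kappa> > 0"
  shows "\<exists>\<kappa>'>0. \<exists>R>0. \<exists>K k0. \<forall>k\<ge>k0. 0 < k \<and> (\<forall>q. convex_on UNIV q \<longrightarrow> (\<forall>h. 0 \<le> q h) \<longrightarrow>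
    (\<forall>h. norm h \<le> 2 * R \<longrightarrow> q h \<le> C * (norm h)\<^sup>2) \<longrightarrow>
    (\<forall>w g H h0. c2_with w g H \<longrightarrow> norm h0 < R \<longrightarrow> (\<forall>\<^sub>F h in nhds h0. q h - w h \<le> q h0 - w h0) \<longrightarrow>
      norm (g h0) \<le> K \<longrightarrow> norm (H h0) \<le> K \<longrightarrow> b - \<kappa>' \<le> (\<Sum>i\<in>UNIV. \<xi> i \<bullet> (H h0 *v \<xi> i))) \<longrightarrow>
    b / 2 - \<kappa> \<le> (walk (\<lambda>i. sqrt (real CARD('m) / real k) *\<^sub>R \<xi> i) ^^ k) q 0)"
proof -
  define T where "T = (\<Sum>i\<in>UNIV. (norm (\<xi> i))\<^sup>2)"
  have T: "T \<ge> 0" by (simp add: T_def sum_nonneg)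
  define m where "m = real CARD('m)"
  have m: "m \<ge> 1" by (simp add: m_def Suc_le_eq)
  \<comment> \<open>The budget of \<open>\<kappa>\<close>: one \<open>\<kappa>'\<close> is lost in
    the hypothesis on test functions, one in the Taylor error of a step, one is kept to make the
    maximum principle strict, and \<open>2 * \<kappa>' * T\<close> is the cost of the penalty
    \<open>\<kappa>' * (norm x)\<^sup>2\<close>.\<close>
  define \<kappa>' where "\<kappa>' = \<kappa> / (3 + 2 * T)"
  have \<kappa>': "\<kappa>' > 0" using assms T by (simp add: \<kappa>'_def)
  define \<beta> where "\<beta> = b - 3 * \<kappa>' - 2 * \<kappa>' * T"
  have \<beta>: "\<beta> = b - \<kappa>"
  proof -
    have "\<kappa>' * (3 + 2 * T) = \<kappa>" using T by (simp add: \<kappa>'_def)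
    then show ?thesis by (simp add: \<beta>_def algebra_simps)
  qed
  \<comment> \<open>On the sphere of radius R the penalty exceeds \<open>\<bar>b\<bar>\<close>,
    hence any growth accumulated over the whole flow. Positive maxima therefore lie inside.\<close>
  define R where "R = (\<bar>b\<bar> + 1) / \<kappa>' + 1"
  have R: "R \<ge> 1" using \<kappa>' by (simp add: R_def)
  have R2: "\<bar>b\<bar> < \<kappa>' * R\<^sup>2"
  proof -
    have "\<bar>b\<bar> + 1 \<le> \<kappa>' * R" using \<kappa>' by (simp add: R_def field_simps)
    also have "\<dots> \<le> \<kappa>' * R\<^sup>2" using R \<kappa>' by (simp add: power2_eq_square)
    finally show ?thesis by simp
  qed
  define N where "N = 4 * C * R"
  have N: "N \<ge> 0" using assms R by (simp add: N_def)
  obtain K1 where K1: "K1 \<ge> 0" "\<And>F::real ^ 'n \<Rightarrow> real. N-lipschitz_on UNIV F \<Longrightarrow>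
    (\<exists>\<phi> g h. c2_with \<phi> g h \<and> (\<forall>x. F x \<le> \<phi> x \<and> \<phi> x \<le> F x + \<kappa> / 2) \<and>
      (\<forall>x. norm (g x) \<le> K1) \<and> (\<forall>x. norm (h x) \<le> K1) \<and> K1-lipschitz_on UNIV h)"
    using mollify[OF N, of "\<kappa> / 2"] assms by auto
  \<comment> \<open>Bounds gradient and Hessian of a flow member plus penalty on the ball of radius
    R.\<close>
  define K where "K = K1 + 2 * \<kappa>' * R + 2 * \<kappa>' * norm (mat 1 :: real ^ 'n ^ 'n)"
  define B where "B = (\<Sum>i\<in>UNIV. norm (\<xi> i))"
  have B: "norm (\<xi> i) \<le> B" for i unfolding B_def by (rule member_le_sum) auto
  have B0: "B \<ge> 0" by (simp add: B_def sum_nonneg)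
  \<comment> \<open>The step length is proportional to \<open>sqrt (m / real k)\<close>, so for
    large k the Taylor error of each step is below the allotted share; see
    \<open>cs\<close>.\<close>
  obtain k1 :: nat where k1: "real k1 > m * (2 * K1 * B * T / \<kappa>')\<^sup>2" using reals_Archimedean2 by blast
  show ?thesis
  proof (rule exI[of _ \<kappa>'], rule conjI[OF \<kappa>'], rule exI[of _ R], rule conjI,
      use R in simp, rule exI[of _ K], rule exI[of _ "Suc k1"], intro allI impI conjI)
    fix k assume k: "Suc k1 \<le> k"
    then show k0: "0 < k" by simp
    fix q :: "real ^ 'n \<Rightarrow> real"
    assume q: "convex_on UNIV q" and q0: "\<forall>h. 0 \<le> q h" and qC: "\<forall>h. norm h \<le> 2 * R \<longrightarrow> q h \<le> C * (norm h)\<^sup>2"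
      and sub: "\<forall>w g H h0. c2_with w g H \<longrightarrow> norm h0 < R \<longrightarrow> (\<forall>\<^sub>F h in nhds h0. q h - w h \<le> q h0 - w h0) \<longrightarrow>
      norm (g h0) \<le> K \<longrightarrow> norm (H h0) \<le> K \<longrightarrow> b - \<kappa>' \<le> (\<Sum>i\<in>UNIV. \<xi> i \<bullet> (H h0 *v \<xi> i))"
    define c where "c = sqrt (m / real k)"
    have c: "c \<ge> 0" "c\<^sup>2 = m / real k" using m k0 by (auto simp: c_def)
    have cs: "2 * K1 * (c * B) * T \<le> \<kappa>'"
    proof -
      let ?a = "2 * K1 * B * T / \<kappa>'"
      have "m * ?a\<^sup>2 \<le> real k" using k1 k by linarith
      then have "m / real k * ?a\<^sup>2 \<le> 1" using k0 by (simp add: field_simps del: power_divide)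
      then have "(c * ?a)\<^sup>2 \<le> 1" by (simp only: power_mult_distrib c(2))
      then have "c * ?a \<le> 1" using abs_square_le_1[of "c * ?a"] by (simp only: abs_le_iff)
      then show ?thesis using \<kappa>' by (simp add: divide_simps mult_ac)
    qed
    define \<zeta> where "\<zeta> = (\<lambda>i. c *\<^sub>R \<xi> i)"
    have \<zeta>B: "norm (\<zeta> i) \<le> c * B" for i using B c by (simp add: \<zeta>_def mult_left_mono)
    define F where "F = inf_conv N q"
    have FN: "N-lipschitz_on UNIV F" unfolding F_def using q0 N by (intro inf_conv_lipschitz) auto
    have Fc: "convex_on UNIV F" unfolding F_def using q q0 N by (intro inf_conv_convex) auto
    have Fq: "F h \<le> q h" for h using inf_conv_le[of q N h h] q0 N by (simp add: F_def)
    have qF: "q h \<le> F h" if "norm h \<le> R" for h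
      unfolding F_def N_def by (rule inf_conv_eq) (use q q0 assms R qC that in auto)
    obtain \<phi> g h where \<phi>: "c2_bounded K1 \<phi> g h" and \<phi>F: "\<And>x. F x \<le> \<phi> x" "\<And>x. \<phi> x \<le> F x + \<kappa> / 2"
      using K1(2)[OF FN] unfolding c2_bounded_def by blast
    define w where "w j = (walk \<zeta> ^^ j) \<phi>" for j
    define gw where "gw j = (walk \<zeta> ^^ j) g" for j
    define hw where "hw j = (walk \<zeta> ^^ j) h" for j
    have cb: "c2_bounded K1 (w j) (gw j) (hw j)" for j
      unfolding w_def gw_def hw_def by (rule c2_bounded_walk_iter[OF \<phi>])
    \<comment> \<open>Convexity enters here: averaging can only raise F, so q stays below the flow
      at all times.\<close>
    have wq: "q x \<le> w j x" if "norm x \<le> R" for j x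
    proof -
      have "q x \<le> F x" by (rule qF[OF that])
      also have "\<dots> \<le> (walk \<zeta> ^^ j) F x" by (rule walk_convex[OF Fc])
      also have "\<dots> \<le> w j x" unfolding w_def by (rule walk_iter_mono) (rule \<phi>F)
      finally show ?thesis .
    qed
    have q_cont: "continuous_on UNIV q" by (rule convex_on_continuous[OF open_UNIV q])
    \<comment> \<open>A maximum principle in discrete time: from time j to \<open>Suc j\<close> the
      flow rises by at least \<open>\<beta> / (2 * real k)\<close> at a positive maximum, because
      there the later flow member touches q and is a test function.\<close>
    have ind: "\<forall>x. norm x \<le> R \<longrightarrow> q x - w j x - \<kappa>' * (norm x)\<^sup>2 + real j / (2 * real k) * \<beta> \<le> 0" if "j \<le> k" for j
      using that
    proof (induction j)
      case 0
      show ?case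
      proof (intro allI impI)
        fix x :: "real ^ 'n" assume nx: "norm x \<le> R"
        have "0 \<le> \<kappa>' * (norm x)\<^sup>2" using \<kappa>' by simp
        moreover have "real 0 / (2 * real k) * \<beta> = 0" by simp
        ultimately show "q x - w 0 x - \<kappa>' * (norm x)\<^sup>2 + real 0 / (2 * real k) * \<beta> \<le> 0"
          using wq[OF nx, of 0] by linarith
      qed
    next
      case (Suc j)
      define E where "E x = q x - w (Suc j) x - \<kappa>' * (norm x)\<^sup>2 + real (Suc j) / (2 * real k) * \<beta>" for x
      have cw: "c2_with (w (Suc j)) (gw (Suc j)) (hw (Suc j))" using cb unfolding c2_bounded_def by blast
      then have "continuous_on (cball 0 R) E"
        unfolding E_def[abs_def]
        by (intro continuous_intros continuous_on_subset[OF q_cont] c2_with_continuous(1)[OF cw]) auto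
      then obtain x where x: "x \<in> cball 0 R" "\<And>y. y \<in> cball 0 R \<Longrightarrow> E y \<le> E x"
        using continuous_attains_sup[of "cball 0 R" E] R by force
      have nx: "norm x \<le> R" using x(1) by simp
      have "E x \<le> 0"
      proof (rule ccontr)
        assume "\<not> E x \<le> 0"
        then have pos: "E x > 0" by simp
        have "real (Suc j) / (2 * real k) * \<beta> \<le> \<bar>b\<bar>"
        proof (cases "\<beta> \<ge> 0")
          case True
          have "real (Suc j) / (2 * real k) \<le> 1" using Suc.prems k0 by (simp add: divide_simps)
          then have "real (Suc j) / (2 * real k) * \<beta> \<le> 1 * \<beta>" using True by (rule mult_right_mono)
          then show ?thesis using \<beta> assms by simp
        next
          case False
          then have "real (Suc j) / (2 * real k) * \<beta> \<le> 0" by (intro mult_nonneg_nonpos) auto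
          then show ?thesis by simp
        qed
        then have "\<kappa>' * (norm x)\<^sup>2 < \<bar>b\<bar>" using pos wq[OF nx, of "Suc j"] by (simp add: E_def)
        then have "\<kappa>' * (norm x)\<^sup>2 < \<kappa>' * R\<^sup>2" using R2 by simp
        then have "(norm x)\<^sup>2 < R\<^sup>2" using \<kappa>' by simp
        then have inner: "norm x < R" using R by (simp add: power_less_imp_less_base)
        define W where "W y = w (Suc j) y + \<kappa>' * (norm (y - 0))\<^sup>2" for y
        have Wc2: "c2_with W (\<lambda>y. gw (Suc j) y + \<kappa>' *\<^sub>R (2 *\<^sub>R (y - 0))) (\<lambda>y. hw (Suc j) y + \<kappa>' *\<^sub>R (2 *\<^sub>R mat 1))"
          unfolding W_def[abs_def] by (intro c2_with_add c2_with_scale c2_with_sqnorm cw)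
        have loc: "\<forall>\<^sub>F y in nhds x. q y - W y \<le> q x - W x"
        proof (rule eventually_nhds_in_open[of "ball 0 R", THEN eventually_mono])
          fix y :: "real ^ 'n" assume "y \<in> ball 0 R"
          then have "E y \<le> E x" using x(2)[of y] by (simp add: less_imp_le)
          then show "q y - W y \<le> q x - W x" by (simp add: E_def W_def)
        qed (use inner in auto)
        have bg: "norm (gw (Suc j) x) \<le> K1" "norm (hw (Suc j) x) \<le> K1" using cb by (auto simp: c2_bounded_def)
        have "norm (gw (Suc j) x + \<kappa>' *\<^sub>R (2 *\<^sub>R (x - 0))) \<le> K1 + \<kappa>' * (2 * R)"
          using bg(1) nx \<kappa>' by (intro norm_triangle_le add_mono) (auto intro!: mult_left_mono)
        also have "\<dots> \<le> K" using \<kappa>' by (simp add: K_def)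
        finally have n1: "norm (gw (Suc j) x + \<kappa>' *\<^sub>R (2 *\<^sub>R (x - 0))) \<le> K" .
        have "norm (hw (Suc j) x + \<kappa>' *\<^sub>R (2 *\<^sub>R mat 1)) \<le> K1 + \<kappa>' * (2 * norm (mat 1 :: real ^ 'n ^ 'n))"
          using bg(2) \<kappa>' by (intro norm_triangle_le add_mono) auto
        also have "\<dots> \<le> K" using \<kappa>' R by (simp add: K_def)
        finally have n2: "norm (hw (Suc j) x + \<kappa>' *\<^sub>R (2 *\<^sub>R mat 1)) \<le> K" .
        have "b - \<kappa>' \<le> (\<Sum>i\<in>UNIV. \<xi> i \<bullet> ((hw (Suc j) x + \<kappa>' *\<^sub>R (2 *\<^sub>R mat 1)) *v \<xi> i))"
          using sub Wc2 inner loc n1 n2 by blast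
        also have "\<dots> = (\<Sum>i\<in>UNIV. \<xi> i \<bullet> (hw (Suc j) x *v \<xi> i)) + 2 * \<kappa>' * T"
          by (simp add: matrix_vector_mult_add_rdistrib inner_add_right scaleR_matrix_vector_assoc[symmetric]
              sum.distrib T_def sum_distrib_left power2_norm_eq_inner mult_ac)
        finally have S: "b - \<kappa>' - 2 * \<kappa>' * T \<le> (\<Sum>i\<in>UNIV. \<xi> i \<bullet> (hw (Suc j) x *v \<xi> i))" by simp
        \<comment> \<open>The weight of a step is \<open>c\<^sup>2 / (2 * m)\<close>, which is
          \<open>1 / (2 * real k)\<close>; the total time is one half.\<close>
        have "w (Suc j) x - w j x \<ge> (1 / (2 * m)) *
          (\<Sum>i\<in>UNIV. \<zeta> i \<bullet> (hw (Suc j) x *v \<zeta> i) - 2 * K1 * (c * B) * (norm (\<zeta> i))\<^sup>2)"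
          using walk_step_ge[where x=x, OF cb[of j] \<zeta>B] by (simp add: w_def hw_def m_def)
        also have "(\<Sum>i\<in>UNIV. \<zeta> i \<bullet> (hw (Suc j) x *v \<zeta> i) - 2 * K1 * (c * B) * (norm (\<zeta> i))\<^sup>2)
          = c\<^sup>2 * ((\<Sum>i\<in>UNIV. \<xi> i \<bullet> (hw (Suc j) x *v \<xi> i)) - 2 * K1 * (c * B) * T)"
          using c(1) by (simp add: \<zeta>_def matrix_vector_mult_scaleR sum_subtractf sum_distrib_left T_def
              power_mult_distrib power2_eq_square algebra_simps)
        also have "(1 / (2 * m)) * (c\<^sup>2 * ((\<Sum>i\<in>UNIV. \<xi> i \<bullet> (hw (Suc j) x *v \<xi> i)) - 2 * K1 * (c * B) * T)) =
          (1 / (2 * real k)) * ((\<Sum>i\<in>UNIV. \<xi> i \<bullet> (hw (Suc j) x *v \<xi> i)) - 2 * K1 * (c * B) * T)"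
          using m by (simp add: c(2))
        also have "\<dots> \<ge> (1 / (2 * real k)) * (\<beta> + \<kappa>')"
          using S cs by (intro mult_left_mono) (auto simp: \<beta>_def)
        finally have step: "w (Suc j) x - w j x \<ge> (1 / (2 * real k)) * (\<beta> + \<kappa>')" .
        define a where "a = 1 / (2 * real k)"
        define P where "P = real j / (2 * real k) * \<beta>"
        have "q x - w j x - \<kappa>' * (norm x)\<^sup>2 + P \<le> 0" using Suc nx by (simp add: P_def)
        moreover have "real (Suc j) / (2 * real k) * \<beta> = P + a * \<beta>"
          by (simp add: P_def a_def add_divide_distrib distrib_right)
        then have "0 < q x - w (Suc j) x - \<kappa>' * (norm x)\<^sup>2 + (P + a * \<beta>)" using pos by (simp only: E_def)
        moreover have "a * (\<beta> + \<kappa>') \<le> w (Suc j) x - w j x" using step by (simp only: a_def)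
        then have "a * \<beta> + a * \<kappa>' \<le> w (Suc j) x - w j x" by (simp only: distrib_left)
        moreover have "a * \<kappa>' > 0" using k0 \<kappa>' by (simp add: a_def)
        ultimately show False by linarith
      qed
      then show ?case using x(2) unfolding E_def by (meson dual_order.trans mem_cball_0)
    qed
    \<comment> \<open>The remaining loss splits evenly: half of \<open>\<kappa>\<close> is in
      \<open>\<beta> / 2\<close>, the other half is the mollification error.\<close>
    have "q 0 - w k 0 + \<beta> / 2 \<le> 0" using ind[of k] k0 R by (auto dest!: spec[of _ 0])
    moreover have "w k 0 \<le> (walk \<zeta> ^^ k) (\<lambda>x. q x + \<kappa> / 2) 0"
      unfolding w_def by (rule walk_iter_mono) (use \<phi>F(2) Fq in \<open>meson add_right_mono order_trans\<close>)
    then have "w k 0 \<le> (walk \<zeta> ^^ k) q 0 + \<kappa> / 2" by (simp add: walk_add walk_const)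
    moreover have "q 0 \<ge> 0" using q0 by simp
    ultimately have "b / 2 - \<kappa> \<le> (walk \<zeta> ^^ k) q 0" using \<beta> by (simp add: field_simps)
    then show "b / 2 - \<kappa> \<le> (walk (\<lambda>i. sqrt (real CARD('m) / real k) *\<^sub>R \<xi> i) ^^ k) q 0"
      by (simp add: \<zeta>_def c_def m_def)
  qed
qed


section \<open>Sup-convolutions of subsolutions\<close>

definition usc :: "('a::topological_space \<Rightarrow> real) \<Rightarrow> bool"
  where "usc f \<longleftrightarrow> (\<forall>c. open {x. f x < c})"

lemma usc_eventually: "usc f \<Longrightarrow> f x < c \<Longrightarrow> \<forall>\<^sub>F y in nhds x. f y < c"
  unfolding usc_def eventually_nhds by (metis mem_Collect_eq)

lemma uscI:
  assumes "\<And>x c. f x < c \<Longrightarrow> \<forall>\<^sub>F y in nhds x. f y < c"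
  shows "usc f"
  unfolding usc_def
proof
  fix c show "open {x. f x < c}"
  proof (subst open_subopen, intro ballI)
    fix x assume "x \<in> {x. f x < c}"
    then have "\<forall>\<^sub>F y in nhds x. f y < c" using assms by simp
    then show "\<exists>T. open T \<and> x \<in> T \<and> T \<subseteq> {x. f x < c}" unfolding eventually_nhds by blast
  qed
qed

lemma usc_continuous: "continuous_on UNIV f \<Longrightarrow> usc f"
  unfolding usc_def by (auto intro: open_Collect_less continuous_intros)

lemma usc_add:
  assumes "usc f" "usc g"
  shows "usc (\<lambda>x. f x + g x)"
proof (rule uscI)
  fix x c assume "f x + g x < c"
  then obtain e where e: "e > 0" "f x + g x + 2 * e = c"
    by (metis add.commute diff_add_cancel diff_gt_0_iff_gt field_sum_of_halves half_gt_zero mult_2)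
  have "\<forall>\<^sub>F y in nhds x. f y < f x + e" "\<forall>\<^sub>F y in nhds x. g y < g x + e"
    using usc_eventually assms e by (metis less_add_same_cancel1)+
  then show "\<forall>\<^sub>F y in nhds x. f y + g y < c"
    by eventually_elim (use e in simp)
qed

lemma usc_compose:
  assumes "usc f" "continuous_on UNIV T"
  shows "usc (\<lambda>x. f (T x))"
  unfolding usc_def
proof
  fix c
  have "open (T -` {x. f x < c})" using assms(1) by (intro open_vimage assms(2)) (auto simp: usc_def)
  then show "open {x. f (T x) < c}" by (simp add: vimage_def)
qed

lemma usc_attains_max:
  assumes "usc f" "compact S" "S \<noteq> {}"
  shows "\<exists>x\<in>S. \<forall>y\<in>S. f y \<le> f x"
proof (rule ccontr)
  assume *: "\<not> ?thesis"
  have "S \<subseteq> (\<Union>y\<in>S. {x. f x < f y})"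
  proof
    fix x assume "x \<in> S"
    then obtain y where "y \<in> S" "f x < f y" using * by (auto simp: not_le)
    then show "x \<in> (\<Union>y\<in>S. {x. f x < f y})" by blast
  qed
  moreover have "\<And>y. y \<in> S \<Longrightarrow> open {x. f x < f y}" using assms(1) by (auto simp: usc_def)
  ultimately obtain T where T: "T \<subseteq> S" "finite T" "S \<subseteq> (\<Union>y\<in>T. {x. f x < f y})"
    using compactE_image[OF assms(2), of S "\<lambda>y. {x. f x < f y}"] by metis
  have "T \<noteq> {}" using T(3) assms(3) by auto
  then have "Max (f ` T) \<in> f ` T" using T(2) by (intro Max_in) auto
  then obtain y where y: "y \<in> T" "f y = Max (f ` T)" by auto
  then obtain z where "z \<in> T" "f y < f z" using T by blast
  moreover have "f z \<le> f y" using \<open>z \<in> T\<close> y T(2) by simp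
  ultimately show False by simp
qed

definition sup_conv :: "real \<Rightarrow> ('a::real_normed_vector \<Rightarrow> real) \<Rightarrow> 'a \<Rightarrow> real"
  where "sup_conv e u x = (SUP y. u y - (norm (x - y))\<^sup>2 / (2 * e))"

text \<open>The viscosity inequality \<open>B \<le> trace (A D\<^sup>2u)\<close>. A supersolution u
  is always expressed as a subsolution \<open>- u\<close> with reflected B, so that sup-convolutions
  serve for both; no semicontinuity is included because Perron's method passes through
  envelopes.\<close>

definition subsol ::
    "(real ^ 'n \<Rightarrow> real ^ 'n ^ 'n) \<Rightarrow> (real ^ 'n \<Rightarrow> real \<Rightarrow> real ^ 'n \<Rightarrow> real) \<Rightarrow> (real ^ 'n \<Rightarrow> real) \<Rightarrow> bool"
  where "subsol A B u \<longleftrightarrow> (\<forall>\<phi> g h x. c2_with \<phi> g h \<longrightarrow> (\<forall>\<^sub>F y in nhds x. u y - \<phi> y \<le> u x - \<phi> x) \<longrightarrow>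
    B x (u x) (g x) \<le> trace (A x ** h x))"

lemma abs_trace_mult_le:
  fixes M X :: "real ^ 'n ^ 'n"
  shows "\<bar>trace (M ** X)\<bar> \<le> (real CARD('n))\<^sup>2 * (norm M * norm X)"
proof -
  have e: "\<bar>Y $ i $ j\<bar> \<le> norm Y" for Y :: "real ^ 'n ^ 'n" and i j
    using Finite_Cartesian_Product.norm_nth_le[of "Y $ i" j] Finite_Cartesian_Product.norm_nth_le[of Y i] by simp
  have "\<bar>trace (M ** X)\<bar> \<le> (\<Sum>i\<in>UNIV. \<bar>\<Sum>k\<in>UNIV. M $ i $ k * X $ k $ i\<bar>)"
    by (simp add: trace_def matrix_matrix_mult_def)
  also have "\<dots> \<le> (\<Sum>i\<in>(UNIV::'n set). \<Sum>k\<in>(UNIV::'n set). norm M * norm X)"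
    by (intro sum_mono order_trans[OF sum_abs]) (simp add: abs_mult mult_mono e)
  finally have "\<bar>trace (M ** X)\<bar> \<le> (\<Sum>i\<in>(UNIV::'n set). \<Sum>k\<in>(UNIV::'n set). norm M * norm X)" .
  then show ?thesis by (simp add: power2_eq_square)
qed

locale sup_convolution =
  fixes u :: "real ^ 'n \<Rightarrow> real" and e S :: real
  assumes usc: "usc u" and bdd: "\<And>x. \<bar>u x\<bar> \<le> S" and e: "e > 0"
begin

abbreviation "U \<equiv> sup_conv e u"

lemma term_le: "u y - (norm (x - y))\<^sup>2 / (2 * e) \<le> S"
proof -
  have "(norm (x - y))\<^sup>2 / (2 * e) \<ge> 0" using e by simp
  then show ?thesis using bdd[of y] by simp
qed

lemma sup_conv_ge: "u y - (norm (x - y))\<^sup>2 / (2 * e) \<le> U x"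
  unfolding sup_conv_def by (rule cSUP_upper) (auto intro!: bdd_aboveI[of _ S] term_le)

lemma sup_conv_upper: "U x \<le> S"
  unfolding sup_conv_def by (rule cSUP_least) (auto intro: term_le)

lemma sup_conv_lower: "u x \<le> U x" using sup_conv_ge[of x x] by simp

lemma sup_conv_attained: "\<exists>a. U x = u a - (norm (x - a))\<^sup>2 / (2 * e)"
proof -
  define G where "G y = u y + (- ((norm (x - y))\<^sup>2 / (2 * e)))" for y
  have S0: "S \<ge> 0" using bdd[of 0] by linarith
  \<comment> \<open>Outside this radius the quadratic penalty is at least \<open>2 * S\<close>, so
    the centre itself is at least as good.\<close>
  define \<rho> where "\<rho> = sqrt (4 * e * S)"
  have \<rho>: "\<rho> \<ge> 0" "\<rho>\<^sup>2 = 4 * e * S" using e S0 by (auto simp: \<rho>_def)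
  have "usc G" unfolding G_def[abs_def]
    by (intro usc_add usc usc_continuous continuous_intros) (use e in auto)
  then obtain a where a: "a \<in> cball x \<rho>" "\<And>y. y \<in> cball x \<rho> \<Longrightarrow> G y \<le> G a"
    using usc_attains_max[of G "cball x \<rho>"] \<rho> by auto
  have "G y \<le> G a" for y
  proof (cases "y \<in> cball x \<rho>")
    case False
    then have "\<rho> \<le> norm (x - y)" by (simp add: dist_norm)
    then have "4 * e * S \<le> (norm (x - y))\<^sup>2" using \<rho> by (metis power_mono)
    then have "2 * S \<le> (norm (x - y))\<^sup>2 / (2 * e)" using e by (simp add: field_simps)
    then have "G y \<le> u x" using bdd[of y] bdd[of x] by (simp add: G_def)
    also have "\<dots> = G x" by (simp add: G_def)
    also have "\<dots> \<le> G a" by (rule a) (use \<rho> in simp)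
    finally show ?thesis .
  qed (rule a)
  then have "U x \<le> G a" unfolding sup_conv_def by (intro cSUP_least) (auto simp: G_def)
  moreover have "G a \<le> U x" using sup_conv_ge[of a x] by (simp add: G_def)
  ultimately show ?thesis by (auto simp: G_def intro!: exI[of _ a])
qed

text \<open>Expanding the square turns the function into a supremum of affine functions of
  x.\<close>

lemma sup_conv_convex: "convex_on UNIV (\<lambda>x. U x + (norm x)\<^sup>2 / (2 * e))"
proof (rule convex_onI)
  fix t :: real and x y :: "real ^ 'n" assume t: "0 < t" "t < 1"
  let ?z = "(1 - t) *\<^sub>R x + t *\<^sub>R y"
  obtain a where a: "U ?z = u a - (norm (?z - a))\<^sup>2 / (2 * e)" using sup_conv_attained by blast
  have eq: "u a - (norm (z - a))\<^sup>2 / (2 * e) + (norm z)\<^sup>2 / (2 * e) = u a - (norm a)\<^sup>2 / (2 * e) + (z \<bullet> a) / e" for z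
    using e by (simp add: power2_norm_eq_inner inner_diff_left inner_diff_right inner_commute field_simps)
  have "U ?z + (norm ?z)\<^sup>2 / (2 * e) = u a - (norm a)\<^sup>2 / (2 * e) + (?z \<bullet> a) / e" by (simp only: a eq)
  also have "\<dots> = (1 - t) * (u a - (norm a)\<^sup>2 / (2 * e) + (x \<bullet> a) / e) + t * (u a - (norm a)\<^sup>2 / (2 * e) + (y \<bullet> a) / e)"
  proof -
    have "(1 - t) * (c + (x \<bullet> a) / e) + t * (c + (y \<bullet> a) / e) = c + (?z \<bullet> a) / e" for c
      by (simp add: inner_add_left add_divide_distrib distrib_left) (simp add: left_diff_distrib)
    then show ?thesis by simp
  qed
  also have "\<dots> \<le> (1 - t) * (U x + (norm x)\<^sup>2 / (2 * e)) + t * (U y + (norm y)\<^sup>2 / (2 * e))"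
    unfolding eq[symmetric] using t sup_conv_ge[of a] by (intro add_mono mult_left_mono) auto
  finally show "U ?z + (norm ?z)\<^sup>2 / (2 * e) \<le>
    (1 - t) * (U x + (norm x)\<^sup>2 / (2 * e)) + t * (U y + (norm y)\<^sup>2 / (2 * e))" .
qed simp

lemma sup_conv_continuous: "continuous_on UNIV U"
proof -
  have "continuous_on UNIV (\<lambda>x. (U x + (norm x)\<^sup>2 / (2 * e)) - (norm x)\<^sup>2 / (2 * e))"
    by (intro continuous_intros convex_on_continuous[OF open_UNIV sup_conv_convex]) (use e in auto)
  then show ?thesis by simp
qed

text \<open>The paraboloid from the maximising point a lies below U and touches it at x, so it has
  the same gradient at x as w. This identifies a as \<open>x + e *\<^sub>R g x\<close> and fixes the
  value of u there.\<close>

lemma contact_value: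
  assumes "c2_with w g h" "\<forall>\<^sub>F y in nhds x. U y - w y \<le> U x - w x"
  shows "U x = u (x + e *\<^sub>R g x) - e * (norm (g x))\<^sup>2 / 2"
proof -
  obtain a where a: "U x = u a - (norm (x - a))\<^sup>2 / (2 * e)" using sup_conv_attained by blast
  have c: "c2_with (\<lambda>y. (- 1 / (2 * e)) * (norm (y - a))\<^sup>2 + (- 1) * w y)
      (\<lambda>y. (- 1 / (2 * e)) *\<^sub>R (2 *\<^sub>R (y - a)) + (- 1) *\<^sub>R g y) (\<lambda>y. (- 1 / (2 * e)) *\<^sub>R (2 *\<^sub>R mat 1) + (- 1) *\<^sub>R h y)"
    by (intro c2_with_add c2_with_scale c2_with_sqnorm assms)
  have "\<forall>\<^sub>F y in nhds x. (- 1 / (2 * e)) * (norm (y - a))\<^sup>2 + (- 1) * w y \<le> (- 1 / (2 * e)) * (norm (x - a))\<^sup>2 + (- 1) * w x"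
    using assms(2)
  proof eventually_elim
    case (elim y)
    then show ?case using sup_conv_ge[of a y] a by simp
  qed
  from c2_local_max(1)[OF c this] have "g x = (- 1 / (2 * e)) *\<^sub>R (2 *\<^sub>R (x - a))" by simp
  then have g: "g x = (- 1 / e) *\<^sub>R (x - a)" by simp
  have "x + e *\<^sub>R g x = a" using e by (simp add: g)
  moreover have "norm (g x) = norm (x - a) / e" using e unfolding g by simp
  ultimately have "x + e *\<^sub>R g x = a" "norm (g x) = norm (x - a) / e" by blast+
  then show ?thesis using a e by (simp add: power_divide power2_eq_square)
qed

text \<open>Shifting w so that x goes to the maximising point gives a test function for u itself,
  with the same gradient and Hessian.\<close>

lemma contact_subsol:
  assumes "c2_with w g h" "\<forall>\<^sub>F y in nhds x. U y - w y \<le> U x - w x" "subsol A B u"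
  shows "B (x + e *\<^sub>R g x) (u (x + e *\<^sub>R g x)) (g x) \<le> trace (A (x + e *\<^sub>R g x) ** h x)"
proof -
  define a where "a = x + e *\<^sub>R g x"
  have Ux: "U x = u a - (norm (x - a))\<^sup>2 / (2 * e)"
    using contact_value[OF assms(1,2)] e by (simp add: a_def power_mult_distrib power2_eq_square)
  have c: "c2_with (\<lambda>y. w (y + (x - a))) (\<lambda>y. g (y + (x - a))) (\<lambda>y. h (y + (x - a)))"
    using c2_with_affine[OF assms(1), of 1 "x - a"] by simp
  have "((\<lambda>y. y + (x - a)) \<longlongrightarrow> a + (x - a)) (nhds a)" by (intro tendsto_intros filterlim_ident)
  then have "filterlim (\<lambda>y. y + (x - a)) (nhds x) (nhds a)" by simp
  from eventually_compose_filterlim[OF assms(2) this]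
  have "\<forall>\<^sub>F y in nhds a. u y - w (y + (x - a)) \<le> u a - w (a + (x - a))"
  proof eventually_elim
    case (elim y)
    then show ?case using sup_conv_ge[of y "y + (x - a)"] Ux by simp
  qed
  then have "B a (u a) (g (a + (x - a))) \<le> trace (A a ** h (a + (x - a)))"
    using assms(3) c unfolding subsol_def by blast
  then show ?thesis by (simp add: a_def)
qed

end


lemma walk_cmult:
  fixes \<phi> :: "'a::real_vector \<Rightarrow> real"
  shows "(walk \<xi> ^^ k) (\<lambda>x. c * \<phi> x) x = c * (walk \<xi> ^^ k) \<phi> x"
proof (induction k arbitrary: x)
  case (Suc k)
  have "(walk \<xi> ^^ k) (\<lambda>x. c * \<phi> x) = (\<lambda>x. c * (walk \<xi> ^^ k) \<phi> x)" using Suc by auto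
  moreover have "walk \<xi> (\<lambda>x. c * \<psi> x) x = c * walk \<xi> \<psi> x" for \<psi> :: "'a \<Rightarrow> real"
    by (simp add: walk_def sum_distrib_left distrib_left mult_ac)
  ultimately show ?case by simp
qed simp

lemma trace_mult_diff_left: "trace ((M - N) ** X) = trace (M ** X) - trace (N ** X)"
  for M :: "real ^ 'n ^ 'n"
  by (simp add: trace_def matrix_matrix_mult_def left_diff_distrib sum_subtractf)

lemma trace_mult_diff_right: "trace (X ** (M - N)) = trace (X ** M) - trace (X ** N)"
  for M :: "real ^ 'n ^ 'n"
  by (simp add: trace_def matrix_matrix_mult_def right_diff_distrib sum_subtractf)

lemma trace_mult_scaleR: "trace (X ** (c *\<^sub>R M)) = c * trace (X ** M)"
  for M :: "real ^ 'n ^ 'n"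
  by (simp add: trace_def matrix_matrix_mult_def sum_distrib_left mult_ac)

lemma dist_Pair_le: "dist (a, b) (c, d) \<le> dist a c + dist b d"
  by (simp add: dist_Pair_Pair sqrt_sum_squares_le_sum)

text \<open>\<open>walk_mean_value\<close> is applied to the blow-ups q of U at x, made convex by
  the term \<open>(norm h)\<^sup>2 / (2 * e)\<close>. Since the constants there do not depend on q,
  the number of steps can be fixed before the scale t tends to zero.\<close>

lemma (in sup_convolution) sup_conv_mean_value:
  fixes \<xi> :: "'m::finite \<Rightarrow> real ^ 'n"
  assumes sub: "subsol A B u" and A: "continuous_on UNIV A"
    and B: "continuous_on UNIV (\<lambda>(x, r, p). B x r p)"
    and touch: "\<And>h. U (x + h) \<le> U x + p \<bullet> h + C * (norm h)\<^sup>2"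
    and fac: "\<And>X. (\<Sum>i\<in>UNIV. \<xi> i \<bullet> (X *v \<xi> i)) = \<alpha> * trace (A (x + e *\<^sub>R p) ** X)"
    and C: "C \<ge> 0" and \<alpha>: "\<alpha> \<ge> 0" and \<kappa>: "\<kappa> > 0"
  shows "\<exists>k0. \<forall>k\<ge>k0. 0 < k \<and> (\<exists>t0>0. \<forall>t. 0 < t \<longrightarrow> t < t0 \<longrightarrow>
    U x + t\<^sup>2 * (\<alpha> * B (x + e *\<^sub>R p) (u (x + e *\<^sub>R p)) p / 2 - \<kappa>) \<le>
    (walk (\<lambda>i. sqrt (real CARD('m) / real k) *\<^sub>R \<xi> i) ^^ k) (\<lambda>h. U (x + t *\<^sub>R h)) 0)"
proof -
  define a where "a = x + e *\<^sub>R p"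
  define b0 where "b0 = B a (u a) p"
  \<comment> \<open>The convexifying term adds \<open>1 / e\<close> times the identity to Hessians.
    Its contribution \<open>trace (A a) / e\<close> is subtracted again at the end through
    \<open>quad\<close>.\<close>
  define b where "b = \<alpha> * (b0 + trace (A a) / e)"
  define C' where "C' = C + 1 / (2 * e)"
  have C': "C' \<ge> 0" using C e by (simp add: C'_def)
  have ua: "u a = U x + e * (norm p)\<^sup>2 / 2"
  proof -
    have c: "c2_with (\<lambda>y. (0 + p \<bullet> (y - x)) + C * (norm (y - x))\<^sup>2) (\<lambda>y. p + C *\<^sub>R (2 *\<^sub>R (y - x)))
        (\<lambda>y. 0 + C *\<^sub>R (2 *\<^sub>R mat 1))"
      by (intro c2_with_add c2_with_scale c2_with_sqnorm c2_with_linear)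
    have "\<forall>\<^sub>F y in nhds x. U y - ((0 + p \<bullet> (y - x)) + C * (norm (y - x))\<^sup>2) \<le>
        U x - ((0 + p \<bullet> (x - x)) + C * (norm (x - x))\<^sup>2)"
    proof (intro always_eventually allI)
      fix y show "U y - ((0 + p \<bullet> (y - x)) + C * (norm (y - x))\<^sup>2) \<le> U x - ((0 + p \<bullet> (x - x)) + C * (norm (x - x))\<^sup>2)"
        using touch[of "y - x"] by simp
    qed
    from contact_value[OF c this] show ?thesis by (simp add: a_def)
  qed
  obtain \<kappa>' R K k0 where \<kappa>': "\<kappa>' > 0" and R: "R > 0" and
    mv: "\<forall>k\<ge>k0. 0 < k \<and> (\<forall>q. convex_on UNIV q \<longrightarrow> (\<forall>h. 0 \<le> q h) \<longrightarrow>
    (\<forall>h. norm h \<le> 2 * R \<longrightarrow> q h \<le> C' * (norm h)\<^sup>2) \<longrightarrow>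
    (\<forall>w g H h0. c2_with w g H \<longrightarrow> norm h0 < R \<longrightarrow> (\<forall>\<^sub>F h in nhds h0. q h - w h \<le> q h0 - w h0) \<longrightarrow>
      norm (g h0) \<le> K \<longrightarrow> norm (H h0) \<le> K \<longrightarrow> b - \<kappa>' \<le> (\<Sum>i\<in>UNIV. \<xi> i \<bullet> (H h0 *v \<xi> i))) \<longrightarrow>
    b / 2 - \<kappa> \<le> (walk (\<lambda>i. sqrt (real CARD('m) / real k) *\<^sub>R \<xi> i) ^^ k) q 0)"
    using walk_mean_value[OF C' \<kappa>, of b \<xi>] by (elim exE conjE) (rule that)
  define n2 where "n2 = (real CARD('n))\<^sup>2"
  have n2: "n2 \<ge> 0" by (simp add: n2_def)
  define K' where "K' = \<bar>K\<bar> + norm ((1 / e) *\<^sub>R mat 1 :: real ^ 'n ^ 'n)"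
  have K': "K' \<ge> 0" by (simp add: K'_def)
  \<comment> \<open>One tolerance for the continuity of B and A: both errors, the second multiplied
    by the Hessian bound \<open>K'\<close>, together stay within \<open>\<kappa>'\<close> even after
    multiplication by \<open>\<alpha>\<close>.\<close>
  define \<delta> where "\<delta> = \<kappa>' / (\<alpha> + 1) / (1 + n2 * K')"
  have n2K: "1 + n2 * K' > 0" using n2 K' by (simp add: add_pos_nonneg)
  have \<delta>: "\<delta> > 0" using \<kappa>' \<alpha> n2K by (simp add: \<delta>_def)
  have \<delta>2: "\<alpha> * (\<delta> * (1 + n2 * K')) \<le> \<kappa>'"
  proof -
    have "\<alpha> * (\<delta> * (1 + n2 * K')) = \<kappa>' * (\<alpha> / (\<alpha> + 1))" using n2K by (simp add: \<delta>_def)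
    also have "\<dots> \<le> \<kappa>' * 1" using \<kappa>' \<alpha> by (intro mult_left_mono) auto
    finally show ?thesis by simp
  qed
  \<comment> \<open>Since u is only semicontinuous, its value at the contact point is written
    through the continuous U by \<open>contact_value\<close>. Only then can continuity of B be
    used.\<close>
  define \<Psi> where "\<Psi> z = B (fst (snd z)) (U (fst z) + e * (norm (snd (snd z)))\<^sup>2 / 2) (snd (snd z))"
    for z :: "(real ^ 'n) \<times> (real ^ 'n) \<times> (real ^ 'n)"
  have "continuous_on UNIV \<Psi>"
  proof -
    have "continuous_on UNIV (\<lambda>z :: (real ^ 'n) \<times> (real ^ 'n) \<times> (real ^ 'n).
        (fst (snd z), U (fst z) + e * (norm (snd (snd z)))\<^sup>2 / 2, snd (snd z)))"
      by (intro continuous_intros continuous_on_compose2[OF sup_conv_continuous]) auto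
    from continuous_on_compose2[OF B this] show ?thesis by (simp add: \<Psi>_def[abs_def])
  qed
  then have "isCont \<Psi> (x, a, p)" by (simp add: continuous_on_eq_continuous_at)
  then obtain d1 where d1: "d1 > 0" "\<And>z. dist z (x, a, p) < d1 \<Longrightarrow> dist (\<Psi> z) (\<Psi> (x, a, p)) < \<delta>"
    using \<delta> unfolding continuous_at_eps_delta by blast
  have "isCont A a" using A by (simp add: continuous_on_eq_continuous_at)
  then obtain d2 where d2: "d2 > 0" "\<And>y. dist y a < d2 \<Longrightarrow> dist (A y) (A a) < \<delta>"
    using \<delta> unfolding continuous_at_eps_delta by blast
  define d where "d = min d1 d2"
  have d: "d > 0" using d1 d2 by (simp add: d_def)
  \<comment> \<open>\<open>t * M\<close> bounds the displacement of the contact data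
    \<open>(z, y, G z)\<close> from \<open>(x, a, p)\<close>.\<close>
  define M where "M = R + e * \<bar>K\<bar> + (\<bar>K\<bar> + R / e) + 1"
  have M: "M > 0" using R e by (simp add: M_def add_pos_nonneg)
  define t0 where "t0 = d / M"
  have t0: "t0 > 0" using d M by (simp add: t0_def)
  show ?thesis
  proof (rule exI[of _ k0], intro allI impI conjI, rule mv[rule_format, THEN conjunct1], assumption, rule exI[of _ t0], intro conjI allI impI, rule t0)
    fix k and t :: real assume k: "k0 \<le> k" and t: "0 < t" "t < t0"
    have k0: "0 < k" by (rule mv[rule_format, OF k, THEN conjunct1])
    have tM: "t * M < d" using t M by (simp add: t0_def field_simps)
    define q where "q h = (U (x + t *\<^sub>R h) - U x - t * (p \<bullet> h)) / t\<^sup>2 + (norm h)\<^sup>2 / (2 * e)" for h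
    have q0: "q 0 = 0" by (simp add: q_def)
    have qC: "q h \<le> C' * (norm h)\<^sup>2" for h
    proof -
      have "U (x + t *\<^sub>R h) - U x - t * (p \<bullet> h) \<le> C * (t\<^sup>2 * (norm h)\<^sup>2)"
        using touch[of "t *\<^sub>R h"] t by (simp add: power_mult_distrib)
      then have "(U (x + t *\<^sub>R h) - U x - t * (p \<bullet> h)) / t\<^sup>2 \<le> C * (norm h)\<^sup>2"
        using t by (simp add: divide_simps mult_ac)
      then show ?thesis by (simp add: q_def C'_def distrib_right)
    qed
    have qconv: "convex_on UNIV q"
    proof (rule convex_onI)
      fix s :: real and y z :: "real ^ 'n" assume s: "0 < s" "s < 1"
      define f where "f y = U y + (norm y)\<^sup>2 / (2 * e)" for y
      define l where "l h = (f x + t * ((p + (1 / e) *\<^sub>R x) \<bullet> h))" for h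
      have qf: "q h = (f (x + t *\<^sub>R h) - l h) / t\<^sup>2" for h
      proof -
        have "(norm (x + t *\<^sub>R h))\<^sup>2 / (2 * e) = (norm x)\<^sup>2 / (2 * e) + t * ((1 / e) * (x \<bullet> h)) + t\<^sup>2 * ((norm h)\<^sup>2 / (2 * e))"
          using e unfolding power2_norm_eq_inner
          by (simp add: inner_add_left inner_add_right inner_commute power2_eq_square field_simps)
        then have "f (x + t *\<^sub>R h) - l h = U (x + t *\<^sub>R h) - U x - t * (p \<bullet> h) + t\<^sup>2 * ((norm h)\<^sup>2 / (2 * e))"
          by (simp add: f_def l_def inner_add_left distrib_left)
        then show ?thesis using t by (simp add: q_def add_divide_distrib)
      qed
      have "f ((1 - s) *\<^sub>R (x + t *\<^sub>R y) + s *\<^sub>R (x + t *\<^sub>R z)) \<le> (1 - s) * f (x + t *\<^sub>R y) + s * f (x + t *\<^sub>R z)"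
        using convex_onD[OF sup_conv_convex, of s "x + t *\<^sub>R y" "x + t *\<^sub>R z"] s by (simp add: f_def)
      moreover have "(1 - s) *\<^sub>R (x + t *\<^sub>R y) + s *\<^sub>R (x + t *\<^sub>R z) = x + t *\<^sub>R ((1 - s) *\<^sub>R y + s *\<^sub>R z)"
        by (simp add: algebra_simps)
      moreover have "l ((1 - s) *\<^sub>R y + s *\<^sub>R z) = (1 - s) * l y + s * l z"
        by (simp add: l_def inner_add_right algebra_simps diff_divide_distrib)
      ultimately have "f (x + t *\<^sub>R ((1 - s) *\<^sub>R y + s *\<^sub>R z)) - l ((1 - s) *\<^sub>R y + s *\<^sub>R z) \<le>
          (1 - s) * (f (x + t *\<^sub>R y) - l y) + s * (f (x + t *\<^sub>R z) - l z)"
        by (simp add: right_diff_distrib)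
      then have "q ((1 - s) *\<^sub>R y + s *\<^sub>R z) \<le> ((1 - s) * (f (x + t *\<^sub>R y) - l y) + s * (f (x + t *\<^sub>R z) - l z)) / t\<^sup>2"
        unfolding qf by (rule divide_right_mono) simp
      then show "q ((1 - s) *\<^sub>R y + s *\<^sub>R z) \<le> (1 - s) * q y + s * q z"
        unfolding qf by (simp add: add_divide_distrib)
    qed simp
    \<comment> \<open>The origin lies between \<open>- s *\<^sub>R h\<close> and h. Convexity with q
      0 = 0 bounds \<open>s * q h\<close> below by \<open>- q (- s *\<^sub>R h)\<close>, which is of
      order \<open>s\<^sup>2\<close> by \<open>qC\<close>; then s is made small.\<close>
    have qpos: "0 \<le> q h" for h
    proof (rule field_le_epsilon)
      fix \<epsilon> :: real assume \<epsilon>: "\<epsilon> > 0"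
      define s where "s = \<epsilon> / (C' * (norm h)\<^sup>2 + 1)"
      have c1: "C' * (norm h)\<^sup>2 + 1 > 0" using C' by (simp add: add_nonneg_pos)
      have s: "s > 0" using \<epsilon> c1 by (simp add: s_def)
      have "q ((1 - s / (1 + s)) *\<^sub>R (- (s *\<^sub>R h)) + (s / (1 + s)) *\<^sub>R h) \<le>
          (1 - s / (1 + s)) * q (- (s *\<^sub>R h)) + (s / (1 + s)) * q h"
        by (rule convex_onD[OF qconv]) (use s in auto)
      moreover have "1 - s / (1 + s) = 1 / (1 + s)" using s by (simp add: field_simps)
      moreover have "(1 / (1 + s)) *\<^sub>R (- (s *\<^sub>R h)) + (s / (1 + s)) *\<^sub>R h = 0" by simp
      ultimately have "0 \<le> (1 / (1 + s)) * q (- (s *\<^sub>R h)) + (s / (1 + s)) * q h" using q0 by simp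
      then have "0 \<le> (q (- (s *\<^sub>R h)) + s * q h) / (1 + s)" by (simp add: add_divide_distrib)
      then have "0 \<le> q (- (s *\<^sub>R h)) + s * q h" using s by (simp add: zero_le_divide_iff)
      moreover have "q (- (s *\<^sub>R h)) \<le> s * (s * (C' * (norm h)\<^sup>2))"
        using qC[of "- (s *\<^sub>R h)"] by (simp add: power_mult_distrib power2_eq_square mult_ac)
      ultimately have "0 \<le> s * (s * (C' * (norm h)\<^sup>2) + q h)" by (simp add: distrib_left)
      then have "0 \<le> s * (C' * (norm h)\<^sup>2) + q h" using s by (simp add: zero_le_mult_iff)
      moreover have "s * (C' * (norm h)\<^sup>2) \<le> s * (C' * (norm h)\<^sup>2 + 1)" using s by simp
      moreover have "s * (C' * (norm h)\<^sup>2 + 1) = \<epsilon>" using c1 by (simp add: s_def)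
      ultimately show "0 \<le> q h + \<epsilon>" by linarith
    qed
    \<comment> \<open>A test function w for the blow-up becomes a test function for U near x by
      undoing the scaling and restoring the affine and quadratic parts.\<close>
    have contact: "b - \<kappa>' \<le> (\<Sum>i\<in>UNIV. \<xi> i \<bullet> (H h0 *v \<xi> i))"
      if w: "c2_with w g H" and h0: "norm h0 < R" and loc: "\<forall>\<^sub>F h in nhds h0. q h - w h \<le> q h0 - w h0"
        and g: "norm (g h0) \<le> K" and H: "norm (H h0) \<le> K" for w g H h0
    proof -
      define z where "z = x + t *\<^sub>R h0"
      define \<Phi> where "\<Phi> y = (t\<^sup>2 * w ((1 / t) *\<^sub>R y + (- (1 / t) *\<^sub>R x)) + (0 + p \<bullet> (y - x))) + (- 1 / (2 * e)) * (norm (y - x))\<^sup>2" for y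
      define G where "G y = (t\<^sup>2 *\<^sub>R ((1 / t) *\<^sub>R g ((1 / t) *\<^sub>R y + (- (1 / t) *\<^sub>R x))) + p) + (- 1 / (2 * e)) *\<^sub>R (2 *\<^sub>R (y - x))" for y
      define J where "J y = (t\<^sup>2 *\<^sub>R ((1 / t)\<^sup>2 *\<^sub>R H ((1 / t) *\<^sub>R y + (- (1 / t) *\<^sub>R x))) + 0) + (- 1 / (2 * e)) *\<^sub>R (2 *\<^sub>R mat 1)" for y
      have c2: "c2_with \<Phi> G J"
        unfolding \<Phi>_def[abs_def] G_def[abs_def] J_def[abs_def]
        by (intro c2_with_add c2_with_scale c2_with_sqnorm c2_with_linear c2_with_affine w)
      have pt: "(1 / t) *\<^sub>R z + (- (1 / t) *\<^sub>R x) = h0" using t by (simp add: z_def scaleR_add_right)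
      have Gz: "G z = p + t *\<^sub>R g h0 - (t / e) *\<^sub>R h0"
        unfolding G_def pt using t by (simp add: z_def power2_eq_square)
      have Jz: "J z = H h0 - (1 / e) *\<^sub>R mat 1"
        unfolding J_def pt using t by (simp add: power_divide)
      have UQ: "U (x + t *\<^sub>R h) - \<Phi> (x + t *\<^sub>R h) = U x + t\<^sup>2 * (q h - w h)" for h
      proof -
        have "t\<^sup>2 * q h = U (x + t *\<^sub>R h) - U x - t * (p \<bullet> h) + t\<^sup>2 * ((norm h)\<^sup>2 / (2 * e))"
          using t by (simp add: q_def distrib_left)
        moreover have "\<Phi> (x + t *\<^sub>R h) = t\<^sup>2 * w h + t * (p \<bullet> h) - t\<^sup>2 * ((norm h)\<^sup>2 / (2 * e))"
          using t by (simp add: \<Phi>_def scaleR_add_right power_mult_distrib)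
        ultimately show ?thesis by (simp add: right_diff_distrib)
      qed
      have "\<forall>\<^sub>F y in nhds z. U y - \<Phi> y \<le> U z - \<Phi> z"
      proof -
        have "((\<lambda>y. (1 / t) *\<^sub>R (y - x)) \<longlongrightarrow> (1 / t) *\<^sub>R (z - x)) (nhds z)" by (intro tendsto_intros filterlim_ident)
        then have "filterlim (\<lambda>y. (1 / t) *\<^sub>R (y - x)) (nhds h0) (nhds z)" using t by (simp add: z_def)
        from eventually_compose_filterlim[OF loc this]
        show ?thesis
        proof eventually_elim
          case (elim y)
          have "U y - \<Phi> y = U x + t\<^sup>2 * (q ((1 / t) *\<^sub>R (y - x)) - w ((1 / t) *\<^sub>R (y - x)))"
            using UQ[of "(1 / t) *\<^sub>R (y - x)"] t by simp
          also have "\<dots> \<le> U x + t\<^sup>2 * (q h0 - w h0)" using elim by (intro add_left_mono mult_left_mono) auto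
          also have "\<dots> = U z - \<Phi> z" using UQ[of h0] by (simp add: z_def)
          finally show ?case .
        qed
      qed
      note loc' = this
      define y where "y = z + e *\<^sub>R G z"
      have yeq: "y = a + (e * t) *\<^sub>R g h0" unfolding y_def Gz using e by (simp add: a_def z_def algebra_simps)
      have uy: "u y = U z + e * (norm (G z))\<^sup>2 / 2" using contact_value[OF c2 loc'] by (simp add: y_def)
      have ineq: "B y (u y) (G z) \<le> trace (A y ** J z)" using contact_subsol[OF c2 loc' sub] by (simp add: y_def)
      have gK: "norm (g h0) \<le> \<bar>K\<bar>" using g by simp
      have dz: "dist z x \<le> t * R" using h0 t by (simp add: z_def dist_norm)
      have dy: "dist y a \<le> t * (e * \<bar>K\<bar>)" using gK e t by (simp add: yeq dist_norm mult_left_mono)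
      have dG: "dist (G z) p \<le> t * (\<bar>K\<bar> + R / e)"
      proof -
        have "dist (G z) p = norm (t *\<^sub>R g h0 - (t / e) *\<^sub>R h0)" by (simp add: Gz dist_norm algebra_simps)
        also have "\<dots> \<le> t * norm (g h0) + (t / e) * norm h0"
          using norm_triangle_ineq4[of "t *\<^sub>R g h0" "(t / e) *\<^sub>R h0"] t e by simp
        also have "\<dots> \<le> t * \<bar>K\<bar> + (t / e) * R" using gK h0 t e by (intro add_mono mult_left_mono) auto
        finally show ?thesis by (simp add: distrib_left)
      qed
      have "dist (z, y, G z) (x, a, p) \<le> dist z x + (dist y a + dist (G z) p)"
        using dist_Pair_le[of z "(y, G z)" x "(a, p)"] dist_Pair_le[of y "G z" a p] by linarith
      also have "\<dots> \<le> t * R + (t * (e * \<bar>K\<bar>) + t * (\<bar>K\<bar> + R / e))" using dz dy dG by linarith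
      also have "\<dots> \<le> t * M" using t by (simp add: M_def distrib_left)
      finally have "dist (z, y, G z) (x, a, p) < d1" using tM by (simp add: d_def)
      from d1(2)[OF this] have "\<bar>B y (u y) (G z) - b0\<bar> < \<delta>"
        by (simp add: \<Psi>_def uy ua b0_def dist_real_def)
      then have 1: "b0 - \<delta> \<le> B y (u y) (G z)" by linarith
      have "t * (e * \<bar>K\<bar>) \<le> t * M" using t R e by (intro mult_left_mono) (auto simp: M_def add_nonneg_nonneg)
      then have "dist y a < d2" using dy tM by (simp add: d_def)
      from d2(2)[OF this] have Ay: "norm (A y - A a) \<le> \<delta>" by (simp add: dist_norm)
      have Jn: "norm (J z) \<le> K'"
        unfolding Jz K'_def using H norm_triangle_ineq4[of "H h0" "(1 / e) *\<^sub>R mat 1"] by linarith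
      have "\<bar>trace ((A y - A a) ** J z)\<bar> \<le> n2 * (norm (A y - A a) * norm (J z))"
        unfolding n2_def by (rule abs_trace_mult_le)
      also have "\<dots> \<le> n2 * (\<delta> * K')" using Ay Jn n2 \<delta> by (intro mult_left_mono mult_mono) auto
      finally have "trace (A y ** J z) \<le> trace (A a ** J z) + n2 * (\<delta> * K')"
        by (simp add: trace_mult_diff_left)
      with ineq 1 have "b0 - \<delta> * (1 + n2 * K') \<le> trace (A a ** J z)" by (simp add: algebra_simps)
      also have "trace (A a ** J z) = trace (A a ** H h0) - trace (A a) / e"
        by (simp add: Jz trace_mult_diff_right trace_mult_scaleR)
      finally have "b0 + trace (A a) / e - \<delta> * (1 + n2 * K') \<le> trace (A a ** H h0)" by simp
      from mult_left_mono[OF this \<alpha>] have "b - \<alpha> * (\<delta> * (1 + n2 * K')) \<le> (\<Sum>i\<in>UNIV. \<xi> i \<bullet> (H h0 *v \<xi> i))"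
        by (simp add: b_def fac a_def right_diff_distrib)
      then show ?thesis using \<delta>2 by linarith
    qed
    let ?\<zeta> = "\<lambda>i. sqrt (real CARD('m) / real k) *\<^sub>R \<xi> i"
    have main: "b / 2 - \<kappa> \<le> (walk ?\<zeta> ^^ k) q 0"
      by (rule mv[rule_format, OF k, THEN conjunct2, rule_format]) (rule qconv qpos qC contact; assumption)+
    have qsplit: "q = (\<lambda>h. (1 / t\<^sup>2) * U (x + t *\<^sub>R h) + (- U x / t\<^sup>2 + ((- 1 / t) * (p \<bullet> h) + (1 / (2 * e)) * (norm h)\<^sup>2)))"
      using t by (auto simp: q_def fun_eq_iff diff_divide_distrib power2_eq_square)
    have lin: "(walk ?\<zeta> ^^ k) (\<lambda>h. p \<bullet> h) 0 = 0"
      using walk_quadratic[where Q="\<lambda>h. p \<bullet> h" and P="\<lambda>_. 0" and \<xi>="?\<zeta>" and k=k and x=0] by (simp add: inner_add_right inner_diff_right)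
    have quad: "(walk ?\<zeta> ^^ k) (\<lambda>h. (norm h)\<^sup>2) 0 = \<alpha> * trace (A a)"
    proof -
      have "(walk ?\<zeta> ^^ k) (\<lambda>h. (norm h)\<^sup>2) 0 = real k * ((\<Sum>i\<in>UNIV. (norm (?\<zeta> i))\<^sup>2) / real CARD('m))"
        using walk_quadratic[where Q="\<lambda>h. (norm h)\<^sup>2" and P="\<lambda>v. (norm v)\<^sup>2" and \<xi>="?\<zeta>" and k=k and x=0]
        by (simp add: power2_norm_eq_inner inner_add_left inner_add_right inner_diff_left inner_diff_right inner_commute)
      also have "\<dots> = (\<Sum>i\<in>UNIV. (norm (\<xi> i))\<^sup>2)"
        using k0 by (simp add: power_mult_distrib sum_distrib_left[symmetric] sum_divide_distrib[symmetric])
      also have "\<dots> = \<alpha> * trace (A a)" using fac[of "mat 1"] by (simp add: power2_norm_eq_inner a_def)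
      finally show ?thesis .
    qed
    have "(walk ?\<zeta> ^^ k) q 0 = (1 / t\<^sup>2) * (walk ?\<zeta> ^^ k) (\<lambda>h. U (x + t *\<^sub>R h)) 0 - U x / t\<^sup>2 + \<alpha> * trace (A a) / (2 * e)"
      unfolding qsplit walk_add walk_cmult walk_const lin quad by simp
    with main have "b / 2 - \<kappa> \<le> (1 / t\<^sup>2) * (walk ?\<zeta> ^^ k) (\<lambda>h. U (x + t *\<^sub>R h)) 0 - U x / t\<^sup>2 + \<alpha> * trace (A a) / (2 * e)" by simp
    moreover have "b / 2 = \<alpha> * b0 / 2 + \<alpha> * trace (A a) / (2 * e)" by (simp add: b_def distrib_left add_divide_distrib)
    ultimately have "\<alpha> * b0 / 2 - \<kappa> \<le> ((walk ?\<zeta> ^^ k) (\<lambda>h. U (x + t *\<^sub>R h)) 0 - U x) / t\<^sup>2"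
      by (simp add: diff_divide_distrib)
    then have "t\<^sup>2 * (\<alpha> * b0 / 2 - \<kappa>) \<le> (walk ?\<zeta> ^^ k) (\<lambda>h. U (x + t *\<^sub>R h)) 0 - U x"
      using t by (simp add: pos_le_divide_eq mult.commute)
    then show "U x + t\<^sup>2 * (\<alpha> * B (x + e *\<^sub>R p) (u (x + e *\<^sub>R p)) p / 2 - \<kappa>) \<le>
        (walk ?\<zeta> ^^ k) (\<lambda>h. U (x + t *\<^sub>R h)) 0"
      by (simp add: b0_def a_def)
  qed
qed


lemma c2_taylor_local:
  fixes z :: "real ^ 'n"
  assumes "c2_with \<psi> g h" "\<kappa> > 0" "r > 0"
  shows "\<exists>t0>0. \<forall>t. \<forall>d::real ^ 'n. 0 < t \<longrightarrow> t < t0 \<longrightarrow> norm d \<le> r \<longrightarrow>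
    \<psi> (z + t *\<^sub>R d) \<le> \<psi> z + t * (g z \<bullet> d) + t\<^sup>2 / 2 * (d \<bullet> (h z *v d) + \<kappa> * (norm d)\<^sup>2)"
proof -
  have "isCont h z" using c2_with_continuous(3)[OF assms(1), of UNIV] by (simp add: continuous_on_eq_continuous_at)
  then obtain \<delta> where \<delta>: "\<delta> > 0" "\<And>y. dist y z < \<delta> \<Longrightarrow> dist (h y) (h z) < \<kappa>"
    using assms(2) unfolding continuous_at_eps_delta by blast
  show ?thesis
  proof (rule exI[of _ "\<delta> / r"], intro conjI allI impI)
    show "\<delta> / r > 0" using \<delta> assms by simp
    fix t and d :: "real ^ 'n" assume t: "0 < t" "t < \<delta> / r" and d: "norm d \<le> r"
    obtain s where s: "0 < s" "s < 1"
      "\<psi> (z + t *\<^sub>R d) = \<psi> z + g z \<bullet> (t *\<^sub>R d) + ((t *\<^sub>R d) \<bullet> (h (z + s *\<^sub>R t *\<^sub>R d) *v (t *\<^sub>R d))) / 2"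
      using c2_taylor[OF assms(1)] by blast
    define y where "y = z + s *\<^sub>R t *\<^sub>R d"
    have "dist y z = s * (t * norm d)" using s t by (simp add: y_def dist_norm)
    also have "\<dots> \<le> 1 * (t * r)" using s t d by (intro mult_mono) auto
    also have "\<dots> < \<delta>" using t assms by (simp add: field_simps)
    finally have "norm (h y - h z) \<le> \<kappa>" using \<delta>(2)[of y] by (simp add: dist_norm)
    then have "norm (h y - h z) * (norm d)\<^sup>2 \<le> \<kappa> * (norm d)\<^sup>2" by (rule mult_right_mono) simp
    then have "d \<bullet> ((h y - h z) *v d) \<le> \<kappa> * (norm d)\<^sup>2" using abs_quadratic_form_le[of d "h y - h z"] by linarith
    then have "d \<bullet> (h y *v d) \<le> d \<bullet> (h z *v d) + \<kappa> * (norm d)\<^sup>2"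
      by (simp add: matrix_vector_mult_diff_rdistrib inner_diff_right)
    then have "t\<^sup>2 / 2 * (d \<bullet> (h y *v d)) \<le> t\<^sup>2 / 2 * (d \<bullet> (h z *v d) + \<kappa> * (norm d)\<^sup>2)"
      by (rule mult_left_mono) simp
    moreover have "\<psi> (z + t *\<^sub>R d) = \<psi> z + t * (g z \<bullet> d) + t\<^sup>2 / 2 * (d \<bullet> (h y *v d))"
      using s(3) by (simp add: y_def matrix_vector_mult_scaleR power2_eq_square)
    ultimately show "\<psi> (z + t *\<^sub>R d) \<le> \<psi> z + t * (g z \<bullet> d) + t\<^sup>2 / 2 * (d \<bullet> (h z *v d) + \<kappa> * (norm d)\<^sup>2)"
      by simp
  qed
qed

text \<open>This replaces the theorem on sums of Crandall and Ishii. The mean value inequalities of the two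
  sup-convolutions are added along the coupled walk with steps \<open>(\<xi>\<^sub>i, \<eta>\<^sub>i)\<close>.\<close>

lemma sup_conv_sums:
  fixes u1 u2 :: "real ^ 'n \<Rightarrow> real" and \<xi> \<eta> :: "'m::finite \<Rightarrow> real ^ 'n"
  assumes u1: "sup_convolution u1 e S" and u2: "sup_convolution u2 e S"
    and sub1: "subsol A B1 u1" and sub2: "subsol A B2 u2"
    and A: "continuous_on UNIV A"
    and B1: "continuous_on UNIV (\<lambda>(x, r, p). B1 x r p)" and B2: "continuous_on UNIV (\<lambda>(x, r, p). B2 x r p)"
    and \<psi>: "c2_with \<psi> g h" and hC: "\<And>z v. v \<bullet> (h z *v v) \<le> 2 * C * (norm v)\<^sup>2" and C: "C \<ge> 0"
    and max: "\<And>x' y'. sup_conv e u1 x' + sup_conv e u2 y' - \<psi> (x' - y') \<le>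
      sup_conv e u1 x + sup_conv e u2 y - \<psi> (x - y)"
    and p: "p = g (x - y)" and a: "a = x + e *\<^sub>R p" and b: "b = y - e *\<^sub>R p"
    and fac1: "\<And>X. (\<Sum>i\<in>UNIV. \<xi> i \<bullet> (X *v \<xi> i)) = \<alpha> * trace (A a ** X)" and \<alpha>: "\<alpha> \<ge> 0"
    and fac2: "\<And>X. (\<Sum>i\<in>UNIV. \<eta> i \<bullet> (X *v \<eta> i)) = trace (A b ** X)"
  shows "\<alpha> * B1 a (u1 a) p + B2 b (u2 b) (- p) \<le> (\<Sum>i\<in>UNIV. (\<xi> i - \<eta> i) \<bullet> (h (x - y) *v (\<xi> i - \<eta> i)))"
proof -
  define U where "U = sup_conv e u1"
  define V where "V = sup_conv e u2"
  define \<zeta> where "\<zeta> = x - y"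
  define m where "m = real CARD('m)"
  have m: "m > 0" by (simp add: m_def)
  define D where "D i = \<xi> i - \<eta> i" for i
  define T where "T = (\<Sum>i\<in>UNIV. (norm (D i))\<^sup>2)"
  have T: "T \<ge> 0" by (simp add: T_def sum_nonneg)
  define Q where "Q = (\<Sum>i\<in>UNIV. D i \<bullet> (h \<zeta> *v D i))"
  \<comment> \<open>The global upper bound on the Hessian of \<open>\<psi>\<close> makes both
    sup-convolutions lie below a paraboloid at the maximum, as \<open>sup_conv_mean_value\<close>
    requires.\<close>
  have tay: "\<psi> (z + v) \<le> \<psi> z + g z \<bullet> v + C * (norm v)\<^sup>2" for z v
    using c2_taylor[OF \<psi>, of z v] hC by (metis (no_types, lifting) add_left_mono divide_right_mono mult.assoc
        nonzero_mult_div_cancel_left zero_le_numeral zero_neq_numeral)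
  have touch1: "sup_conv e u1 (x + v) \<le> sup_conv e u1 x + p \<bullet> v + C * (norm v)\<^sup>2" for v
    using max[of "x + v" y] tay[of "x - y" v] by (simp add: p algebra_simps)
  have touch2: "sup_conv e u2 (y + v) \<le> sup_conv e u2 y + (- p) \<bullet> v + C * (norm v)\<^sup>2" for v
    using max[of x "y + v"] tay[of "x - y" "- v"] by (simp add: p algebra_simps)
  have "(\<alpha> * B1 a (u1 a) p + B2 b (u2 b) (- p)) / 2 \<le> Q / 2 + \<kappa>0" if \<kappa>0: "\<kappa>0 > 0" for \<kappa>0
  proof -
    \<comment> \<open>Each of the two mean value inequalities costs \<open>\<kappa>\<close>, and the
      Taylor error of \<open>\<psi>\<close> costs \<open>\<kappa> * T / 2\<close>.\<close>
    define \<kappa> where "\<kappa> = \<kappa>0 / (2 + T / 2)"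
    have \<kappa>: "\<kappa> > 0" using \<kappa>0 T by (simp add: \<kappa>_def)
    have \<kappa>e: "2 * \<kappa> + \<kappa> * T / 2 = \<kappa>0"
    proof -
      have "\<kappa> * (2 + T / 2) = \<kappa>0" using T by (simp add: \<kappa>_def)
      then show ?thesis by (simp add: distrib_left)
    qed
    obtain k1 where k1: "\<forall>k\<ge>k1. 0 < k \<and> (\<exists>t0>0. \<forall>t. 0 < t \<longrightarrow> t < t0 \<longrightarrow>
      U x + t\<^sup>2 * (\<alpha> * B1 (x + e *\<^sub>R p) (u1 (x + e *\<^sub>R p)) p / 2 - \<kappa>) \<le>
      (walk (\<lambda>i. sqrt (m / real k) *\<^sub>R \<xi> i) ^^ k) (\<lambda>h. U (x + t *\<^sub>R h)) 0)"
      using sup_convolution.sup_conv_mean_value[OF u1 sub1 A B1 touch1 fac1[unfolded a] C \<alpha> \<kappa>, folded U_def m_def]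
      by (elim exE) (rule that)
    have fac2': "(\<Sum>i\<in>UNIV. \<eta> i \<bullet> (X *v \<eta> i)) = 1 * trace (A (y + e *\<^sub>R (- p)) ** X)" for X
      using fac2[of X] by (simp add: b)
    obtain k2 where k2: "\<forall>k\<ge>k2. 0 < k \<and> (\<exists>t0>0. \<forall>t. 0 < t \<longrightarrow> t < t0 \<longrightarrow>
      V y + t\<^sup>2 * (1 * B2 (y + e *\<^sub>R (- p)) (u2 (y + e *\<^sub>R (- p))) (- p) / 2 - \<kappa>) \<le>
      (walk (\<lambda>i. sqrt (m / real k) *\<^sub>R \<eta> i) ^^ k) (\<lambda>h. V (y + t *\<^sub>R h)) 0)"
      using sup_convolution.sup_conv_mean_value[OF u2 sub2 A B2 touch2 fac2' C zero_le_one \<kappa>, folded V_def m_def]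
      by (elim exE) (rule that)
    \<comment> \<open>Both walks must have the same number of steps and the same scaling c to be
      coupled; this is why the mean value inequality is stated for all large k.\<close>
    define k where "k = max k1 k2"
    have k: "k1 \<le> k" "k2 \<le> k" by (auto simp: k_def)
    have k0: "0 < k" by (rule k1[rule_format, OF k(1), THEN conjunct1])
    define c where "c = sqrt (m / real k)"
    have c2: "c\<^sup>2 = m / real k" and c0: "c \<ge> 0" using m by (auto simp: c_def)
    obtain t1 where t1: "t1 > 0" "\<And>t. 0 < t \<Longrightarrow> t < t1 \<Longrightarrow>
      U x + t\<^sup>2 * (\<alpha> * B1 a (u1 a) p / 2 - \<kappa>) \<le> (walk (\<lambda>i. c *\<^sub>R \<xi> i) ^^ k) (\<lambda>h. U (x + t *\<^sub>R h)) 0"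
      using k1[rule_format, OF k(1), THEN conjunct2, folded c_def a] by (elim exE conjE) (rule that, auto)
    obtain t2 where t2: "t2 > 0" "\<And>t. 0 < t \<Longrightarrow> t < t2 \<Longrightarrow>
      V y + t\<^sup>2 * (B2 b (u2 b) (- p) / 2 - \<kappa>) \<le> (walk (\<lambda>i. c *\<^sub>R \<eta> i) ^^ k) (\<lambda>h. V (y + t *\<^sub>R h)) 0"
      using k2[rule_format, OF k(2), THEN conjunct2, folded c_def] by (elim exE conjE) (rule that, auto simp: b)
    define Bd where "Bd = (\<Sum>i\<in>UNIV. norm (c *\<^sub>R D i)) + 1"
    have Bd: "norm (c *\<^sub>R D i) \<le> Bd" for i
    proof -
      have "norm (c *\<^sub>R D i) \<le> (\<Sum>i\<in>UNIV. norm (c *\<^sub>R D i))" by (rule member_le_sum) auto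
      then show ?thesis by (simp add: Bd_def)
    qed
    have Bd0: "Bd > 0" by (simp add: Bd_def add_nonneg_pos sum_nonneg)
    obtain t3 where t3: "t3 > 0" "\<And>t d. 0 < t \<Longrightarrow> t < t3 \<Longrightarrow> norm d \<le> real k * Bd \<Longrightarrow>
      \<psi> (\<zeta> + t *\<^sub>R d) \<le> \<psi> \<zeta> + t * (g \<zeta> \<bullet> d) + t\<^sup>2 / 2 * (d \<bullet> (h \<zeta> *v d) + \<kappa> * (norm d)\<^sup>2)"
      using c2_taylor_local[OF \<psi> \<kappa>, of "real k * Bd" \<zeta>] k0 Bd0 by auto
    define t where "t = min t1 (min t2 t3) / 2"
    have t: "0 < t" "t < t1" "t < t2" "t < t3" using t1(1) t2(1) t3(1) by (auto simp: t_def)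
    let ?\<xi> = "\<lambda>i. c *\<^sub>R \<xi> i" and ?\<eta> = "\<lambda>i. c *\<^sub>R \<eta> i" and ?D = "\<lambda>i. c *\<^sub>R D i"
    let ?J = "\<lambda>i. (c *\<^sub>R \<xi> i, c *\<^sub>R \<eta> i)"
    have w1: "(walk ?J ^^ k) (\<lambda>z. U (x + t *\<^sub>R fst z)) 0 = (walk ?\<xi> ^^ k) (\<lambda>h. U (x + t *\<^sub>R h)) 0"
      using walk_compose[where T=fst and \<xi>="?J" and \<eta>="?\<xi>" and \<phi>="\<lambda>h. U (x + t *\<^sub>R h)" and x=0 and k=k] by simp
    have w2: "(walk ?J ^^ k) (\<lambda>z. V (y + t *\<^sub>R snd z)) 0 = (walk ?\<eta> ^^ k) (\<lambda>h. V (y + t *\<^sub>R h)) 0"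
      using walk_compose[where T=snd and \<xi>="?J" and \<eta>="?\<eta>" and \<phi>="\<lambda>h. V (y + t *\<^sub>R h)" and x=0 and k=k] by simp
    have w3: "(walk ?J ^^ k) (\<lambda>z. \<psi> (\<zeta> + t *\<^sub>R (fst z - snd z))) 0 = (walk ?D ^^ k) (\<lambda>d. \<psi> (\<zeta> + t *\<^sub>R d)) 0"
      using walk_compose[where T="\<lambda>z. fst z - snd z" and \<xi>="?J" and \<eta>="?D" and \<phi>="\<lambda>d. \<psi> (\<zeta> + t *\<^sub>R d)" and x=0 and k=k]
      by (simp add: D_def algebra_simps)
    have "U x + t\<^sup>2 * (\<alpha> * B1 a (u1 a) p / 2 - \<kappa>) + (V y + t\<^sup>2 * (B2 b (u2 b) (- p) / 2 - \<kappa>)) \<le>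
      (walk ?J ^^ k) (\<lambda>z. U (x + t *\<^sub>R fst z)) 0 + (walk ?J ^^ k) (\<lambda>z. V (y + t *\<^sub>R snd z)) 0"
      unfolding w1 w2 by (intro add_mono t1(2) t2(2) t)
    also have "\<dots> = (walk ?J ^^ k) (\<lambda>z. U (x + t *\<^sub>R fst z) + V (y + t *\<^sub>R snd z)) 0" by (simp add: walk_add)
    \<comment> \<open>Maximality of (x, y) is a pointwise inequality on the product space, so
      monotonicity of the coupled walk transports it. No second derivative of U or V
      appears.\<close>
    also have "\<dots> \<le> (walk ?J ^^ k) (\<lambda>z. (U x + V y - \<psi> \<zeta>) + \<psi> (\<zeta> + t *\<^sub>R (fst z - snd z))) 0"
    proof (rule walk_iter_mono)
      fix z :: "(real ^ 'n) \<times> (real ^ 'n)"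
      have "x + t *\<^sub>R fst z - (y + t *\<^sub>R snd z) = \<zeta> + t *\<^sub>R (fst z - snd z)"
        by (simp add: \<zeta>_def algebra_simps)
      from max[of "x + t *\<^sub>R fst z" "y + t *\<^sub>R snd z", unfolded this, folded U_def V_def \<zeta>_def]
      show "U (x + t *\<^sub>R fst z) + V (y + t *\<^sub>R snd z) \<le> (U x + V y - \<psi> \<zeta>) + \<psi> (\<zeta> + t *\<^sub>R (fst z - snd z))"
        by linarith
    qed
    also have "\<dots> = (U x + V y - \<psi> \<zeta>) + (walk ?D ^^ k) (\<lambda>d. \<psi> (\<zeta> + t *\<^sub>R d)) 0"
      unfolding walk_add walk_const w3 ..
    finally have 1: "t\<^sup>2 * (\<alpha> * B1 a (u1 a) p / 2 - \<kappa>) + t\<^sup>2 * (B2 b (u2 b) (- p) / 2 - \<kappa>) \<le>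
      (walk ?D ^^ k) (\<lambda>d. \<psi> (\<zeta> + t *\<^sub>R d)) 0 - \<psi> \<zeta>" by linarith
    have lin: "(walk ?D ^^ k) (\<lambda>d. g \<zeta> \<bullet> d) 0 = 0"
      using walk_quadratic[where Q="\<lambda>h. g \<zeta> \<bullet> h" and P="\<lambda>_. 0" and \<xi>="?D" and k=k and x=0]
      by (simp add: inner_add_right inner_diff_right)
    have quad: "(walk ?D ^^ k) (\<lambda>d. d \<bullet> (M *v d)) 0 = (\<Sum>i\<in>UNIV. D i \<bullet> (M *v D i))" for M
    proof -
      have "(walk ?D ^^ k) (\<lambda>d. d \<bullet> (M *v d)) 0 = real k * ((\<Sum>i\<in>UNIV. ?D i \<bullet> (M *v ?D i)) / m)"
        using walk_quadratic[where Q="\<lambda>d. d \<bullet> (M *v d)" and P="\<lambda>d. d \<bullet> (M *v d)" and \<xi>="?D" and k=k and x=0]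
        by (simp add: inner_add_left inner_add_right inner_diff_left inner_diff_right
            matrix_vector_right_distrib matrix_vector_mult_diff_distrib m_def)
      also have "(\<Sum>i\<in>UNIV. ?D i \<bullet> (M *v ?D i)) = c\<^sup>2 * (\<Sum>i\<in>UNIV. D i \<bullet> (M *v D i))"
        by (simp add: matrix_vector_mult_scaleR sum_distrib_left power2_eq_square mult_ac)
      finally show ?thesis using k0 m by (simp add: c2)
    qed
    \<comment> \<open>The difference walk stays in a ball of radius \<open>real k * Bd\<close>,
      where the expansion of \<open>\<psi>\<close> is valid. The squared norm is written with
      \<open>mat 1\<close> so that \<open>quad\<close> covers it.\<close>
    have "(walk ?D ^^ k) (\<lambda>d. \<psi> (\<zeta> + t *\<^sub>R d)) 0 \<le>
      (walk ?D ^^ k) (\<lambda>d. \<psi> \<zeta> + (t * (g \<zeta> \<bullet> d) + (t\<^sup>2 / 2 * (d \<bullet> (h \<zeta> *v d)) + t\<^sup>2 / 2 * \<kappa> * (d \<bullet> (mat 1 *v d))))) 0"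
    proof (rule walk_mono_local[OF Bd])
      fix d :: "real ^ 'n" assume "norm (d - 0) \<le> real k * Bd"
      from t3(2)[OF t(1) t(4), of d] this
      show "\<psi> (\<zeta> + t *\<^sub>R d) \<le> \<psi> \<zeta> + (t * (g \<zeta> \<bullet> d) + (t\<^sup>2 / 2 * (d \<bullet> (h \<zeta> *v d)) + t\<^sup>2 / 2 * \<kappa> * (d \<bullet> (mat 1 *v d))))"
        by (simp add: power2_norm_eq_inner distrib_left)
    qed
    also have "\<dots> = \<psi> \<zeta> + (t\<^sup>2 / 2 * Q + t\<^sup>2 / 2 * \<kappa> * T)"
      unfolding walk_add walk_const walk_cmult lin quad by (simp add: Q_def T_def power2_norm_eq_inner)
    finally have "t\<^sup>2 * (\<alpha> * B1 a (u1 a) p / 2 - \<kappa>) + t\<^sup>2 * (B2 b (u2 b) (- p) / 2 - \<kappa>) \<le>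
      t\<^sup>2 / 2 * Q + t\<^sup>2 / 2 * \<kappa> * T" using 1 by linarith
    then have "t\<^sup>2 * (\<alpha> * B1 a (u1 a) p / 2 - \<kappa> + (B2 b (u2 b) (- p) / 2 - \<kappa>)) \<le> t\<^sup>2 * (Q / 2 + \<kappa> * T / 2)"
      unfolding distrib_left by simp
    then have "\<alpha> * B1 a (u1 a) p / 2 - \<kappa> + (B2 b (u2 b) (- p) / 2 - \<kappa>) \<le> Q / 2 + \<kappa> * T / 2"
      using t(1) by simp
    then show ?thesis using \<kappa>e by (simp add: add_divide_distrib)
  qed
  then have "(\<alpha> * B1 a (u1 a) p + B2 b (u2 b) (- p)) / 2 \<le> Q / 2" by (rule field_le_epsilon)
  then show ?thesis by (simp add: Q_def D_def \<zeta>_def)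
qed


section \<open>Doubling of variables\<close>

text \<open>The constant makes the function vanish at 0 and stay below \<open>L * norm z\<close>;
  replacing the cone by it in the doubling thus does not decrease the maximum.\<close>

lemma c2_smoothed_norm:
  fixes L e :: real
  assumes "e > 0"
  defines "n \<equiv> \<lambda>z::real^'n. sqrt (z \<bullet> z + e\<^sup>2)"
  shows "c2_with (\<lambda>z. L * n z + - L * e) (\<lambda>z. (L / n z) *\<^sub>R z)
    (\<lambda>z. (L / n z) *\<^sub>R mat 1 - (L / n z ^ 3) *\<^sub>R (\<chi> i j. z $ i * z $ j))"
  unfolding c2_with_def
proof (intro conjI allI)
  fix z :: "real ^ 'n"
  have pos: "z \<bullet> z + e\<^sup>2 > 0" for z :: "real ^ 'n" using assms by (simp add: add_nonneg_pos)
  then have n: "n z > 0" for z by (simp add: n_def)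
  have dn: "(n has_derivative (\<lambda>v. (z \<bullet> v) / n z)) (at z)"
    unfolding n_def using pos[of z]
    by (auto intro!: derivative_eq_intros simp: inner_commute field_simps)
  show "((\<lambda>z. L * n z + - L * e) has_derivative (\<lambda>v. ((L / n z) *\<^sub>R z) \<bullet> v)) (at z)"
    by (rule has_derivative_eq_rhs[OF has_derivative_add[OF has_derivative_mult_right[OF dn] has_derivative_const]]) auto
  have m: "(\<chi> i j. z $ i * z $ j) *v v = (z \<bullet> v) *\<^sub>R z" for v :: "real ^ 'n"
    by (simp add: matrix_vector_mult_def vec_eq_iff inner_vec_def sum_distrib_left sum_distrib_right mult_ac)
  have di: "((\<lambda>z. L / n z) has_derivative (\<lambda>v. - (L / n z ^ 3) * (z \<bullet> v))) (at z)"
    using n[of z] by (auto intro!: derivative_eq_intros dn simp: field_simps power3_eq_cube power2_eq_square)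
  show "((\<lambda>z. (L / n z) *\<^sub>R z) has_derivative
      (\<lambda>v. ((L / n z) *\<^sub>R mat 1 - (L / n z ^ 3) *\<^sub>R (\<chi> i j. z $ i * z $ j)) *v v)) (at z)"
    by (rule has_derivative_eq_rhs[OF has_derivative_scaleR[OF di has_derivative_ident]])
       (simp add: fun_eq_iff matrix_vector_mult_diff_rdistrib scaleR_matrix_vector_assoc[symmetric] m)
next
  have pos: "z \<bullet> z + e\<^sup>2 > 0" for z :: "real ^ 'n" using assms by (simp add: add_nonneg_pos)
  then have "n z \<noteq> 0" for z by (metis n_def less_irrefl real_sqrt_gt_zero)
  then show "continuous_on UNIV (\<lambda>z. (L / n z) *\<^sub>R mat 1 - (L / n z ^ 3) *\<^sub>R (\<chi> i j. z $ i * z $ j))"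
    unfolding n_def by (intro continuous_intros) auto
qed

lemma smoothed_norm_hess_le:
  fixes z v :: "real ^ 'n"
  assumes "L \<ge> 0" "N > 0"
  shows "v \<bullet> (((L / N) *\<^sub>R mat 1 - (L / N ^ 3) *\<^sub>R (\<chi> i j. z $ i * z $ j)) *v v) \<le> L / N * (norm v)\<^sup>2"
proof -
  have m: "(\<chi> i j. z $ i * z $ j) *v v = (z \<bullet> v) *\<^sub>R z"
    by (simp add: matrix_vector_mult_def vec_eq_iff inner_vec_def sum_distrib_left sum_distrib_right mult_ac)
  have "v \<bullet> (((L / N) *\<^sub>R mat 1 - (L / N ^ 3) *\<^sub>R (\<chi> i j. z $ i * z $ j)) *v v) =
      L / N * (norm v)\<^sup>2 - L / N ^ 3 * (z \<bullet> v)\<^sup>2"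
    by (simp add: matrix_vector_mult_diff_rdistrib scaleR_matrix_vector_assoc[symmetric] m inner_diff_right
        power2_norm_eq_inner) (simp add: power2_eq_square inner_commute)
  moreover have "L / N ^ 3 * (z \<bullet> v)\<^sup>2 \<ge> 0" using assms by simp
  ultimately show ?thesis by linarith
qed

section \<open>Periodic functions\<close>

definition int_vec :: "real ^ 'n \<Rightarrow> bool" where "int_vec k \<longleftrightarrow> (\<forall>i. k $ i \<in> \<int>)"

lemma torus_fun_shift: "torus_fun g \<Longrightarrow> int_vec k \<Longrightarrow> g (x + k) = g x" "torus_fun g \<Longrightarrow> int_vec k \<Longrightarrow> g (x - k) = g x"
proof -
  assume "torus_fun g" "int_vec k"
  then show "g (x + k) = g x" for x by (simp add: torus_fun_def int_vec_def)
  from this[of "x - k"] show "g (x - k) = g x" by simp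
qed

lemma ex_int_shift: "\<exists>k. int_vec k \<and> x - k \<in> cbox 0 (1::real^'n)"
proof (intro exI conjI)
  show "int_vec (\<chi> i. of_int \<lfloor>x $ i\<rfloor>)" by (simp add: int_vec_def)
  show "x - (\<chi> i. of_int \<lfloor>x $ i\<rfloor>) \<in> cbox 0 1" by (simp add: mem_box_cart) linarith
qed

lemma torus_fun_bounded:
  fixes g :: "real ^ 'n \<Rightarrow> 'b::real_normed_vector"
  assumes "torus_fun g" "continuous_on UNIV g"
  shows "\<exists>B\<ge>0. \<forall>x. norm (g x) \<le> B"
proof -
  have "compact (g ` cbox 0 1)"
    by (rule compact_continuous_image[OF continuous_on_subset[OF assms(2)] compact_cbox]) auto
  then have "bounded (g ` cbox 0 1)" by (rule compact_imp_bounded)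
  then obtain B where B: "\<forall>y\<in>g ` cbox 0 1. norm y \<le> B" unfolding bounded_iff by blast
  have "norm (g x) \<le> max 0 B" for x
  proof -
    obtain k where k: "int_vec k" "x - k \<in> cbox 0 1" using ex_int_shift by blast
    then have "g x = g (x - k)" using torus_fun_shift(2)[OF assms(1) k(1)] by simp
    then show ?thesis using B k(2) by (simp add: le_max_iff_disj)
  qed
  then show ?thesis by (intro exI[of _ "max 0 B"]) auto
qed

lemma (in sup_convolution) sup_conv_torus:
  assumes "torus_fun u" shows "torus_fun U"
  unfolding torus_fun_def
proof (intro allI impI)
  fix x k :: "real ^ 'n" assume "\<forall>i. k $ i \<in> \<int>"
  then have k: "int_vec k" by (simp add: int_vec_def)
  have nk: "int_vec (- k)" using k by (simp add: int_vec_def)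
  have le: "U (z + l) \<le> U z" if "int_vec l" for z l
  proof -
    obtain a where "U (z + l) = u a - (norm (z + l - a))\<^sup>2 / (2 * e)" using sup_conv_attained by blast
    also have "\<dots> = u (a - l) - (norm (z - (a - l)))\<^sup>2 / (2 * e)"
      using torus_fun_shift(2)[OF assms that] by (simp add: algebra_simps)
    finally show ?thesis using sup_conv_ge by simp
  qed
  show "U (x + k) = U x" using le[OF k, of x] le[OF nk, of "x + k"] by simp
qed

text \<open>Shifting x and y by one integer vector changes nothing, so x can be put in the unit
  cube, while a large difference is excluded by the growth of \<open>\<psi>\<close>. The variables
  are therefore x and \<open>x - y\<close>.\<close>

lemma periodic_max_exists:
  fixes U V :: "real ^ 'n \<Rightarrow> real"
  assumes "torus_fun U" "torus_fun V" "continuous_on UNIV U" "continuous_on UNIV V" "continuous_on UNIV \<psi>"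
    and far: "\<And>z. norm z \<ge> \<rho> \<Longrightarrow> \<psi> z \<ge> M" and M: "\<And>x y. U x + V y - M \<le> U 0 + V 0 - \<psi> 0" and \<rho>: "\<rho> \<ge> 0"
  shows "\<exists>x y. \<forall>x' y'. U x' + V y' - \<psi> (x' - y') \<le> U x + V y - \<psi> (x - y)"
proof -
  define \<Phi> where "\<Phi> z = U (fst z) + V (fst z - snd z) - \<psi> (snd z)" for z :: "(real ^ 'n) \<times> (real ^ 'n)"
  let ?K = "cbox 0 (1::real^'n) \<times> cball (0::real^'n) \<rho>"
  have "continuous_on ?K \<Phi>"
    unfolding \<Phi>_def[abs_def]
    by (intro continuous_intros continuous_on_compose2[OF assms(3)] continuous_on_compose2[OF assms(4)]
        continuous_on_compose2[OF assms(5)]) auto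
  moreover have "compact ?K" by (intro compact_Times compact_cbox compact_cball)
  moreover have 0: "(0, 0) \<in> ?K" using \<rho> by (simp add: mem_box_cart)
  ultimately obtain z where z: "z \<in> ?K" "\<And>w. w \<in> ?K \<Longrightarrow> \<Phi> w \<le> \<Phi> z"
    using continuous_attains_sup[of ?K \<Phi>] by blast
  have "U x' + V y' - \<psi> (x' - y') \<le> \<Phi> z" for x' y'
  proof (cases "norm (x' - y') \<le> \<rho>")
    case True
    obtain k where k: "int_vec k" "x' - k \<in> cbox 0 1" using ex_int_shift by blast
    have "U x' + V y' - \<psi> (x' - y') = \<Phi> (x' - k, x' - y')"
      using torus_fun_shift(2)[OF assms(1) k(1), of x'] torus_fun_shift(2)[OF assms(2) k(1), of y']
      by (simp add: \<Phi>_def algebra_simps)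
    also have "\<dots> \<le> \<Phi> z" by (rule z) (use True k in auto)
    finally show ?thesis .
  next
    case False
    then have "U x' + V y' - \<psi> (x' - y') \<le> U x' + V y' - M" using far[of "x' - y'"] by simp
    also have "\<dots> \<le> \<Phi> (0, 0)" using M by (simp add: \<Phi>_def)
    also have "\<dots> \<le> \<Phi> z" by (rule z(2)[OF 0])
    finally show ?thesis .
  qed
  then show ?thesis
    by (intro exI[of _ "fst z"] exI[of _ "fst z - snd z"]) (simp add: \<Phi>_def)
qed

text \<open>The squared slope \<open>(1 + s r)\<^sup>2\<close> in front of the first equation is what makes the trace terms useful:
  it produces \<open>r H\<close> on the left, which beats the \<open>L r\<close> on the right by superlinearity.\<close>

lemma doubling_estimate:
  fixes u v :: "real ^ 'n \<Rightarrow> real" and A :: "real ^ 'n \<Rightarrow> real ^ 'n ^ 'n"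
  assumes usc: "usc u" "usc (\<lambda>x. - v x)" and per: "torus_fun u" "torus_fun v"
    and bdd: "\<And>x. \<bar>u x\<bar> \<le> S" "\<And>x. \<bar>v x\<bar> \<le> S"
    and sub: "subsol A (\<lambda>x r p. H x p + G x r - c) u"
    and super: "subsol A (\<lambda>x r p. - (H x (- p) + G x (- r) - c)) (\<lambda>x. - v x)"
    and A: "continuous_on UNIV A" and H: "continuous_on UNIV (\<lambda>(x, p). H x p)"
    and G: "continuous_on UNIV (\<lambda>(x, r). G x r)"
    and coup: "\<And>a b. \<exists>\<xi> \<eta>. factors (A a) \<xi> \<and> factors (A b) \<eta> \<and>
      (\<Sum>i\<in>UNIV. (norm (\<xi> i - \<eta> i))\<^sup>2) \<le> KA * (norm (a - b))\<^sup>2" and KA: "KA \<ge> 0"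
    and TA: "\<And>a. trace (A a) \<le> TA"
    and H0: "\<And>x p. 1 \<le> H x p + C0" and C0: "C0 \<ge> 0"
    and H1: "\<And>a b p. norm (a - b) \<le> 2 \<Longrightarrow> H b p + C0 \<le> (1 + \<gamma> * norm (a - b)) * (H a p + C0)" and \<gamma>: "\<gamma> \<ge> 0"
    and H2: "superlinear_in_p H"
    and GS: "\<And>x r. \<bar>r\<bar> \<le> S \<Longrightarrow> \<bar>G x r\<bar> \<le> CG"
    and sep: "\<And>m. m > 0 \<Longrightarrow> \<exists>\<theta>>0. \<forall>a b. u a - v b \<ge> m \<longrightarrow> G a (u a) - G b (v b) \<ge> \<theta> - KG * norm (a - b)"
    and KG: "KG \<ge> 0"
  shows "\<exists>L\<ge>0. \<forall>x y. u x - v y \<le> L * norm (x - y)"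
proof -
  have S: "S \<ge> 0" using bdd(1)[of 0] by linarith
  have CG: "CG \<ge> 0" using GS[of 0 0] S by simp
  \<comment> \<open>The factor \<open>(1 + s * r)\<^sup>2\<close> yields at least
    \<open>2 * s * r\<close> times the shifted Hamiltonian. Of this, \<open>\<gamma> * r\<close>
    pays for moving H from a to b and r is left over.\<close>
  define s where "s = (\<gamma> + 1) / 2"
  have s: "s > 0" "2 * s = \<gamma> + 1" using \<gamma> by (auto simp: s_def)
  define C2 where "C2 = CG + \<bar>c\<bar> + C0"
  have C2: "C2 \<ge> 0" using CG C0 by (simp add: C2_def)
  define C3 where "C3 = (2 * s + 2 * s\<^sup>2) * C2 + KG"
  have C3: "C3 \<ge> 0" using s C2 KG by (simp add: C3_def)
  define C5 where "C5 = 2 * KA + 2 * s\<^sup>2 * \<bar>TA\<bar> + 1"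
  have C5: "C5 > 0" using KA by (simp add: C5_def add_nonneg_pos)
  have "\<forall>\<^sub>F p in at_infinity. \<forall>x. H x p / norm p \<ge> 4 * C5 + 2"
    using H2 by (simp add: superlinear_in_p_def)
  \<comment> \<open>The slope is chosen so that \<open>norm p \<ge> L / 2\<close> gives
    \<open>H a p \<ge> 2 * C5 * L + L\<close>, above the bound \<open>C6\<close> since
    \<open>L \<ge> C3 + 1\<close>.\<close>
  then obtain P0 where P0: "\<And>p x. norm p \<ge> P0 \<Longrightarrow> H x p / norm p \<ge> 4 * C5 + 2"
    unfolding eventually_at_infinity by blast
  \<comment> \<open>The summands ensure in turn that the slope at the maximum exceeds
    \<open>P0\<close>, that L beats the error terms free of L, and that the maximising points are
    within distance 1.\<close>
  define L where "L = 2 * \<bar>P0\<bar> + C3 + 4 * S + 1"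
  have L: "L > 0" "L \<ge> 2 * \<bar>P0\<bar> + 1" "L \<ge> C3 + 1" "L \<ge> 4 * S" using C3 S by (auto simp: L_def)
  have "u x0 - v y0 \<le> L * norm (x0 - y0)" for x0 y0
  proof (rule ccontr)
    assume "\<not> u x0 - v y0 \<le> L * norm (x0 - y0)"
    then obtain m where m: "m > 0" "u x0 - v y0 - L * norm (x0 - y0) = m" by simp
    \<comment> \<open>The gap depends on m, hence on the points that violate the estimate, but L was
      fixed before. It enters only the scale of smoothing.\<close>
    obtain \<theta> where \<theta>: "\<theta> > 0" "\<And>a b. u a - v b \<ge> m \<Longrightarrow> G a (u a) - G b (v b) \<ge> \<theta> - KG * norm (a - b)"
      using sep[OF m(1)] by blast
    define C6 where "C6 = C3 + 2 * C5 * L"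
    have C6: "C6 > 0" using C3 C5 L by (simp add: C6_def add_nonneg_pos)
    \<comment> \<open>The final inequality forces \<open>\<theta> / C6 \<le> r\<close>. This
      \<open>e0\<close> is then below \<open>norm \<zeta>\<close>, where the smoothed cone still has
      at least half its slope.\<close>
    define e0 where "e0 = min (1 / 2) (\<theta> / C6 / 2)"
    have e0: "e0 > 0" "e0 \<le> 1 / 2" "2 * e0 \<le> \<theta> / C6" using \<theta> C6 by (auto simp: e0_def)
    \<comment> \<open>With \<open>2 * e * L = e0\<close> the contact points a and b, displaced by
      \<open>e *\<^sub>R p\<close>, are at most twice as far apart as x and y.\<close>
    define e where "e = e0 / (2 * L)"
    have e: "e > 0" "2 * e * L = e0" using e0 L by (auto simp: e_def)
    define N where "N z = sqrt (z \<bullet> z + e0\<^sup>2)" for z :: "real ^ 'n"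
    have N: "N z > 0" "norm z \<le> N z" "N z \<le> norm z + e0" "e0 \<le> N z" for z
    proof -
      have "0 < z \<bullet> z + e0\<^sup>2" using e0 by (simp add: add_nonneg_pos)
      then show "N z > 0" by (simp add: N_def)
      show "norm z \<le> N z" by (simp add: N_def norm_eq_sqrt_inner)
      show "N z \<le> norm z + e0"
        using sqrt_sum_squares_le_sum[of "norm z" e0] e0 by (simp add: N_def power2_norm_eq_inner)
      show "e0 \<le> N z" unfolding N_def by (rule real_le_rsqrt) simp
    qed
    define \<psi> where "\<psi> z = L * N z + - L * e0" for z
    define g where "g z = (L / N z) *\<^sub>R z" for z
    define h where "h z = (L / N z) *\<^sub>R mat 1 - (L / N z ^ 3) *\<^sub>R (\<chi> i j. z $ i * z $ j)" for z
    have c2: "c2_with \<psi> g h"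
      using c2_smoothed_norm[OF e0(1), of L] by (simp add: \<psi>_def[abs_def] g_def[abs_def] h_def[abs_def] N_def)
    have hN: "w \<bullet> (h z *v w) \<le> L / N z * (norm w)\<^sup>2" for z w
      unfolding h_def by (rule smoothed_norm_hess_le) (use L N in auto)
    have hC: "w \<bullet> (h z *v w) \<le> 2 * (L / (2 * e0)) * (norm w)\<^sup>2" for z w
    proof -
      have "L / N z \<le> L / e0" using N[of z] e0 L by (intro divide_left_mono) auto
      then have "L / N z * (norm w)\<^sup>2 \<le> L / e0 * (norm w)\<^sup>2" by (rule mult_right_mono) simp
      then show ?thesis using hN[of w z] by simp
    qed
    have \<psi>0: "\<psi> z \<ge> 0" "\<psi> 0 = 0" "\<psi> z \<le> L * norm z" "\<psi> z \<ge> L * (norm z - e0)" for z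
    proof -
      have "L * e0 \<le> L * N z" "L * N z \<le> L * (norm z + e0)" "L * norm z \<le> L * N z"
        using N[of z] L by (auto intro!: mult_left_mono)
      then show "\<psi> z \<ge> 0" "\<psi> z \<le> L * norm z" "\<psi> z \<ge> L * (norm z - e0)" by (auto simp: \<psi>_def algebra_simps)
      show "\<psi> 0 = 0" using e0 by (simp add: \<psi>_def N_def)
    qed
    define v' where "v' x = - v x" for x
    interpret u: sup_convolution u e S by unfold_locales (use usc bdd e in auto)
    interpret v: sup_convolution v' e S by unfold_locales (use usc bdd e in \<open>auto simp: v'_def[abs_def]\<close>)
    have v'per: "torus_fun v'" using per(2) by (simp add: torus_fun_def v'_def)
    obtain x y where max: "\<And>x' y'. u.U x' + v.U y' - \<psi> (x' - y') \<le> u.U x + v.U y - \<psi> (x - y)"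
    proof -
      have "\<exists>x y. \<forall>x' y'. u.U x' + v.U y' - \<psi> (x' - y') \<le> u.U x + v.U y - \<psi> (x - y)"
      proof (rule periodic_max_exists[where M="4 * S" and \<rho>="4 * S / L + e0"])
        show "torus_fun u.U" "torus_fun v.U" using u.sup_conv_torus v.sup_conv_torus per(1) v'per by blast+
        show "continuous_on UNIV u.U" "continuous_on UNIV v.U" "continuous_on UNIV \<psi>"
          using u.sup_conv_continuous v.sup_conv_continuous c2_with_continuous(1)[OF c2] by blast+
        show "4 * S \<le> \<psi> z" if "4 * S / L + e0 \<le> norm z" for z
        proof -
          have "4 * S = L * (4 * S / L)" using L by simp
          also have "\<dots> \<le> L * (norm z - e0)" using that L by (intro mult_left_mono) auto
          finally show ?thesis using \<psi>0(4)[of z] by simp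
        qed
        show "u.U x + v.U y - 4 * S \<le> u.U 0 + v.U 0 - \<psi> 0" for x y
          using u.sup_conv_upper[of x] v.sup_conv_upper[of y] u.sup_conv_lower[of 0] v.sup_conv_lower[of 0]
            bdd(1)[of 0] bdd(2)[of 0] \<psi>0(2) by (simp add: v'_def)
        show "0 \<le> 4 * S / L + e0" using S L e0 by simp
      qed
      then show ?thesis using that by blast
    qed
    define \<zeta> where "\<zeta> = x - y"
    define p where "p = g \<zeta>"
    define a where "a = x + e *\<^sub>R p"
    define b where "b = y - e *\<^sub>R p"
    have ge: "u.U x + v.U y - \<psi> \<zeta> \<ge> m"
      using max[of x0 y0] u.sup_conv_lower[of x0] v.sup_conv_lower[of y0] \<psi>0(3)[of "x0 - y0"] m(2)
      by (simp add: v'_def \<zeta>_def)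
    \<comment> \<open>The value of u at the contact point is at least that of U at x, so the gap m
      passes from the sup-convolutions to the original functions.\<close>
    have ua: "u.U x \<le> u a"
    proof -
      have c: "c2_with (\<lambda>z. \<psi> (1 *\<^sub>R z + - y)) (\<lambda>z. 1 *\<^sub>R g (1 *\<^sub>R z + - y)) (\<lambda>z. 1\<^sup>2 *\<^sub>R h (1 *\<^sub>R z + - y))"
        by (rule c2_with_affine[OF c2])
      have "\<forall>\<^sub>F z in nhds x. u.U z - \<psi> (1 *\<^sub>R z + - y) \<le> u.U x - \<psi> (1 *\<^sub>R x + - y)"
      proof (intro always_eventually allI)
        fix z show "u.U z - \<psi> (1 *\<^sub>R z + - y) \<le> u.U x - \<psi> (1 *\<^sub>R x + - y)" using max[of z y] by simp
      qed
      from u.contact_value[OF c this] show ?thesis using e by (simp add: a_def p_def \<zeta>_def)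
    qed
    have vb: "v.U y \<le> v' b"
    proof -
      have c: "c2_with (\<lambda>z. \<psi> ((-1) *\<^sub>R z + x)) (\<lambda>z. (-1) *\<^sub>R g ((-1) *\<^sub>R z + x)) (\<lambda>z. (-1)\<^sup>2 *\<^sub>R h ((-1) *\<^sub>R z + x))"
        by (rule c2_with_affine[OF c2])
      have "\<forall>\<^sub>F z in nhds y. v.U z - \<psi> ((-1) *\<^sub>R z + x) \<le> v.U y - \<psi> ((-1) *\<^sub>R y + x)"
      proof (intro always_eventually allI)
        fix z show "v.U z - \<psi> ((-1) *\<^sub>R z + x) \<le> v.U y - \<psi> ((-1) *\<^sub>R y + x)" using max[of x z] by simp
      qed
      from v.contact_value[OF c this] show ?thesis using e by (simp add: b_def p_def \<zeta>_def)
    qed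
    have uv: "u a - v b \<ge> m" using ge ua vb \<psi>0(1)[of \<zeta>] by (simp add: v'_def)
    \<comment> \<open>The distance of the contact points, because the equations, and with them A and
      H, are evaluated at a and b.\<close>
    define r where "r = norm (a - b)"
    have ab: "a - b = (1 + 2 * e * (L / N \<zeta>)) *\<^sub>R \<zeta>"
    proof -
      have "e *\<^sub>R p + e *\<^sub>R p = (2 * e) *\<^sub>R p" by (simp only: mult_2 scaleR_add_left)
      then have "a - b = \<zeta> + (2 * e) *\<^sub>R p" by (simp add: a_def b_def \<zeta>_def algebra_simps)
      then show ?thesis by (simp add: p_def g_def scaleR_add_left)
    qed
    have f: "0 \<le> 2 * e * (L / N \<zeta>)" "2 * e * (L / N \<zeta>) \<le> 1"
    proof -
      show "0 \<le> 2 * e * (L / N \<zeta>)" using e L N[of \<zeta>] by simp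
      have "2 * e * (L / N \<zeta>) = e0 / N \<zeta>" using e(2) by simp
      also have "\<dots> \<le> 1" using N(1,4)[of \<zeta>] by simp
      finally show "2 * e * (L / N \<zeta>) \<le> 1" .
    qed
    have rz: "r \<le> 2 * norm \<zeta>"
    proof -
      have "r = (1 + 2 * e * (L / N \<zeta>)) * norm \<zeta>" using f by (simp add: r_def ab)
      also have "\<dots> \<le> 2 * norm \<zeta>" using f by (intro mult_right_mono) auto
      finally show ?thesis .
    qed
    have r0: "r \<ge> 0" by (simp add: r_def)
    have "norm \<zeta> \<le> 1"
    proof -
      have "L * (norm \<zeta> - e0) \<le> 2 * S"
        using \<psi>0(4)[of \<zeta>] ge m(1) u.sup_conv_upper[of x] v.sup_conv_upper[of y] by linarith
      also have "\<dots> \<le> L * (1 / 2)" using L(4) by simp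
      finally show ?thesis using L e0 by simp
    qed
    then have r2: "r \<le> 2" using rz by simp
    obtain \<xi> \<eta> where fac: "factors (A a) \<xi>" "factors (A b) \<eta>"
      and cl: "(\<Sum>i\<in>UNIV. (norm (\<xi> i - \<eta> i))\<^sup>2) \<le> KA * r\<^sup>2"
      using coup[of a b] unfolding r_def by blast
    have TAx: "(\<Sum>i\<in>UNIV. (norm (\<xi> i))\<^sup>2) \<le> \<bar>TA\<bar>"
    proof -
      have "(\<Sum>i\<in>UNIV. (norm (\<xi> i))\<^sup>2) = trace (A a)"
        using fac(1)[unfolded factors_def, rule_format, of "mat 1"] by (simp add: power2_norm_eq_inner)
      then show ?thesis using TA[of a] by simp
    qed
    define \<alpha> where "\<alpha> = (1 + s * r)\<^sup>2"
    define ha where "ha = H a p + G a (u a) - c"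
    define hb where "hb = H b p + G b (v b) - c"
    have "\<alpha> * (H a p + G a (u a) - c) + (- (H b (- (- p)) + G b (- v' b) - c)) \<le>
      (\<Sum>i\<in>UNIV. ((1 + s * r) *\<^sub>R \<xi> i - \<eta> i) \<bullet> (h (x - y) *v ((1 + s * r) *\<^sub>R \<xi> i - \<eta> i)))"
    proof (rule sup_conv_sums[where ?u1.0=u and ?u2.0=v' and ?B1.0="\<lambda>x r p. H x p + G x r - c"
          and ?B2.0="\<lambda>x r p. - (H x (- p) + G x (- r) - c)" and \<xi>="\<lambda>i. (1 + s * r) *\<^sub>R \<xi> i" and \<eta>=\<eta> and e=e and S=S
          and A=A and \<psi>=\<psi> and C="L / (2 * e0)" and p=p and a=a and b=b and x=x and y=y])
      show "sup_convolution u e S" "sup_convolution v' e S" by unfold_locales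
      show "subsol A (\<lambda>x r p. H x p + G x r - c) u" by (rule sub)
      show "subsol A (\<lambda>x r p. - (H x (- p) + G x (- r) - c)) v'" using super by (simp add: v'_def[abs_def])
      show "continuous_on UNIV (\<lambda>(x, r, p). H x p + G x r - c)"
        unfolding split_beta
        by (intro continuous_intros continuous_on_compose2[OF H, where f="\<lambda>z. (fst z, snd (snd z))", simplified]
            continuous_on_compose2[OF G, where f="\<lambda>z. (fst z, fst (snd z))", simplified])
      show "continuous_on UNIV (\<lambda>(x, r, p). - (H x (- p) + G x (- r) - c))"
        unfolding split_beta
        by (intro continuous_intros continuous_on_compose2[OF H, where f="\<lambda>z. (fst z, - snd (snd z))", simplified]
            continuous_on_compose2[OF G, where f="\<lambda>z. (fst z, - fst (snd z))", simplified])
      show "u.U x' + v.U y' - \<psi> (x' - y') \<le> u.U x + v.U y - \<psi> (x - y)" for x' y' by (rule max)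
      show "p = g (x - y)" by (simp add: p_def \<zeta>_def)
      show "a = x + e *\<^sub>R p" "b = y - e *\<^sub>R p" by (simp_all add: a_def b_def)
      show "(\<Sum>i\<in>UNIV. ((1 + s * r) *\<^sub>R \<xi> i) \<bullet> (X *v ((1 + s * r) *\<^sub>R \<xi> i))) = \<alpha> * trace (A a ** X)" for X
        using fac(1)[unfolded factors_def, rule_format, of X]
        by (simp add: matrix_vector_mult_scaleR \<alpha>_def power2_eq_square sum_distrib_left mult_ac)
      show "(\<Sum>i\<in>UNIV. \<eta> i \<bullet> (X *v \<eta> i)) = trace (A b ** X)" for X
        using fac(2)[unfolded factors_def, rule_format, of X] by simp
    qed (use A c2 hC L e0 in \<open>auto simp: \<alpha>_def\<close>)
    also have "\<dots> \<le> (\<Sum>i\<in>UNIV. L / N \<zeta> * (norm ((1 + s * r) *\<^sub>R \<xi> i - \<eta> i))\<^sup>2)"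
      unfolding \<zeta>_def by (intro sum_mono hN)
    also have "\<dots> = L / N \<zeta> * (\<Sum>i\<in>UNIV. (norm ((1 + s * r) *\<^sub>R \<xi> i - \<eta> i))\<^sup>2)" by (simp add: sum_distrib_left)
    also have "\<dots> \<le> L / N \<zeta> * (C5 * r\<^sup>2)"
    proof (rule mult_left_mono)
      \<comment> \<open>The step difference splits into the coupling error and
        \<open>(s * r) *\<^sub>R \<xi> i\<close>; both are of order r, so unequal factors in front
        of the two equations are affordable.\<close>
      have "(norm ((1 + s * r) *\<^sub>R \<xi> i - \<eta> i))\<^sup>2 \<le> 2 * (norm (\<xi> i - \<eta> i))\<^sup>2 + 2 * (s * r)\<^sup>2 * (norm (\<xi> i))\<^sup>2" for i
      proof -
        have "norm ((1 + s * r) *\<^sub>R \<xi> i - \<eta> i) \<le> norm (\<xi> i - \<eta> i) + (s * r) * norm (\<xi> i)"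
          using norm_triangle_ineq[of "\<xi> i - \<eta> i" "(s * r) *\<^sub>R \<xi> i"] s r0 by (simp add: algebra_simps)
        then have "(norm ((1 + s * r) *\<^sub>R \<xi> i - \<eta> i))\<^sup>2 \<le> (norm (\<xi> i - \<eta> i) + (s * r) * norm (\<xi> i))\<^sup>2"
          by (rule power_mono) simp
        also have "\<dots> \<le> 2 * (norm (\<xi> i - \<eta> i))\<^sup>2 + 2 * ((s * r) * norm (\<xi> i))\<^sup>2"
          using sum_squares_bound[of "norm (\<xi> i - \<eta> i)" "(s * r) * norm (\<xi> i)"]
          by (simp add: power2_sum)
        finally show ?thesis by (simp add: power_mult_distrib)
      qed
      then have "(\<Sum>i\<in>UNIV. (norm ((1 + s * r) *\<^sub>R \<xi> i - \<eta> i))\<^sup>2) \<le>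
          (\<Sum>i\<in>UNIV. 2 * (norm (\<xi> i - \<eta> i))\<^sup>2 + 2 * (s * r)\<^sup>2 * (norm (\<xi> i))\<^sup>2)"
        by (intro sum_mono)
      also have "\<dots> = 2 * (\<Sum>i\<in>UNIV. (norm (\<xi> i - \<eta> i))\<^sup>2) + 2 * (s * r)\<^sup>2 * (\<Sum>i\<in>UNIV. (norm (\<xi> i))\<^sup>2)"
        by (simp add: sum.distrib sum_distrib_left)
      also have "\<dots> \<le> 2 * (KA * r\<^sup>2) + 2 * (s * r)\<^sup>2 * \<bar>TA\<bar>"
        using cl TAx by (intro add_mono mult_left_mono) auto
      also have "\<dots> = (2 * KA + 2 * s\<^sup>2 * \<bar>TA\<bar>) * r\<^sup>2" by (simp add: power_mult_distrib algebra_simps)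
      also have "\<dots> \<le> C5 * r\<^sup>2" by (intro mult_right_mono) (auto simp: C5_def)
      finally show "(\<Sum>i\<in>UNIV. (norm ((1 + s * r) *\<^sub>R \<xi> i - \<eta> i))\<^sup>2) \<le> C5 * r\<^sup>2" .
      show "0 \<le> L / N \<zeta>" using L N[of \<zeta>] by simp
    qed
    \<comment> \<open>The Hessian of the smoothed norm is singular like
      \<open>1 / N \<zeta>\<close>, which consumes one of the two powers of r.\<close>
    also have "\<dots> \<le> 2 * C5 * L * r"
    proof -
      have "r / N \<zeta> \<le> 2" using rz N[of \<zeta>] by (simp add: pos_divide_le_eq)
      then have "L * C5 * r * (r / N \<zeta>) \<le> L * C5 * r * 2" using L C5 r0 by (intro mult_left_mono) auto
      then show ?thesis by (simp add: power2_eq_square mult_ac)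
    qed
    finally have est: "\<alpha> * ha - hb \<le> 2 * C5 * L * r" by (simp add: ha_def hb_def v'_def)
    define Ha where "Ha = H a p + C0"
    have Ha: "Ha \<ge> 1" using H0 by (simp add: Ha_def)
    have Hb: "H b p + C0 \<le> (1 + \<gamma> * r) * Ha" unfolding Ha_def r_def by (rule H1) (use r2 r_def in simp)
    have gsep: "G a (u a) - G b (v b) \<ge> \<theta> - KG * r" using \<theta>(2)[OF uv] by (simp add: r_def)
    define ga where "ga = G a (u a) - c - C0"
    have ga: "- C2 \<le> ga" using GS[OF bdd(1)[of a], of a] unfolding ga_def C2_def by linarith
    define q where "q = \<alpha> - 1"
    have q: "2 * s * r \<le> q" "q \<le> (2 * s + 2 * s\<^sup>2) * r" "0 \<le> q"
    proof -
      have qe: "q = 2 * s * r + s\<^sup>2 * (r * r)" by (simp add: q_def \<alpha>_def power2_eq_square algebra_simps)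
      show "2 * s * r \<le> q" using s r0 by (simp add: qe)
      have "r * r \<le> 2 * r" using r2 r0 by (intro mult_right_mono) auto
      then have "s\<^sup>2 * (r * r) \<le> s\<^sup>2 * (2 * r)" by (rule mult_left_mono) simp
      then show "q \<le> (2 * s + 2 * s\<^sup>2) * r" by (simp add: qe algebra_simps)
      show "0 \<le> q" using s r0 by (simp add: qe)
    qed
    \<comment> \<open>Separates the superlinear gain \<open>q * Ha\<close>, the zero-order
      contribution it multiplies, the change of H between a and b, and the gap.\<close>
    have "\<alpha> * ha - hb = q * Ha + q * ga + (Ha - (H b p + C0)) + (G a (u a) - G b (v b))"
      by (simp add: ha_def hb_def Ha_def ga_def q_def algebra_simps)
    moreover have "q * Ha \<ge> (\<gamma> + 1) * r * Ha" using q(1) Ha s(2) by (intro mult_right_mono) auto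
    moreover have "Ha - (H b p + C0) \<ge> - (\<gamma> * r * Ha)" using Hb by (simp add: algebra_simps)
    moreover have "q * ga \<ge> - ((2 * s + 2 * s\<^sup>2) * r * C2)"
    proof -
      have "q * C2 \<le> (2 * s + 2 * s\<^sup>2) * r * C2" using q(2) C2 by (rule mult_right_mono)
      moreover have "q * (- C2) \<le> q * ga" using ga q(3) by (rule mult_left_mono)
      ultimately show ?thesis by simp
    qed
    ultimately have "(\<gamma> + 1) * r * Ha - (2 * s + 2 * s\<^sup>2) * r * C2 - \<gamma> * r * Ha + \<theta> - KG * r \<le> 2 * C5 * L * r"
      using est gsep by linarith
    \<comment> \<open>Used twice: dropping \<open>r * Ha\<close> keeps r away from 0, and dropping
      \<open>\<theta>\<close> bounds the Hamiltonian by \<open>C6\<close>. The latter contradicts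
      superlinearity once the slope is known to be at least \<open>L / 2\<close>.\<close>
    then have fin: "r * Ha + \<theta> \<le> C6 * r" by (simp add: C6_def C3_def algebra_simps)
    have "r * Ha \<ge> 0" using r0 Ha by simp
    then have "\<theta> \<le> C6 * r" using fin by linarith
    then have rs: "\<theta> / C6 \<le> r" using C6 by (simp add: pos_divide_le_eq mult.commute)
    then have ze: "e0 \<le> norm \<zeta>" using e0(3) rz by simp
    have rp: "r > 0" using rs \<theta> C6 by (smt (verit) divide_pos_pos)
    have "r * Ha < r * C6" using fin \<theta> by (simp add: mult.commute)
    then have HaC: "Ha < C6" using rp by simp
    have "norm p \<ge> L / 2"
    proof -
      have "N \<zeta> \<le> 2 * norm \<zeta>" using N(3)[of \<zeta>] ze by simp
      then have "L / 2 * N \<zeta> \<le> L / 2 * (2 * norm \<zeta>)" using L by (intro mult_left_mono) auto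
      then have "L / 2 \<le> L * norm \<zeta> / N \<zeta>" using N(1)[of \<zeta>] by (simp add: pos_le_divide_eq)
      also have "\<dots> = norm p" using L N(1)[of \<zeta>] by (simp add: p_def g_def)
      finally show ?thesis .
    qed
    then have np: "norm p \<ge> L / 2" "norm p > 0" "norm p \<ge> P0" using L by linarith+
    from P0[OF np(3), of a] have "(4 * C5 + 2) * norm p \<le> H a p" using np(2) by (simp add: pos_le_divide_eq)
    moreover have "(4 * C5 + 2) * (L / 2) \<le> (4 * C5 + 2) * norm p" using np C5 by (intro mult_left_mono) auto
    moreover have "(4 * C5 + 2) * (L / 2) = 2 * C5 * L + L" by (simp add: algebra_simps)
    ultimately have "2 * C5 * L + L \<le> H a p" by linarith
    then show False using HaC L(3) C0 by (simp add: Ha_def C6_def)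
  qed
  then show ?thesis using L(1) by (intro exI[of _ L]) auto
qed


section \<open>Perron's method\<close>

text \<open>The upper limit of f at x, including the point itself. As \<open>Inf\<close> is taken
  over reals, the results below assume a bound on f.\<close>

definition usc_env :: "('a::topological_space \<Rightarrow> real) \<Rightarrow> 'a \<Rightarrow> real"
  where "usc_env f x = Inf {c. \<forall>\<^sub>F y in nhds x. f y \<le> c}"

context
  fixes f :: "'a::topological_space \<Rightarrow> real" and M :: real
  assumes bd: "\<And>x. \<bar>f x\<bar> \<le> M"
begin

lemma usc_env_le:
  assumes "\<forall>\<^sub>F y in nhds x. f y \<le> c" shows "usc_env f x \<le> c"
  unfolding usc_env_def
proof (rule cInf_lower)
  show "c \<in> {c. \<forall>\<^sub>F y in nhds x. f y \<le> c}" using assms by simp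
  show "bdd_below {c. \<forall>\<^sub>F y in nhds x. f y \<le> c}"
    by (rule bdd_belowI[of _ "f x"]) (auto dest: eventually_nhds_x_imp_x)
qed

lemma usc_env_ge: "f x \<le> usc_env f x"
  unfolding usc_env_def
proof (rule cInf_greatest)
  have "\<forall>\<^sub>F y in nhds x. f y \<le> M" using bd by (auto intro!: always_eventually simp: abs_le_iff)
  then show "{c. \<forall>\<^sub>F y in nhds x. f y \<le> c} \<noteq> {}" by blast
qed (auto dest: eventually_nhds_x_imp_x)

lemma usc_env_less:
  assumes "usc_env f x < c" shows "\<exists>c'<c. \<forall>\<^sub>F y in nhds x. f y \<le> c'"
proof -
  have "\<forall>\<^sub>F y in nhds x. f y \<le> M" using bd by (auto intro!: always_eventually simp: abs_le_iff)
  then have "{c. \<forall>\<^sub>F y in nhds x. f y \<le> c} \<noteq> {}" by blast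
  from cInf_lessD[OF this] assms show ?thesis unfolding usc_env_def by blast
qed

lemma usc_usc_env: "usc (usc_env f)"
proof (rule uscI)
  fix x c assume "usc_env f x < c"
  then obtain c' where c': "c' < c" "\<forall>\<^sub>F y in nhds x. f y \<le> c'" using usc_env_less by blast
  from c'(2) have "\<forall>\<^sub>F z in nhds x. \<forall>\<^sub>F y in nhds z. f y \<le> c'" by (simp add: eventually_eventually)
  then show "\<forall>\<^sub>F z in nhds x. usc_env f z < c"
    by eventually_elim (use usc_env_le c'(1) in \<open>blast intro: le_less_trans\<close>)
qed

lemma usc_env_le_usc:
  assumes "usc g" "\<And>x. f x \<le> g x" shows "usc_env f x \<le> g x"
proof (rule field_le_epsilon)
  fix e :: real assume "e > 0"
  then have "\<forall>\<^sub>F y in nhds x. g y < g x + e" using usc_eventually[OF assms(1), of x "g x + e"] by simp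
  then have "\<forall>\<^sub>F y in nhds x. f y \<le> g x + e"
    by eventually_elim (use assms(2) in \<open>meson less_imp_le order_trans\<close>)
  then show "usc_env f x \<le> g x + e" by (rule usc_env_le)
qed

lemma usc_env_frequently:
  assumes "e > 0" "\<forall>\<^sub>F y in nhds x. P y" shows "\<exists>y. P y \<and> usc_env f x - e < f y"
proof (rule ccontr)
  assume "\<not> ?thesis"
  then have "\<forall>\<^sub>F y in nhds x. f y \<le> usc_env f x - e"
    using assms(2) by (auto elim!: eventually_mono simp: not_less)
  from usc_env_le[OF this] assms(1) show False by simp
qed

end

lemma usc_env_torus:
  fixes f :: "real ^ 'n \<Rightarrow> real"
  assumes "torus_fun f" shows "torus_fun (usc_env f)"
  unfolding torus_fun_def
proof (intro allI impI)
  fix x k :: "real ^ 'n" assume "\<forall>i. k $ i \<in> \<int>"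
  then have k: "int_vec k" by (simp add: int_vec_def)
  have "(\<forall>\<^sub>F y in nhds (x + k). f y \<le> c) \<longleftrightarrow> (\<forall>\<^sub>F y in nhds x. f y \<le> c)" for c
  proof -
    have "nhds (x + k) = filtermap (\<lambda>y. y + k) (nhds x)"
      using filtermap_nhds_shift[of "- k" "x + k"] filtermap_nhds_shift[of "-k" x] by simp
    then show ?thesis by (simp add: eventually_filtermap torus_fun_shift(1)[OF assms k])
  qed
  then show "usc_env f (x + k) = usc_env f x" by (simp add: usc_env_def)
qed

text \<open>Gives the contradiction in both halves of Perron's method: a strict failure of the
  inequality at one point persists for nearby points and nearby values of the function.\<close>

lemma strict_nbhd:
  fixes A :: "real ^ 'n \<Rightarrow> real ^ 'n ^ 'n"
  assumes A: "continuous_on UNIV A" and B: "continuous_on UNIV (\<lambda>(x, r, p). B x r p)"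
    and c2: "c2_with \<phi> g h" and lt: "trace (A x ** h x) < B x s (g x)"
  shows "\<exists>d>0. \<forall>y r. dist y x < d \<longrightarrow> \<bar>r - s\<bar> < d \<longrightarrow> trace (A y ** h y) < B y r (g y)"
proof -
  define \<Psi> where "\<Psi> z = B (fst z) (snd z) (g (fst z)) - trace (A (fst z) ** h (fst z))" for z
  have cA: "continuous_on UNIV (\<lambda>z. A (fst z))" "continuous_on UNIV (\<lambda>z. h (fst z))"
    by (intro continuous_on_compose2[OF A] continuous_on_compose2[OF c2_with_continuous(3)[OF c2, of UNIV]] continuous_intros; simp)+
  have cg: "continuous_on UNIV (\<lambda>z. g (fst z))"
    by (intro continuous_on_compose2[OF c2_with_continuous(2)[OF c2, of UNIV]] continuous_intros) auto
  have "continuous_on UNIV (\<lambda>z. (fst z, snd z, g (fst z)))"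
    by (intro continuous_intros cg)
  from continuous_on_compose2[OF B this] have cB: "continuous_on UNIV (\<lambda>z. B (fst z) (snd z) (g (fst z)))"
    by simp
  have "continuous_on UNIV \<Psi>"
    unfolding \<Psi>_def[abs_def] trace_def matrix_matrix_mult_def
    by (intro continuous_intros cA cB)
  then have "isCont \<Psi> (x, s)" by (simp add: continuous_on_eq_continuous_at)
  moreover have "\<Psi> (x, s) > 0" using lt by (simp add: \<Psi>_def)
  ultimately obtain d where d: "d > 0" "\<And>z. dist z (x, s) < d \<Longrightarrow> dist (\<Psi> z) (\<Psi> (x, s)) < \<Psi> (x, s)"
    unfolding continuous_at_eps_delta by blast
  show ?thesis
  proof (intro exI[of _ "d / 2"] conjI allI impI)
    show "d / 2 > 0" using d by simp
    fix y r assume "dist y x < d / 2" "\<bar>r - s\<bar> < d / 2"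
    then have "dist (y, r) (x, s) < d" using dist_Pair_le[of y r x s] by (simp add: dist_real_def)
    from d(2)[OF this] show "trace (A y ** h y) < B y r (g y)"
      by (simp add: \<Psi>_def dist_real_def abs_less_iff)
  qed
qed


lemma isCont_dist_eventually:
  fixes f :: "'a::metric_space \<Rightarrow> 'b::metric_space"
  shows "isCont f x \<Longrightarrow> e > 0 \<Longrightarrow> \<forall>\<^sub>F y in nhds x. dist (f y) (f x) < e"
  unfolding eventually_nhds_metric continuous_at_eps_delta by blast

lemma c2_perturb:
  assumes "c2_with \<phi> g h"
  shows "c2_with (\<lambda>y. \<phi> y + \<kappa> * (norm (y - x))\<^sup>2) (\<lambda>y. g y + \<kappa> *\<^sub>R (2 *\<^sub>R (y - x))) (\<lambda>y. h y + \<kappa> *\<^sub>R (2 *\<^sub>R mat 1))"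
  by (intro c2_with_add c2_with_scale c2_with_sqnorm assms)

lemma trace_perturb: "trace (A ** (h + \<kappa> *\<^sub>R (2 *\<^sub>R mat 1))) = trace (A ** h) + 2 * \<kappa> * trace A"
  for A :: "real ^ 'n ^ 'n"
proof -
  have "h + \<kappa> *\<^sub>R (2 *\<^sub>R mat 1) = h - (- 2 * \<kappa>) *\<^sub>R mat 1" by simp
  then show ?thesis by (simp only: trace_mult_diff_right trace_mult_scaleR) simp
qed

text \<open>If the envelope failed at x, a quadratic perturbation would make the contact strict.
  Some member v almost reaching the envelope near x then has an interior contact point close to x,
  where its own inequality contradicts \<open>strict_nbhd\<close>.\<close>

lemma subsol_usc_env_Sup:
  fixes A :: "real ^ 'n \<Rightarrow> real ^ 'n ^ 'n"
  assumes A: "continuous_on UNIV A" and B: "continuous_on UNIV (\<lambda>(x, r, p). B x r p)"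
    and V: "V \<noteq> {}" "\<And>v. v \<in> V \<Longrightarrow> usc v" "\<And>v. v \<in> V \<Longrightarrow> subsol A B v"
    and bd: "\<And>v x. v \<in> V \<Longrightarrow> \<bar>v x\<bar> \<le> M"
  shows "subsol A B (usc_env (\<lambda>x. SUP v\<in>V. v x))"
  unfolding subsol_def
proof (intro allI impI)
  define W0 where "W0 x = (SUP v\<in>V. v x)" for x
  have bda: "bdd_above ((\<lambda>v. v x) ` V)" for x using bd by (auto intro!: bdd_aboveI[of _ M] simp: abs_le_iff)
  have vW0: "v x \<le> W0 x" if "v \<in> V" for v x unfolding W0_def by (rule cSUP_upper[OF that bda])
  have W0b: "\<bar>W0 x\<bar> \<le> M" for x
  proof -
    obtain v where v: "v \<in> V" using V(1) by blast
    have "W0 x \<le> M" unfolding W0_def using V(1) bd by (intro cSUP_least) (auto simp: abs_le_iff)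
    moreover have "- M \<le> W0 x" using vW0[OF v, of x] bd[OF v, of x] by linarith
    ultimately show ?thesis by simp
  qed
  define W where "W = usc_env W0"
  have WW: "W0 y \<le> W y" for y unfolding W_def by (rule usc_env_ge[OF W0b])
  fix \<phi> g h x
  assume c2: "c2_with \<phi> g h"
    and "\<forall>\<^sub>F y in nhds x. usc_env (\<lambda>x. SUP v\<in>V. v x) y - \<phi> y \<le> usc_env (\<lambda>x. SUP v\<in>V. v x) x - \<phi> x"
  then have loc: "\<forall>\<^sub>F y in nhds x. W y - \<phi> y \<le> W x - \<phi> x" by (simp add: W_def W0_def[abs_def])
  have "B x (W x) (g x) \<le> trace (A x ** h x)"
  proof (rule ccontr)
    assume "\<not> B x (W x) (g x) \<le> trace (A x ** h x)"
    then have lt: "trace (A x ** h x) < B x (W x) (g x)" by simp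
    \<comment> \<open>The perturbation raises the trace by at most \<open>\<kappa> * D\<close>, half
      of the defect at x.\<close>
    define D where "D = 2 * \<bar>trace (A x)\<bar> + 2"
    have D: "D > 0" by (simp add: D_def add_nonneg_pos)
    define \<kappa> where "\<kappa> = (B x (W x) (g x) - trace (A x ** h x)) / D / 2"
    have \<kappa>: "\<kappa> > 0" using lt D by (simp add: \<kappa>_def)
    define \<phi>' where "\<phi>' y = \<phi> y + \<kappa> * (norm (y - x))\<^sup>2" for y
    define g' where "g' y = g y + \<kappa> *\<^sub>R (2 *\<^sub>R (y - x))" for y
    define h' where "h' y = h y + \<kappa> *\<^sub>R (2 *\<^sub>R mat 1)" for y
    have c2': "c2_with \<phi>' g' h'" unfolding \<phi>'_def[abs_def] g'_def[abs_def] h'_def[abs_def] by (rule c2_perturb[OF c2])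
    have "trace (A x ** h' x) < B x (W x) (g' x)"
    proof -
      have "2 * \<kappa> * trace (A x) \<le> \<kappa> * D" using \<kappa> mult_left_mono[of "2 * trace (A x)" D \<kappa>] by (simp add: D_def)
      also have "\<dots> = (B x (W x) (g x) - trace (A x ** h x)) / 2" using D by (simp add: \<kappa>_def)
      also have "\<dots> < B x (W x) (g x) - trace (A x ** h x)" using lt by simp
      finally show ?thesis unfolding h'_def g'_def trace_perturb by simp
    qed
    from strict_nbhd[OF A B c2' this] obtain d where d: "d > 0"
      "\<And>y r. dist y x < d \<Longrightarrow> \<bar>r - W x\<bar> < d \<Longrightarrow> trace (A y ** h' y) < B y r (g' y)" by blast
    have "isCont \<phi>' x" "isCont \<phi> x"
      using c2_with_continuous(1)[OF c2', of UNIV] c2_with_continuous(1)[OF c2, of UNIV]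
      by (simp_all add: continuous_on_eq_continuous_at)
    moreover have "d / 4 > 0" using d(1) by simp
    ultimately have "\<forall>\<^sub>F y in nhds x. dist (\<phi>' y) (\<phi>' x) < d / 4" "\<forall>\<^sub>F y in nhds x. dist (\<phi> y) (\<phi> x) < d / 4"
      using isCont_dist_eventually[of x \<phi>' "d / 4"] isCont_dist_eventually[of x \<phi> "d / 4"] by blast+
    with loc have "\<forall>\<^sub>F y in nhds x. W y - \<phi> y \<le> W x - \<phi> x \<and> dist (\<phi>' y) (\<phi>' x) < d / 4 \<and> dist (\<phi> y) (\<phi> x) < d / 4"
      by eventually_elim simp
    then obtain r0 where r0: "r0 > 0" "\<And>y. dist y x < r0 \<Longrightarrow> W y - \<phi> y \<le> W x - \<phi> x \<and> dist (\<phi>' y) (\<phi>' x) < d / 4 \<and> dist (\<phi> y) (\<phi> x) < d / 4"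
      by (auto simp: eventually_nhds_metric)
    define r where "r = min r0 d / 2"
    have r: "r > 0" "r < r0" "r < d" using r0 d by (auto simp: r_def)
    \<comment> \<open>The second bound keeps the maximum of \<open>v - \<phi>'\<close> off the
      sphere of radius r; the first keeps \<open>v z\<close> within d of \<open>W x\<close>.\<close>
    define \<tau> where "\<tau> = min (d / 8) (\<kappa> * r\<^sup>2 / 4)"
    have \<tau>: "\<tau> > 0" "\<tau> \<le> d / 8" "\<tau> \<le> \<kappa> * r\<^sup>2 / 4" using d r \<kappa> by (auto simp: \<tau>_def)
    have "\<forall>\<^sub>F y in nhds x. dist (\<phi>' y) (\<phi>' x) < \<tau>"
      using \<open>isCont \<phi>' x\<close> \<tau>(1) by (rule isCont_dist_eventually)
    moreover have "\<forall>\<^sub>F y in nhds x. dist y x < r" using r(1) by (auto simp: eventually_nhds_metric)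
    ultimately have "\<forall>\<^sub>F y in nhds x. dist (\<phi>' y) (\<phi>' x) < \<tau> \<and> dist y x < r" by eventually_elim simp
    from usc_env_frequently[where f=W0, OF W0b \<tau>(1) this]
    obtain y1 where y1: "dist (\<phi>' y1) (\<phi>' x) < \<tau>" "dist y1 x < r" "W x - \<tau> < W0 y1" by (auto simp: W_def)
    then obtain v where v: "v \<in> V" "W x - \<tau> < v y1"
      using less_cSUP_iff[OF V(1) bda, of "W x - \<tau>" y1] by (auto simp: W0_def)
    have vW: "v y \<le> W y" for y using vW0[OF v(1), of y] WW[of y] by simp
    have "usc (\<lambda>y. v y + (- \<phi>' y))"
      by (intro usc_add V(2)[OF v(1)] usc_continuous continuous_intros c2_with_continuous(1)[OF c2'])
    then obtain z where z: "z \<in> cball x r" "\<And>y. y \<in> cball x r \<Longrightarrow> v y + (- \<phi>' y) \<le> v z + (- \<phi>' z)"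
      using usc_attains_max[of "\<lambda>y. v y + (- \<phi>' y)" "cball x r"] r by auto
    have zx: "dist z x \<le> r" using z(1) by (simp add: dist_commute)
    have low: "W x - \<phi>' x - 2 * \<tau> < v z - \<phi>' z"
      using z(2)[of y1] y1 v(2) by (simp add: dist_commute dist_real_def abs_less_iff)
    have up: "v z - \<phi>' z \<le> W x - \<phi> x - \<kappa> * (dist z x)\<^sup>2"
      using r0(2)[of z] zx r vW[of z] by (simp add: \<phi>'_def dist_norm)
    have \<phi>x: "\<phi>' x = \<phi> x" by (simp add: \<phi>'_def)
    have "\<kappa> * (dist z x)\<^sup>2 < 2 * \<tau>" using low up \<phi>x by simp
    have "\<kappa> * (dist z x)\<^sup>2 < \<kappa> * r\<^sup>2"
    proof -
      have "\<kappa> * r\<^sup>2 > 0" using \<kappa> r by simp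
      with \<tau>(3) \<open>\<kappa> * (dist z x)\<^sup>2 < 2 * \<tau>\<close> show ?thesis by linarith
    qed
    then have "(dist z x)\<^sup>2 < r\<^sup>2" using \<kappa> by simp
    then have zr: "dist z x < r" using r by (simp add: power_less_imp_less_base)
    have "\<forall>\<^sub>F y in nhds z. v y - \<phi>' y \<le> v z - \<phi>' z"
    proof (rule eventually_nhds_in_open[of "ball x r", THEN eventually_mono])
      fix y assume "y \<in> ball x r"
      then show "v y - \<phi>' y \<le> v z - \<phi>' z" using z(2)[of y] by simp
    qed (use zr in \<open>auto simp: dist_commute\<close>)
    then have s: "B z (v z) (g' z) \<le> trace (A z ** h' z)" using V(3)[OF v(1)] c2' unfolding subsol_def by blast
    have "\<bar>v z - W x\<bar> < d"
    proof -
      have "dist (\<phi>' z) (\<phi>' x) < d / 4" "dist (\<phi> z) (\<phi> x) < d / 4" "W z - \<phi> z \<le> W x - \<phi> x" using r0(2)[of z] zx r by auto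
      then show ?thesis using low vW[of z] \<tau>(2) d(1) \<phi>x unfolding dist_real_def abs_less_iff by linarith
    qed
    with d(2)[of z "v z"] zr r s show False by simp
  qed
  then show "B x (usc_env (\<lambda>x. SUP v\<in>V. v x) x) (g x) \<le> trace (A x ** h x)"
    by (simp add: W_def W0_def[abs_def])
qed

text \<open>On the annulus the bump is below W, so v coincides with W near the gluing sphere and
  both claims are local. Where v equals P, ellipticity transfers the strict inequality from P to the
  test function.\<close>

lemma subsol_bump:
  fixes A :: "real ^ 'n \<Rightarrow> real ^ 'n ^ 'n"
  assumes psd: "\<And>x. sym_psd (A x)" and W: "usc W" "subsol A B W" and c2: "c2_with P g h" and r: "r > 0"
    and strict: "\<And>y. dist y x < r \<Longrightarrow> B y (P y) (g y) \<le> trace (A y ** h y)"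
    and ann: "\<And>y. r / 2 < dist y x \<Longrightarrow> dist y x < r \<Longrightarrow> P y < W y"
  defines "v \<equiv> \<lambda>y. if dist y x < r then max (W y) (P y) else W y"
  shows "usc v" "subsol A B v"
proof -
  have near: "\<forall>\<^sub>F y in nhds z. dist y x < r" if "dist z x < r" for z
    by (rule eventually_nhds_in_open[of "{y. dist y x < r}", THEN eventually_mono])
       (use that in \<open>simp_all add: open_Collect_less continuous_intros\<close>)
  have far: "v z = W z" if "r / 2 < dist z x" for z using ann[of z] that by (auto simp: v_def)
  have farev: "\<forall>\<^sub>F y in nhds z. v y = W y" if "r / 2 < dist z x" for z
    by (rule eventually_nhds_in_open[of "{y. r / 2 < dist y x}", THEN eventually_mono])
       (use that far in \<open>simp_all add: open_Collect_less continuous_intros\<close>)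
  show "usc v"
  proof (rule uscI)
    fix z c assume vz: "v z < c"
    show "\<forall>\<^sub>F y in nhds z. v y < c"
    proof (cases "dist z x < r")
      case True
      then have "W z < c" "P z < c" using vz by (auto simp: v_def)
      then have "\<forall>\<^sub>F y in nhds z. W y < c" "\<forall>\<^sub>F y in nhds z. P y < c"
        using usc_eventually[OF W(1)] usc_eventually[OF usc_continuous[OF c2_with_continuous(1)[OF c2]]] by blast+
      then show ?thesis by eventually_elim (simp add: v_def)
    next
      case False
      then have "r / 2 < dist z x" using r by simp
      from farev[OF this] usc_eventually[OF W(1), of z c] far[OF this] vz show ?thesis
        by (auto elim: eventually_elim2)
    qed
  qed
  show "subsol A B v"
    unfolding subsol_def
  proof (intro allI impI)
    fix \<phi> G K z assume t: "c2_with \<phi> G K" and loc: "\<forall>\<^sub>F y in nhds z. v y - \<phi> y \<le> v z - \<phi> z"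
    have Wv: "W y \<le> v y" for y by (simp add: v_def)
    show "B z (v z) (G z) \<le> trace (A z ** K z)"
    proof (cases "v z = W z")
      case True
      have "\<forall>\<^sub>F y in nhds z. W y - \<phi> y \<le> W z - \<phi> z"
        using loc by eventually_elim (use Wv True in \<open>smt (verit)\<close>)
      then show ?thesis using W(2) t True unfolding subsol_def by fastforce
    next
      case False
      then have zr: "dist z x < r" and vP: "v z = P z" by (auto simp: v_def split: if_splits)
      have "\<forall>\<^sub>F y in nhds z. P y + (-1) * \<phi> y \<le> P z + (-1) * \<phi> z"
        using loc near[OF zr] by eventually_elim (use vP in \<open>auto simp: v_def\<close>)
      note mx = c2_local_max[OF c2_with_add[OF c2 c2_with_scale[OF t, of "-1"]] this]
      have g: "G z = g z" using mx(1) by simp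
      have "0 \<le> trace (A z ** (K z - h z))"
      proof (rule trace_psd_nonneg[OF psd])
        fix w show "0 \<le> w \<bullet> ((K z - h z) *v w)"
          using mx(2)[of w] by (simp add: matrix_vector_mult_diff_rdistrib inner_diff_right)
      qed
      then have "trace (A z ** h z) \<le> trace (A z ** K z)" by (simp add: trace_mult_diff_right)
      then show ?thesis using strict[OF zr] g vP by simp
    qed
  qed
qed


lemma subsol_shift:
  assumes "subsol A B v" "\<And>x. A (x + k) = A x" "\<And>x r p. B (x + k) r p = B x r p"
  shows "subsol A B (\<lambda>x. v (x + k))"
  unfolding subsol_def
proof (intro allI impI)
  fix \<phi> g h x assume c2: "c2_with \<phi> g h" and loc: "\<forall>\<^sub>F y in nhds x. v (y + k) - \<phi> y \<le> v (x + k) - \<phi> x"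
  have c: "c2_with (\<lambda>y. \<phi> (y - k)) (\<lambda>y. g (y - k)) (\<lambda>y. h (y - k))"
    using c2_with_affine[OF c2, of 1 "- k"] by simp
  have "((\<lambda>y. y - k) \<longlongrightarrow> x + k - k) (nhds (x + k))" by (intro tendsto_intros filterlim_ident)
  then have "filterlim (\<lambda>y. y - k) (nhds x) (nhds (x + k))" by simp
  from eventually_compose_filterlim[OF loc this]
  have "\<forall>\<^sub>F y in nhds (x + k). v y - \<phi> (y - k) \<le> v (x + k) - \<phi> (x + k - k)" by simp
  with assms(1) c have "B (x + k) (v (x + k)) (g (x + k - k)) \<le> trace (A (x + k) ** h (x + k - k))"
    unfolding subsol_def by blast
  then show "B x (v (x + k)) (g x) \<le> trace (A x ** h x)" using assms(2,3) by simp
qed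

text \<open>The supremum is taken over all subsolutions below \<open>hi\<close>, periodic or not. This class is invariant under
  integer shifts, so \<open>W\<close> is periodic.\<close>

lemma perron:
  fixes A :: "real ^ 'n \<Rightarrow> real ^ 'n ^ 'n"
  assumes A: "continuous_on UNIV A" and psd: "\<And>x. sym_psd (A x)" and Aper: "torus_fun A"
    and B: "continuous_on UNIV (\<lambda>(x, r, p). B x r p)" and Bper: "torus_fun B"
    and cont: "continuous_on UNIV lo" "continuous_on UNIV hi" and per: "torus_fun hi"
    and bd: "\<And>x. \<bar>lo x\<bar> \<le> M" "\<And>x. \<bar>hi x\<bar> \<le> M" and le: "\<And>x. lo x \<le> hi x"
    and sub: "subsol A B lo" and super: "subsol A (\<lambda>x r p. - B x (- r) (- p)) (\<lambda>x. - hi x)"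
  shows "\<exists>W Z. usc W \<and> usc (\<lambda>x. - Z x) \<and> torus_fun W \<and> torus_fun Z \<and>
    (\<forall>x. lo x \<le> Z x \<and> Z x \<le> W x \<and> W x \<le> hi x) \<and>
    subsol A B W \<and> subsol A (\<lambda>x r p. - B x (- r) (- p)) (\<lambda>x. - Z x)"
proof -
  define V where "V = {v. usc v \<and> subsol A B v \<and> (\<forall>x. \<bar>v x\<bar> \<le> M \<and> v x \<le> hi x)}"
  have loV: "lo \<in> V" using usc_continuous[OF cont(1)] sub bd(1) le by (simp add: V_def)
  then have ne: "V \<noteq> {}" by blast
  define W where "W x = (SUP v\<in>V. v x)" for x
  have bda: "bdd_above ((\<lambda>v. v x) ` V)" for x by (auto intro!: bdd_aboveI[of _ M] simp: V_def abs_le_iff)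
  have vW: "v x \<le> W x" if "v \<in> V" for v x unfolding W_def by (rule cSUP_upper[OF that bda])
  have Whi: "W x \<le> hi x" for x unfolding W_def using ne by (intro cSUP_least) (auto simp: V_def)
  have Wb: "\<bar>W x\<bar> \<le> M" for x
    using Whi[of x] bd(2)[of x] vW[OF loV, of x] bd(1)[of x] by (simp add: abs_le_iff)
  have envge: "W x \<le> usc_env W x" for x by (rule usc_env_ge[OF Wb])
  have envhi: "usc_env W x \<le> hi x" for x by (rule usc_env_le_usc[OF Wb usc_continuous[OF cont(2)] Whi])
  have "usc_env W \<in> V"
  proof -
    have "subsol A B (usc_env W)"
      unfolding W_def[abs_def] by (rule subsol_usc_env_Sup[OF A B ne]) (auto simp: V_def)
    moreover have "\<bar>usc_env W x\<bar> \<le> M" for x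
      using envge[of x] envhi[of x] Wb[of x] bd(2)[of x] by (simp add: abs_le_iff)
    ultimately show ?thesis using usc_usc_env[OF Wb] envhi by (simp add: V_def)
  qed
  then have "usc_env W x \<le> W x" for x by (rule vW)
  \<comment> \<open>The envelope of the supremum is itself admissible, hence not larger than the
    supremum.\<close>
  then have Weq: "usc_env W = W" using envge by (simp add: fun_eq_iff antisym)
  have WV: "W \<in> V" using \<open>usc_env W \<in> V\<close> by (simp add: Weq)
  have Wu: "usc W" and Ws: "subsol A B W" using WV by (auto simp: V_def)
  have Wper: "torus_fun W"
    unfolding torus_fun_def
  proof (intro allI impI)
    fix x k :: "real ^ 'n" assume "\<forall>i. k $ i \<in> \<int>"
    then have k: "int_vec k" "int_vec (- k)" by (simp_all add: int_vec_def)
    have "W (z + l) \<le> W z" if l: "int_vec l" for z l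
    proof -
      have "subsol A B (\<lambda>x. W (x + l))"
        by (rule subsol_shift[OF Ws]) (simp_all add: torus_fun_shift(1)[OF Aper l] torus_fun_shift(1)[OF Bper l])
      moreover have "usc (\<lambda>x. W (x + l))" by (rule usc_compose[OF Wu]) (intro continuous_intros)
      moreover have "W (x + l) \<le> hi x" for x using Whi[of "x + l"] torus_fun_shift(1)[OF per l, of x] by simp
      ultimately have "(\<lambda>x. W (x + l)) \<in> V" using Wb by (simp add: V_def)
      then show ?thesis by (rule vW)
    qed
    from this[OF k(1), of x] this[OF k(2), of "x + k"] show "W (x + k) = W x" by simp
  qed
  define nZ where "nZ = usc_env (\<lambda>x. - W x)"
  have nWb: "\<bar>- W x\<bar> \<le> M" for x using Wb by simp
  have nZge: "- W x \<le> nZ x" for x unfolding nZ_def by (rule usc_env_ge[where f="\<lambda>x. - W x", OF nWb])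
  have nZlo: "nZ x \<le> - lo x" for x
    unfolding nZ_def
    by (rule usc_env_le_usc[where f="\<lambda>x. - W x", OF nWb])
       (auto intro!: usc_continuous continuous_intros cont vW[OF loV])
  have nZu: "usc nZ" unfolding nZ_def by (rule usc_usc_env[where f="\<lambda>x. - W x", OF nWb])
  have nZper: "torus_fun nZ"
    unfolding nZ_def by (rule usc_env_torus) (use Wper in \<open>simp add: torus_fun_def\<close>)
  have nZs: "subsol A (\<lambda>x r p. - B x (- r) (- p)) nZ"
    unfolding subsol_def
  proof (intro allI impI)
    fix \<phi> g h x assume c2: "c2_with \<phi> g h" and loc: "\<forall>\<^sub>F y in nhds x. nZ y - \<phi> y \<le> nZ x - \<phi> x"
    show "- B x (- nZ x) (- g x) \<le> trace (A x ** h x)"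
    \<comment> \<open>If the lower envelope touches hi at x, the test function also touches hi and
      the supersolution property of hi applies. Otherwise there is room to lift W.\<close>
    proof (cases "nZ x = - hi x")
      case True
      have "\<forall>\<^sub>F y in nhds x. - hi y - \<phi> y \<le> - hi x - \<phi> x"
        using loc
      proof eventually_elim
        case (elim y)
        then show ?case using nZge[of y] Whi[of y] True by simp
      qed
      with super c2 have "- B x (- (- hi x)) (- g x) \<le> trace (A x ** h x)" unfolding subsol_def by blast
      then show ?thesis using True by simp
    next
      case False
      then have gap: "hi x + nZ x > 0" using nZge[of x] Whi[of x] by simp
      show ?thesis
      proof (rule ccontr)
        assume "\<not> - B x (- nZ x) (- g x) \<le> trace (A x ** h x)"
        then have lt: "trace (A x ** h x) < - B x (- nZ x) (- g x)" by simp
        define D where "D = 2 * \<bar>trace (A x)\<bar> + 2"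
        have D: "D > 0" by (simp add: D_def add_nonneg_pos)
        define \<kappa> where "\<kappa> = (- B x (- nZ x) (- g x) - trace (A x ** h x)) / D / 2"
        have \<kappa>: "\<kappa> > 0" using lt D by (simp add: \<kappa>_def)
        define \<phi>' where "\<phi>' y = \<phi> y + \<kappa> * (norm (y - x))\<^sup>2" for y
        define g' where "g' y = g y + \<kappa> *\<^sub>R (2 *\<^sub>R (y - x))" for y
        define h' where "h' y = h y + \<kappa> *\<^sub>R (2 *\<^sub>R mat 1)" for y
        have c2': "c2_with \<phi>' g' h'" unfolding \<phi>'_def[abs_def] g'_def[abs_def] h'_def[abs_def] by (rule c2_perturb[OF c2])
        have lt': "trace (A x ** h' x) < - B x (- nZ x) (- g' x)"
        proof -
          have "2 * \<kappa> * trace (A x) \<le> \<kappa> * D" using \<kappa> mult_left_mono[of "2 * trace (A x)" D \<kappa>] by (simp add: D_def)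
          also have "\<dots> = (- B x (- nZ x) (- g x) - trace (A x ** h x)) / 2" using D by (simp add: \<kappa>_def)
          also have "\<dots> < - B x (- nZ x) (- g x) - trace (A x ** h x)" using lt by simp
          finally show ?thesis unfolding h'_def g'_def trace_perturb by simp
        qed
        have B': "continuous_on UNIV (\<lambda>(x, r, p). - B x (- r) (- p))"
        proof -
          have "continuous_on UNIV (\<lambda>z :: (real ^ 'n) \<times> real \<times> (real ^ 'n). (fst z, - fst (snd z), - snd (snd z)))"
            by (intro continuous_intros)
          from continuous_on_minus[OF continuous_on_compose2[OF B this]] show ?thesis by (simp add: split_beta)
        qed
        from strict_nbhd[OF A B' c2' lt'] obtain d where d: "d > 0"
          "\<And>y r. dist y x < d \<Longrightarrow> \<bar>r - nZ x\<bar> < d \<Longrightarrow> trace (A y ** h' y) < - B y (- r) (- g' y)" by blast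
        \<comment> \<open>The second entry is the distance of the lower envelope to hi at x; staying
          within it keeps the lifted function below hi.\<close>
        define \<delta> where "\<delta> = min d (hi x + nZ x)"
        have \<delta>: "\<delta> > 0" "\<delta> \<le> d" "\<delta> \<le> hi x + nZ x" using d gap by (auto simp: \<delta>_def)
        have c\<phi>: "isCont \<phi>' x" using c2_with_continuous(1)[OF c2', of UNIV] by (simp add: continuous_on_eq_continuous_at)
        have chi: "isCont hi x" using cont(2) by (simp add: continuous_on_eq_continuous_at)
        have "\<delta> / 4 > 0" using \<delta> by simp
        from isCont_dist_eventually[OF c\<phi> this] isCont_dist_eventually[OF chi this] loc
        have "\<forall>\<^sub>F y in nhds x. dist (\<phi>' y) (\<phi>' x) < \<delta> / 4 \<and> dist (hi y) (hi x) < \<delta> / 4 \<and> nZ y - \<phi> y \<le> nZ x - \<phi> x"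
          by eventually_elim simp
        then obtain r0 where r0: "r0 > 0" "\<And>y. dist y x < r0 \<Longrightarrow>
            dist (\<phi>' y) (\<phi>' x) < \<delta> / 4 \<and> dist (hi y) (hi x) < \<delta> / 4 \<and> nZ y - \<phi> y \<le> nZ x - \<phi> x"
          by (auto simp: eventually_nhds_metric)
        define r where "r = min r0 d"
        have r: "r > 0" "r \<le> r0" "r \<le> d" using r0 d by (auto simp: r_def)
        \<comment> \<open>The lift is at most the value of the quadratic perturbation at distance
          \<open>r / 2\<close>, so the bump is below W on the outer annulus.\<close>
        define \<tau> where "\<tau> = min (\<delta> / 4) (\<kappa> * (r / 2)\<^sup>2)"
        have \<tau>: "\<tau> > 0" "\<tau> \<le> \<delta> / 4" "\<tau> \<le> \<kappa> * (r / 2)\<^sup>2" using \<delta> r \<kappa> by (auto simp: \<tau>_def)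
        have \<phi>x: "\<phi>' x = \<phi> x" by (simp add: \<phi>'_def)
        define P where "P y = (-1) * \<phi>' y + ((\<phi> x - nZ x + \<tau>) + 0 \<bullet> (y - 0))" for y
        have cP: "c2_with P (\<lambda>y. (-1) *\<^sub>R g' y + 0) (\<lambda>y. (-1) *\<^sub>R h' y + 0)"
          unfolding P_def[abs_def] by (intro c2_with_add c2_with_scale c2_with_linear c2')
        have Pabs: "\<bar>- P y - nZ x\<bar> < \<delta>" "P y \<le> - nZ x + \<delta> / 2" if "dist y x < r" for y
        proof -
          have "P y = - \<phi>' y + \<phi> x - nZ x + \<tau>" by (simp add: P_def)
          moreover have "\<bar>\<phi>' y - \<phi> x\<bar> < \<delta> / 4" using r0(2)[of y] that r \<phi>x by (simp add: dist_real_def)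
          ultimately show "\<bar>- P y - nZ x\<bar> < \<delta>" "P y \<le> - nZ x + \<delta> / 2" using \<tau> \<delta>(1) by linarith+
        qed
        define v where "v y = (if dist y x < r then max (W y) (P y) else W y)" for y
        have strict: "B y (P y) ((-1) *\<^sub>R g' y + 0) \<le> trace (A y ** ((-1) *\<^sub>R h' y + 0))" if "dist y x < r" for y
        proof -
          have "trace (A y ** h' y) < - B y (- (- P y)) (- g' y)"
            by (rule d(2)) (use that r Pabs(1)[OF that] \<delta> in auto)
          moreover have "trace (A y ** ((-1) *\<^sub>R h' y + 0)) = - trace (A y ** h' y)"
            using trace_mult_scaleR[of "A y" "-1" "h' y"] by simp
          ultimately show ?thesis by simp
        qed
        have ann: "P y < W y" if y: "r / 2 < dist y x" "dist y x < r" for y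
        proof -
          have "(r / 2)\<^sup>2 < (dist y x)\<^sup>2" using y r by (intro power_strict_mono) auto
          then have "\<kappa> * (r / 2)\<^sup>2 < \<kappa> * (dist y x)\<^sup>2" using \<kappa> by simp
          then have "\<tau> < \<kappa> * (dist y x)\<^sup>2" using \<tau>(3) by simp
          moreover have "- W y \<le> \<phi> y - \<phi> x + nZ x" using r0(2)[of y] y r nZge[of y] by simp
          ultimately show ?thesis by (simp add: P_def \<phi>'_def dist_norm)
        qed
        have "usc v" "subsol A B v"
          unfolding v_def[abs_def] by (rule subsol_bump[OF psd Wu Ws cP r(1) strict ann]; assumption)+
        moreover have "W y \<le> v y" for y by (simp add: v_def)
        moreover have "v y \<le> hi y" for y
        proof (cases "dist y x < r")
          case True
          have "P y \<le> hi y"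
            using r0(2)[of y] True r Pabs(2)[OF True] \<delta> unfolding dist_real_def by linarith
          then show ?thesis using Whi[of y] by (simp add: v_def)
        qed (use Whi in \<open>simp add: v_def\<close>)
        ultimately have "v \<in> V"
          using Wb bd(2) by (simp add: V_def abs_le_iff) (meson order_trans neg_le_iff_le)
        then have vlW: "v y \<le> W y" for y by (rule vW)
        have "\<tau> / 2 > 0" using \<tau> by simp
        from isCont_dist_eventually[OF c\<phi> this]
        have ev: "\<forall>\<^sub>F y in nhds x. dist (\<phi>' y) (\<phi>' x) < \<tau> / 2" .
        have "\<forall>\<^sub>F y in nhds x. dist y x < r" using r(1) by (auto simp: eventually_nhds_metric)
        with ev have "\<forall>\<^sub>F y in nhds x. dist (\<phi>' y) (\<phi>' x) < \<tau> / 2 \<and> dist y x < r" by eventually_elim simp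
        \<comment> \<open>Near x there are points where W is almost as low as its lower envelope. At
          such a point the bump exceeds W, against maximality.\<close>
        from usc_env_frequently[where f="\<lambda>x. - W x", OF nWb \<open>\<tau> / 2 > 0\<close> this]
        obtain y where y: "dist (\<phi>' y) (\<phi>' x) < \<tau> / 2" "dist y x < r" "nZ x - \<tau> / 2 < - W y"
          by (auto simp: nZ_def)
        have "P y > - nZ x + \<tau> / 2" 
        proof -
          have "P y = - \<phi>' y + \<phi> x - nZ x + \<tau>" by (simp add: P_def)
          moreover have "\<bar>\<phi>' y - \<phi> x\<bar> < \<tau> / 2" using y(1) \<phi>x by (simp add: dist_real_def)
          ultimately show ?thesis by linarith
        qed
        moreover have "P y \<le> v y" using y(2) by (simp add: v_def)
        ultimately show False using vlW[of y] y(3) by linarith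
      qed
    qed
  qed
  show ?thesis
  proof (rule exI[of _ W], rule exI[of _ "\<lambda>x. - nZ x"], intro conjI allI)
    show "torus_fun (\<lambda>x. - nZ x)" using nZper by (simp add: torus_fun_def)
    fix x show "lo x \<le> - nZ x" "- nZ x \<le> W x" "W x \<le> hi x" using nZlo[of x] nZge[of x] Whi[of x] by simp_all
  qed (use Wu nZu Wper Ws nZs in auto)
qed


section \<open>Estimates for the data\<close>

lemma viscosity_sub_iff:
  "viscosity_sub (\<lambda>x r p X. B x r p - trace (A x ** X)) u \<longleftrightarrow> subsol A B u"
proof
  assume v: "viscosity_sub (\<lambda>x r p X. B x r p - trace (A x ** X)) u"
  show "subsol A B u"
    unfolding subsol_def
  proof (intro allI impI)
    fix \<phi> g h x assume "c2_with \<phi> g h" "\<forall>\<^sub>F y in nhds x. u y - \<phi> y \<le> u x - \<phi> x"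
    then show "B x (u x) (g x) \<le> trace (A x ** h x)"
      using v c2_with_imp_C2[of \<phi> g h] c2_with_grad[of \<phi> g h] c2_with_hess[of \<phi> g h]
      unfolding viscosity_sub_def by fastforce
  qed
next
  assume s: "subsol A B u"
  show "viscosity_sub (\<lambda>x r p X. B x r p - trace (A x ** X)) u"
    unfolding viscosity_sub_def
  proof (intro allI impI)
    fix \<phi> x assume "C2 \<phi>" and loc: "\<forall>\<^sub>F y in nhds x. u y - \<phi> y \<le> u x - \<phi> x"
    then obtain g h where c2: "c2_with \<phi> g h" by (auto simp: C2_iff_c2_with)
    with s loc have "B x (u x) (g x) \<le> trace (A x ** h x)" unfolding subsol_def by blast
    then show "B x (u x) (grad \<phi> x) - trace (A x ** hess \<phi> x) \<le> 0"
      by (simp add: c2_with_grad[OF c2] c2_with_hess[OF c2])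
  qed
qed

lemma viscosity_super_iff:
  "viscosity_super (\<lambda>x r p X. B x r p - trace (A x ** X)) u \<longleftrightarrow>
    subsol A (\<lambda>x r p. - B x (- r) (- p)) (\<lambda>x. - u x)"
proof
  have tm: "trace (A x ** ((-1) *\<^sub>R h)) = - trace (A x ** h)" for x h
    using trace_mult_scaleR[of "A x" "-1" h] by simp
  {
    assume v: "viscosity_super (\<lambda>x r p X. B x r p - trace (A x ** X)) u"
    show "subsol A (\<lambda>x r p. - B x (- r) (- p)) (\<lambda>x. - u x)"
      unfolding subsol_def
    proof (intro allI impI)
      fix \<phi> g h x assume c2: "c2_with \<phi> g h" and loc0: "\<forall>\<^sub>F y in nhds x. - u y - \<phi> y \<le> - u x - \<phi> x"
      from loc0 have loc: "\<forall>\<^sub>F y in nhds x. u x - (-1) * \<phi> x \<le> u y - (-1) * \<phi> y" by (rule eventually_mono) simp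
      note c = c2_with_scale[OF c2, of "-1"]
      have "B x (u x) (grad (\<lambda>x. (-1) * \<phi> x) x) - trace (A x ** hess (\<lambda>x. (-1) * \<phi> x) x) \<ge> 0"
        using v c2_with_imp_C2[OF c] loc unfolding viscosity_super_def by blast
      then show "- B x (- (- u x)) (- g x) \<le> trace (A x ** h x)"
        unfolding c2_with_grad[OF c] c2_with_hess[OF c] tm by simp
    qed
  }
  {
    assume s: "subsol A (\<lambda>x r p. - B x (- r) (- p)) (\<lambda>x. - u x)"
    show "viscosity_super (\<lambda>x r p X. B x r p - trace (A x ** X)) u"
      unfolding viscosity_super_def
    proof (intro allI impI)
      fix \<phi> x assume "C2 \<phi>" and loc0: "\<forall>\<^sub>F y in nhds x. u x - \<phi> x \<le> u y - \<phi> y"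
      from loc0 have loc: "\<forall>\<^sub>F y in nhds x. - u y - (-1) * \<phi> y \<le> - u x - (-1) * \<phi> x" by (rule eventually_mono) simp
      obtain g h where c2: "c2_with \<phi> g h" using \<open>C2 \<phi>\<close> by (auto simp: C2_iff_c2_with)
      have "- B x (- (- u x)) (- ((-1) *\<^sub>R g x)) \<le> trace (A x ** ((-1) *\<^sub>R h x))"
        using s c2_with_scale[OF c2, of "-1"] loc unfolding subsol_def by blast
      then show "B x (u x) (grad \<phi> x) - trace (A x ** hess \<phi> x) \<ge> 0"
        unfolding tm by (simp add: c2_with_grad[OF c2] c2_with_hess[OF c2])
    qed
  }
qed

text \<open>Two nearby points need a common integer shift. Their fractional parts may lie on
  different sides of a face of the unit cube, so the box is enlarged by 1 in all directions.\<close>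

lemma torus_reduce:
  fixes x y :: "real ^ 'n"
  assumes "norm (x - y) \<le> 1"
  shows "\<exists>k. int_vec k \<and> x - k \<in> cbox (-1) 2 \<and> y - k \<in> cbox (-1) 2"
proof -
  obtain k where k: "int_vec k" "x - k \<in> cbox 0 1" using ex_int_shift by blast
  have c: "- 1 \<le> (x - k) $ i \<and> (x - k) $ i \<le> 2" "- 1 \<le> (y - k) $ i \<and> (y - k) $ i \<le> 2" for i
  proof -
    have "\<bar>(x - y) $ i\<bar> \<le> 1" using component_le_norm_cart[of "x - y" i] assms by simp
    moreover have "0 \<le> (x - k) $ i" "(x - k) $ i \<le> 1" using k(2) by (simp_all add: mem_box_cart)
    ultimately show "- 1 \<le> (x - k) $ i \<and> (x - k) $ i \<le> 2" "- 1 \<le> (y - k) $ i \<and> (y - k) $ i \<le> 2"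
      by (auto simp: abs_le_iff)
  qed
  have "x - k \<in> cbox (-1) 2 \<and> y - k \<in> cbox (-1) 2" using c by (simp add: mem_box_cart)
  then show ?thesis using k(1) by blast
qed

lemma torus_lipschitz_bound:
  fixes g :: "real ^ 'n \<Rightarrow> real"
  assumes "torus_fun g" "\<And>x. \<bar>g x\<bar> \<le> B"
    and "\<And>x y. x \<in> cbox (-1) 2 \<Longrightarrow> y \<in> cbox (-1) 2 \<Longrightarrow> \<bar>g x - g y\<bar> \<le> L * norm (x - y)"
  shows "\<bar>g x - g y\<bar> \<le> (\<bar>L\<bar> + 2 * B) * norm (x - y)"
proof (cases "norm (x - y) \<le> 1")
  case True
  obtain k where k: "int_vec k" "x - k \<in> cbox (-1) 2" "y - k \<in> cbox (-1) 2" using torus_reduce[OF True] by blast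
  have "B \<ge> 0" using assms(2)[of 0] by linarith
  have "\<bar>g x - g y\<bar> \<le> L * norm (x - y)"
    using assms(3)[OF k(2,3)] torus_fun_shift(2)[OF assms(1) k(1)] by simp
  also have "\<dots> \<le> (\<bar>L\<bar> + 2 * B) * norm (x - y)" using \<open>B \<ge> 0\<close> by (intro mult_right_mono) auto
  finally show ?thesis .
next
  case False
  have "B \<ge> 0" using assms(2)[of 0] by linarith
  have "\<bar>g x - g y\<bar> \<le> 2 * B" using assms(2)[of x] assms(2)[of y] by linarith
  also have "\<dots> \<le> (\<bar>L\<bar> + 2 * B) * 1" by simp
  also have "\<dots> \<le> (\<bar>L\<bar> + 2 * B) * norm (x - y)" using False \<open>B \<ge> 0\<close> by (intro mult_left_mono) auto
  finally show ?thesis .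
qed

lemma torus_uniformly_continuous:
  fixes g :: "real ^ 'n \<Rightarrow> real"
  assumes "torus_fun g" "continuous_on UNIV g" "m > 0"
  shows "\<exists>\<delta>>0. \<forall>x y. norm (x - y) < \<delta> \<longrightarrow> \<bar>g x - g y\<bar> < m"
proof -
  have "uniformly_continuous_on (cbox (-1) 2) g"
    by (rule compact_uniformly_continuous[OF continuous_on_subset[OF assms(2)] compact_cbox]) auto
  then obtain \<delta> where \<delta>: "\<delta> > 0" "\<And>x y. x \<in> cbox (-1) 2 \<Longrightarrow> y \<in> cbox (-1) 2 \<Longrightarrow> dist y x < \<delta> \<Longrightarrow> dist (g y) (g x) < m"
    using assms(3) unfolding uniformly_continuous_on_def by blast
  have "\<bar>g x - g y\<bar> < m" if "norm (x - y) < min \<delta> 1" for x y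
  proof -
    have "norm (x - y) \<le> 1" using that by simp
    from torus_reduce[OF this] obtain k where k: "int_vec k" "x - k \<in> cbox (-1) 2" "y - k \<in> cbox (-1) 2" by blast
    then show ?thesis using \<delta>(2)[OF k(3,2)] that torus_fun_shift(2)[OF assms(1) k(1)]
      by (simp add: dist_norm)
  qed
  then show ?thesis using \<delta>(1) by (intro exI[of _ "min \<delta> 1"]) auto
qed

lemma torus_fun_derivative:
  fixes g :: "real ^ 'n \<Rightarrow> 'b::real_normed_vector"
  assumes "torus_fun g" "\<And>z. (g has_derivative blinfun_apply (g' z)) (at z)"
  shows "torus_fun g'"
  unfolding torus_fun_def
proof (intro allI impI)
  fix x k :: "real ^ 'n" assume "\<forall>i. k $ i \<in> \<int>"
  then have k: "int_vec k" by (simp add: int_vec_def)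
  have "((\<lambda>z. z + k) has_derivative (\<lambda>v. v)) (at x)" by (auto intro!: derivative_eq_intros)
  from has_derivative_compose[OF this assms(2)[of "x + k"]]
  have "(g has_derivative blinfun_apply (g' (x + k))) (at x)" by (simp add: torus_fun_shift(1)[OF assms(1) k])
  then have "blinfun_apply (g' (x + k)) = blinfun_apply (g' x)" using has_derivative_unique assms(2) by blast
  then show "g' (x + k) = g' x" by (simp add: blinfun_apply_inject)
qed

text \<open>Nonnegativity at the minimum of the Taylor majorant gives
  \<open>(f' 0)\<^sup>2 \<le> 2 * K * f 0\<close>. This is the scalar reason why roots of
  nonnegative C^2 functions are Lipschitz.\<close>

lemma nonneg_c2_increment:
  fixes f :: "real \<Rightarrow> real"
  assumes "\<And>t. f t \<ge> 0" "\<And>t. (f has_real_derivative f' t) (at t)" "\<And>t. (f' has_real_derivative f'' t) (at t)"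
    and "\<And>t. \<bar>f'' t\<bar> \<le> K" "K > 0"
  shows "\<bar>f 1 - f 0\<bar> \<le> sqrt (2 * K * f 0) + K / 2"
proof -
  have tay: "\<exists>s. f t = f 0 + f' 0 * t + f'' s / 2 * t\<^sup>2" for t
  proof -
    define D where "D m = (if m = 0 then f else if m = 1 then f' else f'')" for m :: nat
    have "\<exists>s. \<bar>s\<bar> \<le> \<bar>t\<bar> \<and> f t = (\<Sum>m<2. D m 0 / fact m * t ^ m) + D 2 s / fact 2 * t ^ 2"
      by (rule Maclaurin_bi_le) (use assms(2,3) in \<open>auto simp: D_def less_2_cases_iff\<close>)
    then show ?thesis by (auto simp: D_def eval_nat_numeral)
  qed
  have "(f' 0)\<^sup>2 \<le> 2 * K * f 0"
  proof -
    \<comment> \<open>The minimiser of \<open>f 0 + f' 0 * t + K / 2 * t\<^sup>2\<close>.\<close>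
    define t where "t = - f' 0 / K"
    obtain s where s: "f t = f 0 + f' 0 * t + f'' s / 2 * t\<^sup>2" using tay by blast
    have "f'' s / 2 * t\<^sup>2 \<le> K / 2 * t\<^sup>2" using assms(4)[of s] by (intro mult_right_mono) auto
    then have "0 \<le> f 0 + f' 0 * t + K / 2 * t\<^sup>2" using assms(1)[of t] s by linarith
    also have "\<dots> = f 0 - (f' 0)\<^sup>2 / (2 * K)" using assms(5) by (simp add: t_def power2_eq_square field_simps)
    finally show ?thesis using assms(5) by (simp add: field_simps)
  qed
  then have "\<bar>f' 0\<bar> \<le> sqrt (2 * K * f 0)" by (metis real_sqrt_abs real_sqrt_le_iff)
  moreover obtain s where "f 1 = f 0 + f' 0 * 1 + f'' s / 2 * 1\<^sup>2" using tay by blast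
  ultimately show ?thesis using assms(4)[of s] by (simp add: abs_le_iff)
qed

text \<open>The scalar estimate along the segment from a to b, for each quadratic form of A, is
  exactly the closeness hypothesis of \<open>psd_coupling\<close>, with \<open>\<kappa>\<close>
  proportional to the distance. The second derivative of A is bounded by periodicity.\<close>

lemma C2_psd_coupling:
  fixes A :: "real ^ 'n \<Rightarrow> real ^ 'n ^ 'n"
  assumes per: "torus_fun A" and "C2 A" and psd: "\<And>x. sym_psd (A x)"
  shows "\<exists>KA\<ge>0. \<forall>a b. \<exists>\<xi> \<eta>. factors (A a) \<xi> \<and> factors (A b) \<eta> \<and>
    (\<Sum>i\<in>UNIV. (norm (\<xi> i - \<eta> i))\<^sup>2) \<le> KA * (norm (a - b))\<^sup>2"
proof -
  obtain A' A'' where d1: "\<And>z. (A has_derivative blinfun_apply (A' z)) (at z)"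
    and d2: "\<And>z. (A' has_derivative blinfun_apply (A'' z)) (at z)" and c: "continuous_on UNIV A''"
    using assms(2) unfolding C2_def by blast
  have "torus_fun A''" by (rule torus_fun_derivative[OF torus_fun_derivative[OF per d1] d2])
  then obtain K0 where K0: "K0 \<ge> 0" "\<And>x. norm (A'' x) \<le> K0" using torus_fun_bounded[OF _ c] by blast
  define K where "K = K0 + 1"
  have K: "K > 0" "\<And>x. norm (A'' x) \<le> K"
    using K0 by (simp_all add: K_def add_increasing2)
  define N where "N = (real CARD('n) * (real CARD('n) + 3))\<^sup>2"
  show ?thesis
  proof (intro exI[of _ "N * (2 * K)"] conjI allI)
    show "0 \<le> N * (2 * K)" using K by (simp add: N_def)
    fix a b :: "real ^ 'n"
    define w where "w = b - a"
    define \<kappa> where "\<kappa> = sqrt (2 * K) * norm w"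
    have \<kappa>: "\<kappa> \<ge> 0" "\<kappa>\<^sup>2 = 2 * K * (norm w)\<^sup>2" using K by (auto simp: \<kappa>_def power_mult_distrib)
    have "\<bar>e \<bullet> (A a *v e) - e \<bullet> (A b *v e)\<bar> \<le> \<kappa> * norm e * sqrt (e \<bullet> (A a *v e)) + \<kappa>\<^sup>2 * (norm e)\<^sup>2" for e
    proof (cases "w = 0 \<or> e = 0")
      case True then show ?thesis using \<kappa> psd[of a] by (auto simp: w_def sym_psd_def)
    next
      case False
      have bl: "bounded_linear (\<lambda>M::real^'n^'n. e \<bullet> (M *v e))"
        by (rule linear_conv_bounded_linear[THEN iffD1], rule linearI)
           (auto simp: matrix_vector_mult_add_rdistrib inner_add_right scaleR_matrix_vector_assoc[symmetric])
      define f where "f t = e \<bullet> (A (a + t *\<^sub>R w) *v e)" for t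
      define f' where "f' t = e \<bullet> (A' (a + t *\<^sub>R w) w *v e)" for t
      define f'' where "f'' t = e \<bullet> (A'' (a + t *\<^sub>R w) w w *v e)" for t
      have aff: "((\<lambda>t. a + t *\<^sub>R w) has_derivative (\<lambda>s. s *\<^sub>R w)) (at t)" for t
        by (auto intro!: derivative_eq_intros)
      have "(f has_real_derivative f' t) (at t)" for t
        using bounded_linear.has_derivative[OF bl has_derivative_compose[OF aff d1]]
        unfolding f_def f'_def has_field_derivative_def
        by (rule has_derivative_eq_rhs) (simp add: fun_eq_iff blinfun.scaleR_right scaleR_matrix_vector_assoc[symmetric])
      moreover have "(f' has_real_derivative f'' t) (at t)" for t
      proof -
        have "((\<lambda>t. A' (a + t *\<^sub>R w) w) has_derivative (\<lambda>s. A'' (a + t *\<^sub>R w) (s *\<^sub>R w) w)) (at t)"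
          by (rule bounded_linear.has_derivative[OF blinfun.bounded_linear_left has_derivative_compose[OF aff d2]])
        from bounded_linear.has_derivative[OF bl this] show ?thesis
          unfolding f'_def f''_def has_field_derivative_def
          by (rule has_derivative_eq_rhs)
             (simp add: fun_eq_iff blinfun.scaleR_right blinfun.scaleR_left scaleR_matrix_vector_assoc[symmetric])
      qed
      moreover have "\<bar>f'' t\<bar> \<le> K * (norm w)\<^sup>2 * (norm e)\<^sup>2" for t
      proof -
        have "\<bar>f'' t\<bar> \<le> norm (A'' (a + t *\<^sub>R w) w w) * (norm e)\<^sup>2" unfolding f''_def by (rule abs_quadratic_form_le)
        also have "norm (A'' (a + t *\<^sub>R w) w w) \<le> norm (A'' (a + t *\<^sub>R w) w) * norm w" by (rule norm_blinfun)
        also have "\<dots> \<le> norm (A'' (a + t *\<^sub>R w)) * norm w * norm w" by (intro mult_right_mono norm_blinfun) auto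
        also have "\<dots> \<le> K * norm w * norm w" by (intro mult_right_mono K) auto
        finally show ?thesis by (simp add: power2_eq_square mult_right_mono)
      qed
      moreover have "f t \<ge> 0" for t using psd by (simp add: f_def sym_psd_def)
      moreover have "K * (norm w)\<^sup>2 * (norm e)\<^sup>2 > 0" using K False by simp
      ultimately have "\<bar>f 1 - f 0\<bar> \<le> sqrt (2 * (K * (norm w)\<^sup>2 * (norm e)\<^sup>2) * f 0) + K * (norm w)\<^sup>2 * (norm e)\<^sup>2 / 2"
        by (intro nonneg_c2_increment) auto
      also have "sqrt (2 * (K * (norm w)\<^sup>2 * (norm e)\<^sup>2) * f 0) = \<kappa> * norm e * sqrt (f 0)"
        by (simp add: \<kappa>_def real_sqrt_mult mult_ac)
      also have "K * (norm w)\<^sup>2 * (norm e)\<^sup>2 / 2 \<le> \<kappa>\<^sup>2 * (norm e)\<^sup>2" using K by (simp add: \<kappa>)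
      finally show ?thesis by (simp add: f_def w_def abs_minus_commute)
    qed
    from psd_coupling[OF psd psd \<kappa>(1) this]
    show "\<exists>\<xi> \<eta>. factors (A a) \<xi> \<and> factors (A b) \<eta> \<and>
      (\<Sum>i\<in>UNIV. (norm (\<xi> i - \<eta> i))\<^sup>2) \<le> N * (2 * K) * (norm (a - b))\<^sup>2"
      by (simp add: \<kappa>(2) N_def w_def norm_minus_commute mult.assoc)
  qed
qed


lemma grad_inner:
  fixes u :: "real ^ 'n \<Rightarrow> real"
  assumes "(u has_derivative D) (at x)"
  shows "D v = grad u x \<bullet> v"
proof -
  have fd: "frechet_derivative u (at x) = D" using frechet_derivative_at[OF assms] by simp
  have lin: "linear D" using has_derivative_bounded_linear[OF assms] bounded_linear.linear by blast
  have "v = (\<Sum>i\<in>UNIV. v $ i *\<^sub>R axis i 1)" by (metis basis_expansion scalar_mult_eq_scaleR)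
  then have "D v = D (\<Sum>i\<in>UNIV. v $ i *\<^sub>R axis i 1)" by (rule arg_cong)
  also have "\<dots> = (\<Sum>i\<in>UNIV. v $ i * D (axis i 1))" by (simp add: linear_sum[OF lin] linear_cmul[OF lin])
  also have "\<dots> = grad u x \<bullet> v" unfolding grad_def fd inner_vec_def by (simp add: mult.commute)
  finally show ?thesis .
qed

lemma C2_continuous:
  assumes "C2 g" shows "continuous_on UNIV g"
proof -
  obtain g' where "\<And>z. (g has_derivative blinfun_apply (g' z)) (at z)" using assms unfolding C2_def by blast
  then have "isCont g z" for z by (rule has_derivative_continuous)
  then show ?thesis by (simp add: continuous_at_imp_continuous_on)
qed

text \<open>The normalisation to 1 makes the logarithm of \<open>H x p + C0\<close> available and
  lets this quantity absorb constants.\<close>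

lemma hamiltonian_lower_bound:
  fixes H :: "real ^ 'n \<Rightarrow> real ^ 'n \<Rightarrow> real"
  assumes per: "torus_fun H" and cont: "continuous_on UNIV (\<lambda>(x, p). H x p)" and sl: "superlinear_in_p H"
  shows "\<exists>C0\<ge>0. \<forall>x p. 1 \<le> H x p + C0"
proof -
  have "\<forall>\<^sub>F p in at_infinity. \<forall>x. H x p / norm p \<ge> 0" using sl by (simp add: superlinear_in_p_def)
  then obtain R where R: "\<And>p x. norm p \<ge> R \<Longrightarrow> H x p / norm p \<ge> 0" unfolding eventually_at_infinity by blast
  define R' where "R' = \<bar>R\<bar> + 1"
  have "compact ((\<lambda>(x, p). H x p) ` (cbox 0 (1::real^'n) \<times> cball (0::real^'n) R'))"
    by (intro compact_continuous_image continuous_on_subset[OF cont] compact_Times compact_cbox compact_cball) auto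
  then have "bounded ((\<lambda>(x, p). H x p) ` (cbox 0 (1::real^'n) \<times> cball (0::real^'n) R'))" by (rule compact_imp_bounded)
  then obtain M where M: "\<forall>z\<in>(\<lambda>(x, p). H x p) ` (cbox 0 (1::real^'n) \<times> cball (0::real^'n) R'). norm z \<le> M"
    unfolding bounded_iff by blast
  have "H x p \<ge> - \<bar>M\<bar>" for x p
  proof (cases "norm p \<le> R'")
    case True
    obtain k where k: "int_vec k" "x - k \<in> cbox 0 1" using ex_int_shift by blast
    have "norm (H (x - k) p) \<le> M" using M k(2) True by auto
    then show ?thesis using torus_fun_shift(2)[OF per k(1), of x] by simp
  next
    case False
    then have "norm p \<ge> R" "norm p > 0" by (auto simp: R'_def)
    then have "H x p \<ge> 0" using R[of p x] by (simp add: zero_le_divide_iff)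
    then show ?thesis by simp
  qed
  then have "1 \<le> H x p + (\<bar>M\<bar> + 1)" for x p proof -
    have "- \<bar>M\<bar> \<le> H x p" by fact
    then show ?thesis by linarith
  qed
  then show ?thesis by (intro exI[of _ "\<bar>M\<bar> + 1"]) simp
qed

text \<open>A Gronwall argument: by the gradient condition the logarithm of \<open>H + C0\<close> is
  Lipschitz in x, uniformly in p. So the change of H is relative to its size, whatever the size of
  p.\<close>

lemma hamiltonian_growth:
  fixes H :: "real ^ 'n \<Rightarrow> real ^ 'n \<Rightarrow> real"
  assumes C2: "C2 (\<lambda>(x, p). H x p)" and C0: "C0 \<ge> 0" "\<And>x p. 1 \<le> H x p + C0"
    and g: "\<gamma>1 > 0" "\<And>x p. norm (grad (\<lambda>y. H y p) x) \<le> \<gamma>1 * (1 + \<bar>H x p\<bar>)"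
  shows "\<exists>\<gamma>\<ge>0. \<forall>a b p. norm (a - b) \<le> 2 \<longrightarrow> H b p + C0 \<le> (1 + \<gamma> * norm (a - b)) * (H a p + C0)"
proof -
  obtain H' where H': "\<And>z. ((\<lambda>(x, p). H x p) has_derivative blinfun_apply (H' z)) (at z)"
    using C2 unfolding C2_def by blast
  define \<gamma> where "\<gamma> = \<gamma>1 * (2 + 2 * C0)"
  have \<gamma>: "\<gamma> > 0" using g C0 by (simp add: \<gamma>_def add_pos_nonneg)
  define \<Gamma> where "\<Gamma> = \<gamma> * exp (2 * \<gamma>)"
  have "H b p + C0 \<le> (1 + \<Gamma> * norm (a - b)) * (H a p + C0)" if ab: "norm (a - b) \<le> 2" for a b p
  proof -
    define w where "w = b - a"
    define d where "d = norm w"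
    have d: "0 \<le> d" "d \<le> 2" using ab by (simp_all add: d_def w_def norm_minus_commute)
    define F where "F t = H (a + t *\<^sub>R w) p + C0" for t
    define F' where "F' t = grad (\<lambda>y. H y p) (a + t *\<^sub>R w) \<bullet> w" for t
    have F1: "F t \<ge> 1" for t using C0(2) by (simp add: F_def)
    have DF: "(F has_real_derivative F' t) (at t)" for t
    proof -
      have dH: "((\<lambda>y. H y p) has_derivative (\<lambda>v. H' (y, p) (v, 0))) (at y)" for y
      proof -
        have "((\<lambda>y. (y, p)) has_derivative (\<lambda>v. (v, 0))) (at y)" by (auto intro!: derivative_eq_intros)
        from has_derivative_compose[OF this H'] show ?thesis by simp
      qed
      have "((\<lambda>t. a + t *\<^sub>R w) has_derivative (\<lambda>s. s *\<^sub>R w)) (at t)" by (auto intro!: derivative_eq_intros)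
      from has_derivative_compose[OF this dH]
      have "((\<lambda>t. H (a + t *\<^sub>R w) p) has_derivative (\<lambda>s. H' (a + t *\<^sub>R w, p) (s *\<^sub>R w, 0))) (at t)" .
      then have "((\<lambda>t. H (a + t *\<^sub>R w) p) has_derivative (\<lambda>s. grad (\<lambda>y. H y p) (a + t *\<^sub>R w) \<bullet> (s *\<^sub>R w))) (at t)"
        unfolding grad_inner[OF dH] .
      then have "((\<lambda>t. H (a + t *\<^sub>R w) p) has_real_derivative F' t) (at t)"
        unfolding has_field_derivative_def by (rule has_derivative_eq_rhs) (simp add: fun_eq_iff F'_def)
      then show ?thesis unfolding F_def[abs_def] by (auto intro!: derivative_eq_intros)
    qed
    have F'b: "F' t \<le> \<gamma> * d * F t" for t
    proof -
      let ?x = "a + t *\<^sub>R w"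
      have "1 + \<bar>H ?x p\<bar> \<le> (2 + 2 * C0) * F t"
      proof -
        have "1 + \<bar>H ?x p\<bar> \<le> 1 + F t + C0" using C0(2)[of ?x p] C0(1) unfolding F_def by linarith
        also have "\<dots> \<le> F t + F t + C0 * F t" using F1[of t] C0(1) mult_left_mono[OF F1[of t] C0(1)] by simp
        also have "\<dots> \<le> (2 + 2 * C0) * F t" using F1[of t] C0(1) by (simp add: algebra_simps)
        finally show ?thesis .
      qed
      then have "norm (grad (\<lambda>y. H y p) ?x) \<le> \<gamma>1 * ((2 + 2 * C0) * F t)"
        using g(2)[of p ?x] g(1) by (meson order_trans mult_left_mono less_imp_le)
      then have "norm (grad (\<lambda>y. H y p) ?x) * d \<le> \<gamma>1 * ((2 + 2 * C0) * F t) * d" using d by (intro mult_right_mono) auto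
      moreover have "F' t \<le> norm (grad (\<lambda>y. H y p) ?x) * d" unfolding F'_def d_def by (rule norm_cauchy_schwarz)
      ultimately show ?thesis by (simp add: \<gamma>_def mult_ac)
    qed
    have "ln (F 1) - \<gamma> * d * 1 \<le> ln (F 0) - \<gamma> * d * 0"
    proof (rule DERIV_nonpos_imp_nonincreasing[where f="\<lambda>t. ln (F t) - \<gamma> * d * t"])
      fix t :: real
      have "((\<lambda>t. ln (F t) - \<gamma> * d * t) has_real_derivative F' t / F t - \<gamma> * d) (at t)"
        using F1[of t] by (auto intro!: derivative_eq_intros DF)
      moreover have "F' t / F t - \<gamma> * d \<le> 0" using F'b[of t] F1[of t] by (simp add: pos_divide_le_eq)
      ultimately show "\<exists>y. ((\<lambda>t. ln (F t) - \<gamma> * d * t) has_real_derivative y) (at t) \<and> y \<le> 0" by blast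
    qed simp
    then have "exp (ln (F 1)) \<le> exp (ln (F 0) + \<gamma> * d)" by simp
    then have "F 1 \<le> exp (ln (F 0) + \<gamma> * d)" using F1[of 1] by simp
    also have "\<dots> = F 0 * exp (\<gamma> * d)" using F1[of 0] by (simp add: exp_add)
    \<comment> \<open>The exponential is linearised on \<open>d \<le> 2\<close>, which is where
      \<open>exp (2 * \<gamma>)\<close> comes from.\<close>
    also have "exp (\<gamma> * d) \<le> 1 + \<Gamma> * d"
    proof -
      have y: "0 \<le> \<gamma> * d" using \<gamma> d by simp
      have "1 + - (\<gamma> * d) \<le> exp (- (\<gamma> * d))" by (rule exp_ge_add_one_self)
      then have "(1 + - (\<gamma> * d)) * exp (\<gamma> * d) \<le> exp (- (\<gamma> * d)) * exp (\<gamma> * d)" by (rule mult_right_mono) simp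
      then have "exp (\<gamma> * d) \<le> 1 + \<gamma> * d * exp (\<gamma> * d)" by (simp add: exp_minus algebra_simps)
      also have "\<gamma> * d * exp (\<gamma> * d) \<le> \<gamma> * d * exp (2 * \<gamma>)"
        using y \<gamma> d by (intro mult_left_mono) (auto simp: mult.commute)
      finally show ?thesis by (simp add: \<Gamma>_def mult_ac)
    qed
    then have "F 0 * exp (\<gamma> * d) \<le> F 0 * (1 + \<Gamma> * d)" using F1[of 0] by (intro mult_left_mono) auto
    finally show ?thesis by (simp add: F_def w_def d_def norm_minus_commute mult.commute)
  qed
  moreover have "\<Gamma> \<ge> 0" using \<gamma> by (simp add: \<Gamma>_def)
  ultimately show ?thesis by blast
qed

lemma locally_lipschitz_on_compact:
  fixes g :: "'a::real_normed_vector \<Rightarrow> 'b::real_normed_vector"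
  assumes "\<And>z. \<exists>e>0. \<exists>L. L-lipschitz_on (ball z e) g" "compact K"
  shows "\<exists>L. L-lipschitz_on K g"
proof -
  have cont: "continuous_on UNIV g"
  proof (rule continuous_at_imp_continuous_on, rule ballI)
    fix z :: 'a assume "z \<in> UNIV"
    obtain e L where "e > 0" "L-lipschitz_on (ball z e) g" using assms(1) by blast
    then have "continuous_on (ball z e) g" "z \<in> ball z e" using lipschitz_on_continuous_on by auto
    then show "isCont g z" using continuous_on_eq_continuous_at[OF open_ball] by blast
  qed
  \<comment> \<open>The library notion has a time parameter; a single dummy time is used.\<close>
  have "local_lipschitz {0::real} K (\<lambda>_. g)"
    unfolding local_lipschitz_def
  proof (intro ballI)
    fix z and t :: real assume "z \<in> K"
    obtain e L where e: "e > 0" "L-lipschitz_on (ball z e) g" using assms(1) by blast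
    have "L-lipschitz_on (cball z (e / 2) \<inter> K) g" by (rule lipschitz_on_subset[OF e(2)]) (use e(1) in auto)
    then show "\<exists>u>0. \<exists>L. \<forall>t\<in>cball t u \<inter> {0::real}. L-lipschitz_on (cball z u \<inter> K) g"
      using e(1) by (intro exI[of _ "e / 2"]) auto
  qed
  from local_lipschitz_compact_implies_lipschitz[OF this assms(2)]
  show ?thesis using continuous_on_subset[OF cont] by fastforce
qed

text \<open>Everything is compactness on an enlarged period cell times the interval of radius
  \<open>\<rho>\<close>, with \<open>\<kappa>\<close> the minimum of the derivative in r. The radius
  is a parameter because f is controlled only locally in r.\<close>

lemma discount_bounds:
  fixes f :: "real ^ 'n \<Rightarrow> real \<Rightarrow> real"
  assumes per: "torus_fun f" and C11: "C11_loc (\<lambda>(x, r). f x r)"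
    and pos: "\<And>x r. deriv (f x) r > 0" and f0: "\<And>x. f x 0 = 0" and \<rho>: "\<rho> \<ge> 0"
  shows "\<exists>\<kappa>>0. \<exists>K\<ge>0.
    (\<forall>x r s. \<bar>r\<bar> \<le> \<rho> \<longrightarrow> \<bar>s\<bar> \<le> \<rho> \<longrightarrow> s \<le> r \<longrightarrow> f x r - f x s \<ge> \<kappa> * (r - s)) \<and>
    (\<forall>x r. \<bar>r\<bar> \<le> \<rho> \<longrightarrow> \<bar>f x r\<bar> \<le> K) \<and>
    (\<forall>x y r. \<bar>r\<bar> \<le> \<rho> \<longrightarrow> \<bar>f x r - f y r\<bar> \<le> K * norm (x - y)) \<and>
    (\<forall>x r. \<bar>r\<bar> \<le> \<rho> \<longrightarrow> \<bar>f x r - deriv (f x) 0 * r\<bar> \<le> K * r\<^sup>2) \<and>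
    (\<forall>x. \<kappa> \<le> deriv (f x) 0) \<and> (\<forall>x. \<bar>deriv (f x) 0\<bar> \<le> K) \<and>
    (\<forall>x y. \<bar>deriv (f x) 0 - deriv (f y) 0\<bar> \<le> K * norm (x - y))"
proof -
  obtain f' where f': "\<And>z. ((\<lambda>(x, r). f x r) has_derivative blinfun_apply (f' z)) (at z)"
    and ll: "\<And>z. \<exists>e>0. \<exists>L. L-lipschitz_on (ball z e) f'"
    using C11 unfolding C11_loc_def by blast
  define Q where "Q = cbox (-1) (2::real^'n) \<times> cbox (-\<rho>) \<rho>"
  have Q: "compact Q" "convex Q" unfolding Q_def by (intro compact_Times convex_Times compact_cbox convex_box)+
  have inQ: "(x, r) \<in> Q \<longleftrightarrow> x \<in> cbox (-1) 2 \<and> \<bar>r\<bar> \<le> \<rho>" for x r by (auto simp: Q_def)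
  have Q0: "(0, 0) \<in> Q" using \<rho> by (simp add: inQ mem_box_cart)
  obtain L where L: "L-lipschitz_on Q f'" using locally_lipschitz_on_compact[OF ll Q(1)] by blast
  have L0: "L \<ge> 0" using L lipschitz_on_nonneg by blast
  have cf': "continuous_on Q f'" using L lipschitz_on_continuous_on by blast
  have cf: "continuous_on Q (\<lambda>(x, r). f x r)"
    by (rule continuous_at_imp_continuous_on) (use f' has_derivative_continuous in blast)
  have bdQ: "\<exists>B. \<forall>z\<in>Q. norm (h z) \<le> B" if "continuous_on Q h" for h :: "(real ^ 'n) \<times> real \<Rightarrow> 'c::real_normed_vector"
    using compact_imp_bounded[OF compact_continuous_image[OF that Q(1)]] unfolding bounded_iff by fast
  obtain B1 where B1: "\<And>z. z \<in> Q \<Longrightarrow> norm (f' z) \<le> B1" using bdQ[OF cf'] by blast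
  obtain B2 where B2: "\<And>z. z \<in> Q \<Longrightarrow> norm (case z of (x, r) \<Rightarrow> f x r) \<le> B2" using bdQ[OF cf] by blast
  define fr where "fr x r = f' (x, r) (0, 1)" for x r
  have Dr: "(f x has_real_derivative fr x r) (at r)" for x r
  proof -
    have "((\<lambda>r. (x, r)) has_derivative (\<lambda>v. (0, v))) (at r)" by (auto intro!: derivative_eq_intros)
    from has_derivative_compose[OF this f'] have "(f x has_derivative (\<lambda>v. f' (x, r) (0, v))) (at r)" by simp
    moreover have "(\<lambda>v. f' (x, r) (0, v)) = (\<lambda>v. fr x r * v)"
    proof
      fix v :: real
      have "(0 :: real ^ 'n, v) = v *\<^sub>R (0, 1)" by simp
      then show "f' (x, r) (0, v) = fr x r * v" unfolding fr_def by (metis blinfun.scaleR_right mult.commute real_scaleR_def)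
    qed
    ultimately show ?thesis by (simp add: has_field_derivative_def)
  qed
  have dfr: "deriv (f x) r = fr x r" for x r by (rule DERIV_imp_deriv[OF Dr])
  have n01: "norm (0 :: real ^ 'n, 1 :: real) = 1" by (simp add: norm_Pair)
  have frL: "\<bar>fr x r - fr y s\<bar> \<le> L * dist (x, r) (y, s)" if "(x, r) \<in> Q" "(y, s) \<in> Q" for x y r s
  proof -
    have "fr x r - fr y s = (f' (x, r) - f' (y, s)) (0, 1)" by (simp add: fr_def blinfun.diff_left)
    then have "\<bar>fr x r - fr y s\<bar> \<le> norm (f' (x, r) - f' (y, s))"
      using norm_blinfun[of "f' (x, r) - f' (y, s)" "(0, 1)"] n01 by simp
    also have "\<dots> \<le> L * dist (x, r) (y, s)" using lipschitz_onD[OF L that] by (simp add: dist_norm)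
    finally show ?thesis .
  qed
  have frB: "\<bar>fr x r\<bar> \<le> B1" if "(x, r) \<in> Q" for x r
    using norm_blinfun[of "f' (x, r)" "(0, 1)"] n01 B1[OF that] by (simp add: fr_def)
  have cfr: "continuous_on Q (\<lambda>z. f' z (0, 1))" by (intro continuous_intros cf')
  obtain z0 where z0: "z0 \<in> Q" "\<And>z. z \<in> Q \<Longrightarrow> f' z0 (0, 1) \<le> f' z (0, 1)"
    using continuous_attains_inf[OF Q(1) _ cfr] Q0 by blast
  define \<kappa> where "\<kappa> = f' z0 (0, 1)"
  have \<kappa>: "\<kappa> > 0" using pos[of "fst z0" "snd z0"] by (simp add: \<kappa>_def dfr fr_def)
  have fr\<kappa>: "\<kappa> \<le> fr x r" if "(x, r) \<in> Q" for x r using z0(2)[OF that] by (simp add: \<kappa>_def fr_def)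
  have fper: "f (x - k) = f x" if "int_vec k" for x k by (rule torus_fun_shift(2)[OF per that])
  have red: "\<exists>y\<in>cbox (-1) 2. f y = f x" for x
  proof -
    obtain k where k: "int_vec k" "x - k \<in> cbox (-1) 2" using torus_reduce[of x x] by auto
    then show ?thesis using fper by blast
  qed
  define K where "K = \<bar>B1\<bar> + \<bar>B2\<bar> + L + (\<bar>B1\<bar> + 2 * \<bar>B2\<bar>) + (L + 2 * \<bar>B1\<bar>)"
  have K: "K \<ge> 0" using L0 by (simp add: K_def)
  have 1: "f x r - f x s \<ge> \<kappa> * (r - s)" if r: "\<bar>r\<bar> \<le> \<rho>" "\<bar>s\<bar> \<le> \<rho>" "s \<le> r" for x r s
  proof (cases "s = r")
    case False
    obtain y where y: "y \<in> cbox (-1) 2" "f y = f x" using red by blast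
    obtain z where z: "s < z" "z < r" "f y r - f y s = (r - s) * fr y z"
      using MVT2[of s r "f y" "fr y"] Dr r False by auto
    have "\<kappa> \<le> fr y z" by (rule fr\<kappa>) (use y z r in \<open>auto simp: inQ\<close>)
    then have "(r - s) * \<kappa> \<le> (r - s) * fr y z" using r by (intro mult_left_mono) auto
    then show ?thesis using z(3) y(2) by (simp add: mult.commute)
  qed simp
  have 2: "\<bar>f x r\<bar> \<le> \<bar>B2\<bar>" if r: "\<bar>r\<bar> \<le> \<rho>" for x r
  proof -
    obtain y where y: "y \<in> cbox (-1) 2" "f y = f x" using red by blast
    then show ?thesis using B2[of "(y, r)"] r by (simp add: inQ)
  qed
  have 3: "\<bar>f x r - f y r\<bar> \<le> (\<bar>B1\<bar> + 2 * \<bar>B2\<bar>) * norm (x - y)" if r: "\<bar>r\<bar> \<le> \<rho>" for x y r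
  proof -
    have "\<bar>f x r - f y r\<bar> \<le> (\<bar>\<bar>B1\<bar>\<bar> + 2 * \<bar>B2\<bar>) * norm (x - y)"
    proof (rule torus_lipschitz_bound)
      show "torus_fun (\<lambda>x. f x r)" using per by (simp add: torus_fun_def)
      show "\<bar>f x r\<bar> \<le> \<bar>B2\<bar>" for x by (rule 2[OF r])
      fix x y :: "real ^ 'n" assume xy: "x \<in> cbox (-1) 2" "y \<in> cbox (-1) 2"
      have "norm (f x r - f y r) \<le> \<bar>B1\<bar> * norm (x - y)"
      proof (rule differentiable_bound[OF convex_box(1)[of "-1" 2], where f'="\<lambda>x v. f' (x, r) (v, 0)"])
        fix z :: "real ^ 'n" assume z: "z \<in> cbox (-1) 2"
        have "((\<lambda>x. (x, r)) has_derivative (\<lambda>v. (v, 0))) (at z)" by (auto intro!: derivative_eq_intros)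
        from has_derivative_compose[OF this f']
        show "((\<lambda>x. f x r) has_derivative (\<lambda>v. f' (z, r) (v, 0))) (at z within cbox (-1) 2)"
          by (simp add: has_derivative_at_withinI)
        have "norm (f' (z, r) (v, 0)) \<le> \<bar>B1\<bar> * norm v" for v
        proof -
          have "norm (f' (z, r) (v, 0)) \<le> norm (f' (z, r)) * norm (v, 0::real)" by (rule norm_blinfun)
          also have "\<dots> \<le> \<bar>B1\<bar> * norm v" using B1[of "(z, r)"] z r by (intro mult_mono) (auto simp: inQ norm_Pair)
          finally show ?thesis .
        qed
        then show "onorm (\<lambda>v. f' (z, r) (v, 0)) \<le> \<bar>B1\<bar>" by (intro onorm_bound) auto
      qed (use xy in auto)
      then show "\<bar>f x r - f y r\<bar> \<le> \<bar>B1\<bar> * norm (x - y)" by simp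
    qed
    then show ?thesis by simp
  qed
  have 4: "\<bar>f x r - deriv (f x) 0 * r\<bar> \<le> L * r\<^sup>2" if r: "\<bar>r\<bar> \<le> \<rho>" for x r
  proof (cases "r = 0")
    case False
    obtain y where y: "y \<in> cbox (-1) 2" "f y = f x" using red by blast
    have "\<exists>z. \<bar>z\<bar> \<le> \<bar>r\<bar> \<and> f y r - f y 0 = r * fr y z"
    proof (cases "r > 0")
      case True
      then obtain z where "0 < z" "z < r" "f y r - f y 0 = (r - 0) * fr y z" using MVT2[of 0 r "f y" "fr y"] Dr by auto
      then show ?thesis by (intro exI[of _ z]) auto
    next
      case f: False
      then have "r < 0" using False by simp
      then obtain z where "r < z" "z < 0" "f y 0 - f y r = (0 - r) * fr y z" using MVT2[of r 0 "f y" "fr y"] Dr by auto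
      then show ?thesis by (intro exI[of _ z]) auto
    qed
    then obtain z where z: "\<bar>z\<bar> \<le> \<bar>r\<bar>" "f y r - f y 0 = r * fr y z" by blast
    have "\<bar>fr y z - fr y 0\<bar> \<le> L * dist (y, z) (y, 0)" by (rule frL) (use y z r \<rho> in \<open>auto simp: inQ\<close>)
    also have "dist (y, z) (y, 0) = \<bar>z\<bar>" by (simp add: dist_Pair_Pair)
    also have "L * \<bar>z\<bar> \<le> L * \<bar>r\<bar>" using z L0 by (intro mult_left_mono) auto
    finally have "\<bar>r\<bar> * \<bar>fr y z - fr y 0\<bar> \<le> \<bar>r\<bar> * (L * \<bar>r\<bar>)" by (intro mult_left_mono) auto
    moreover have "f x r - deriv (f x) 0 * r = r * (fr y z - fr y 0)"
      using z(2) f0[of y] dfr[of y 0] y(2) by (simp add: algebra_simps)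
    ultimately show ?thesis by (simp add: abs_mult power2_eq_square mult_ac)
  qed (simp add: f0)
  have dB: "\<kappa> \<le> deriv (f x) 0" "\<bar>deriv (f x) 0\<bar> \<le> \<bar>B1\<bar>" for x
  proof -
    obtain y where y: "y \<in> cbox (-1) 2" "f y = f x" using red by blast
    have "deriv (f x) 0 = fr y 0" using dfr[of y 0] y(2) by simp
    moreover have "(y, 0) \<in> Q" using y \<rho> by (simp add: inQ)
    ultimately show "\<kappa> \<le> deriv (f x) 0" "\<bar>deriv (f x) 0\<bar> \<le> \<bar>B1\<bar>" using fr\<kappa> frB[of y 0] by auto
  qed
  have 5: "\<bar>deriv (f x) 0 - deriv (f y) 0\<bar> \<le> (L + 2 * \<bar>B1\<bar>) * norm (x - y)" for x y
  proof -
    have "\<bar>deriv (f x) 0 - deriv (f y) 0\<bar> \<le> (\<bar>L\<bar> + 2 * \<bar>B1\<bar>) * norm (x - y)"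
    proof (rule torus_lipschitz_bound)
      show "torus_fun (\<lambda>x. deriv (f x) 0)" using per by (simp add: torus_fun_def)
      show "\<bar>deriv (f x) 0\<bar> \<le> \<bar>B1\<bar>" for x by (rule dB)
      fix x y :: "real ^ 'n" assume "x \<in> cbox (-1) 2" "y \<in> cbox (-1) 2"
      then show "\<bar>deriv (f x) 0 - deriv (f y) 0\<bar> \<le> L * norm (x - y)"
        using frL[of x 0 y 0] \<rho> by (simp add: inQ dfr dist_Pair_Pair dist_norm)
    qed
    then show ?thesis using L0 by simp
  qed
  have KK: "\<bar>B2\<bar> \<le> K" "\<bar>B1\<bar> + 2 * \<bar>B2\<bar> \<le> K" "L \<le> K" "\<bar>B1\<bar> \<le> K" "L + 2 * \<bar>B1\<bar> \<le> K" using L0 by (auto simp: K_def)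
  show ?thesis
  proof (rule exI[of _ \<kappa>], rule conjI[OF \<kappa>], rule exI[of _ K], rule conjI[OF K], intro conjI allI impI)
    fix x y :: "real ^ 'n" and r s :: real
    show "\<kappa> \<le> deriv (f x) 0" by (rule dB)
    show "\<bar>deriv (f x) 0\<bar> \<le> K" using dB(2)[of x] KK by linarith
    show "\<bar>deriv (f x) 0 - deriv (f y) 0\<bar> \<le> K * norm (x - y)"
      using 5[of x y] mult_right_mono[OF KK(5), of "norm (x - y)"] by simp
    show "\<bar>r\<bar> \<le> \<rho> \<Longrightarrow> \<bar>s\<bar> \<le> \<rho> \<Longrightarrow> s \<le> r \<Longrightarrow> \<kappa> * (r - s) \<le> f x r - f x s" by (rule 1)
    show "\<bar>r\<bar> \<le> \<rho> \<Longrightarrow> \<bar>f x r\<bar> \<le> K" using 2[of r x] KK by linarith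
    show "\<bar>r\<bar> \<le> \<rho> \<Longrightarrow> \<bar>f x r - f y r\<bar> \<le> K * norm (x - y)"
      using 3[of r x y] mult_right_mono[OF KK(2), of "norm (x - y)"] by simp
    show "\<bar>r\<bar> \<le> \<rho> \<Longrightarrow> \<bar>f x r - deriv (f x) 0 * r\<bar> \<le> K * r\<^sup>2"
      using 4[of r x] mult_right_mono[OF KK(3), of "r\<^sup>2"] by simp
  qed
qed


section \<open>The discounted problem\<close>

text \<open>Supplies all constants that depend on the data, leaving only the separation property
  \<open>sep\<close> to be checked for each equation.\<close>

lemma doubling_discount:
  fixes H :: "real ^ 'n \<Rightarrow> real ^ 'n \<Rightarrow> real"
  assumes H: "torus_fun H" "C2 (\<lambda>(x, p). H x p)" "superlinear_in_p H"
    and g: "\<gamma>1 > 0" "\<And>x p. norm (grad (\<lambda>y. H y p) x) \<le> \<gamma>1 * (1 + \<bar>H x p\<bar>)"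
    and A: "torus_fun A" "C2 A" "\<And>x. sym_psd (A x)"
    and G: "torus_fun G" "continuous_on UNIV (\<lambda>(x, r). G x r)"
    and usc: "usc u" "usc (\<lambda>x. - v x)" and per: "torus_fun u" "torus_fun v"
    and bdd: "\<And>x. \<bar>u x\<bar> \<le> S" "\<And>x. \<bar>v x\<bar> \<le> S"
    and sub: "subsol A (\<lambda>x r p. H x p + G x r - c) u"
    and super: "subsol A (\<lambda>x r p. - (H x (- p) + G x (- r) - c)) (\<lambda>x. - v x)"
    and sep: "\<And>m. m > 0 \<Longrightarrow> \<exists>\<theta>>0. \<forall>a b. u a - v b \<ge> m \<longrightarrow> G a (u a) - G b (v b) \<ge> \<theta> - KG * norm (a - b)"
    and KG: "KG \<ge> 0"
  shows "\<exists>L\<ge>0. \<forall>x y. u x - v y \<le> L * norm (x - y)"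
proof -
  obtain C0 where C0: "C0 \<ge> 0" "\<And>x p. 1 \<le> H x p + C0"
    using hamiltonian_lower_bound[OF H(1) C2_continuous[OF H(2)] H(3)] by blast
  obtain \<gamma> where \<gamma>: "\<gamma> \<ge> 0" "\<And>a b p. norm (a - b) \<le> 2 \<Longrightarrow> H b p + C0 \<le> (1 + \<gamma> * norm (a - b)) * (H a p + C0)"
    using hamiltonian_growth[OF H(2) C0 g] by blast
  obtain KA where KA: "KA \<ge> 0" "\<And>a b. \<exists>\<xi> \<eta>. factors (A a) \<xi> \<and> factors (A b) \<eta> \<and>
      (\<Sum>i\<in>UNIV. (norm (\<xi> i - \<eta> i))\<^sup>2) \<le> KA * (norm (a - b))\<^sup>2"
    using C2_psd_coupling[OF A] by blast
  obtain TA where TA: "\<And>x. norm (trace (A x)) \<le> TA"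
  proof -
    have "continuous_on UNIV (\<lambda>x. trace (A x))"
      unfolding trace_def by (intro continuous_intros C2_continuous[OF A(2)])
    moreover have "torus_fun (\<lambda>x. trace (A x))" using A(1) by (simp add: torus_fun_def)
    ultimately show ?thesis using torus_fun_bounded that by blast
  qed
  have "\<exists>B. \<forall>x r. \<bar>r\<bar> \<le> S \<longrightarrow> \<bar>G x r\<bar> \<le> B"
  proof -
    have "compact ((\<lambda>(x, r). G x r) ` (cbox 0 (1::real^'n) \<times> cball 0 S))"
      by (intro compact_continuous_image continuous_on_subset[OF G(2)] compact_Times compact_cbox compact_cball) auto
    then have "bounded ((\<lambda>(x, r). G x r) ` (cbox 0 (1::real^'n) \<times> cball 0 S))" by (rule compact_imp_bounded)
    then obtain B where B: "\<forall>z\<in>(\<lambda>(x, r). G x r) ` (cbox 0 (1::real^'n) \<times> cball 0 S). norm z \<le> B"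
      unfolding bounded_iff by blast
    have "\<bar>G x r\<bar> \<le> B" if "\<bar>r\<bar> \<le> S" for x r
    proof -
      obtain k where k: "int_vec k" "x - k \<in> cbox 0 1" using ex_int_shift by blast
      have "norm (G (x - k) r) \<le> B" using B k(2) that by auto
      then show ?thesis using torus_fun_shift(2)[OF G(1) k(1), of x] by simp
    qed
    then show ?thesis by blast
  qed
  then obtain CG where CG: "\<And>x r. \<bar>r\<bar> \<le> S \<Longrightarrow> \<bar>G x r\<bar> \<le> CG" by blast
  show ?thesis
  proof (rule doubling_estimate[where H=H and G=G and A=A and S=S and c=c and KA=KA and TA=TA and ?C0.0=C0
        and \<gamma>=\<gamma> and CG=CG and KG=KG, OF usc per bdd sub super C2_continuous[OF A(2)] C2_continuous[OF H(2)] G(2)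
        KA(2) KA(1) _ C0(2) C0(1) \<gamma>(2) \<gamma>(1) H(3) CG sep KG])
    show "trace (A a) \<le> TA" for a using TA[of a] by simp
  qed
qed

text \<open>The summand 0 stands for the zero-order term, so that \<open>doubling_discount\<close>
  applies with G = 0.\<close>

lemma ergodic_solution_iff:
  "ergodic_solution H A c u \<longleftrightarrow> torus_fun u \<and> continuous_on UNIV u \<and>
    subsol A (\<lambda>x r p. H x p + 0 - c) u \<and> subsol A (\<lambda>x r p. - (H x (- p) + 0 - c)) (\<lambda>x. - u x)"
proof -
  have eq: "(\<lambda>x r p X. H x p - (trace (A x ** X) + c)) = (\<lambda>x r p X. (H x p + 0 - c) - trace (A x ** X))"
    by (simp add: fun_eq_iff)
  show ?thesis
    unfolding ergodic_solution_def viscosity_solution_def eq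
      viscosity_sub_iff[of "\<lambda>x r p. H x p + 0 - c" A] viscosity_super_iff[of "\<lambda>x r p. H x p + 0 - c" A] ..
qed

lemma discounted_solution_iff:
  "discounted_solution f H A c V lam u \<longleftrightarrow> torus_fun u \<and> continuous_on UNIV u \<and>
    subsol A (\<lambda>x r p. H x p + (f x (lam * r) + lam * V x) - c) u \<and>
    subsol A (\<lambda>x r p. - (H x (- p) + (f x (lam * (- r)) + lam * V x) - c)) (\<lambda>x. - u x)"
proof -
  have eq: "(\<lambda>x r p X. f x (lam * r) + H x p + lam * V x - (trace (A x ** X) + c)) =
      (\<lambda>x r p X. (H x p + (f x (lam * r) + lam * V x) - c) - trace (A x ** X))"
    by (simp add: fun_eq_iff)
  show ?thesis
    unfolding discounted_solution_def viscosity_solution_def eq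
      viscosity_sub_iff[of "\<lambda>x r p. H x p + (f x (lam * r) + lam * V x) - c" A]
      viscosity_super_iff[of "\<lambda>x r p. H x p + (f x (lam * r) + lam * V x) - c" A] ..
qed

lemma subsol_add_const:
  assumes "subsol A B u" "\<And>x g t. B x (u x) g \<le> t \<Longrightarrow> B' x (u x + c) g \<le> t"
  shows "subsol A B' (\<lambda>x. u x + c)"
  unfolding subsol_def
proof (intro allI impI)
  fix \<phi> g h x assume "c2_with \<phi> g h" and loc: "\<forall>\<^sub>F y in nhds x. u y + c - \<phi> y \<le> u x + c - \<phi> x"
  moreover have "\<forall>\<^sub>F y in nhds x. u y - \<phi> y \<le> u x - \<phi> x" using loc by (rule eventually_mono) simp
  ultimately have "B x (u x) (g x) \<le> trace (A x ** h x)" using assms(1) unfolding subsol_def by blast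
  then show "B' x (u x + c) (g x) \<le> trace (A x ** h x)" by (rule assms(2))
qed

lemma torus_LipI:
  assumes "torus_fun u" "L \<ge> 0" "\<And>x y. u x - u y \<le> L * norm (x - y)"
  shows "torus_Lip u"
proof -
  have "L-lipschitz_on UNIV u"
  proof (rule lipschitz_onI[OF _ assms(2)])
    fix x y
    show "dist (u x) (u y) \<le> L * dist x y"
      using assms(3)[of x y] assms(3)[of y x] by (simp add: dist_norm norm_minus_commute abs_le_iff)
  qed
  then show ?thesis using assms(1) unfolding torus_Lip_def by blast
qed

theorem theorem3:
  fixes H :: "real ^ 'n \<Rightarrow> real ^ 'n \<Rightarrow> real"
    and A :: "real ^ 'n \<Rightarrow> real ^ 'n ^ 'n"
    and f :: "real ^ 'n \<Rightarrow> real \<Rightarrow> real"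
    and u0 :: "real ^ 'n \<Rightarrow> real"
    and \<gamma>1 :: real
  assumes "torus_fun H" and "C2 (\<lambda>(x, p). H x p)"
    and "\<And>x. strictly_convex (H x)" and "superlinear_in_p H"
    and "\<gamma>1 > 0" and "\<And>x p. norm (grad (\<lambda>y. H y p) x) \<le> \<gamma>1 * (1 + \<bar>H x p\<bar>)"
    and "torus_fun A" and "C2 A" and "\<And>x. sym_psd (A x)"
    and "torus_fun f" and "C11_loc (\<lambda>(x, r). f x r)"
    and "\<And>x r. deriv (f x) r > 0" and "\<And>x. f x 0 = 0"
    and "ergodic_solution H A (ergodic_constant H A) u0"
  shows "\<exists>V0. torus_Lip V0 \<and>
    (\<exists>lam0>0. \<exists>C. \<exists>u :: real \<Rightarrow> real ^ 'n \<Rightarrow> real.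
      (\<forall>lam. 0 < lam \<and> lam < lam0 \<longrightarrow>
        torus_Lip (u lam) \<and>
        discounted_solution f H A (ergodic_constant H A) V0 lam (u lam) \<and>
        (\<forall>v. discounted_solution f H A (ergodic_constant H A) V0 lam v \<longrightarrow> v = u lam) \<and>
        (\<forall>x. \<bar>u lam x - u0 x\<bar> \<le> C * lam)) \<and>
      uniform_limit UNIV u u0 (at_right 0))"
proof -
  define c where "c = ergodic_constant H A"
  have u0: "torus_fun u0" "continuous_on UNIV u0"
    and u0_sub: "subsol A (\<lambda>x r p. H x p + 0 - c) u0"
    and u0_super: "subsol A (\<lambda>x r p. - (H x (- p) + 0 - c)) (\<lambda>x. - u0 x)"
    using assms(14) by (auto simp: ergodic_solution_iff c_def)
  obtain S0 where S0: "S0 \<ge> 0" "\<And>x. \<bar>u0 x\<bar> \<le> S0" using torus_fun_bounded[OF u0] by auto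
  have "\<exists>L\<ge>0. \<forall>x y. u0 x - u0 y \<le> L * norm (x - y)"
  proof (rule doubling_discount[where G="\<lambda>_ _. 0" and KG=1 and H=H and A=A and ?\<gamma>1.0=\<gamma>1 and S=S0 and c=c,
      OF assms(1,2,4,5,6,7,8,9)])
    show "usc u0" "usc (\<lambda>x. - u0 x)" by (intro usc_continuous continuous_intros u0)+
    show "continuous_on UNIV (\<lambda>(x :: real ^ 'n, r :: real). 0 :: real)" by (simp add: split_beta)
    fix m :: real assume "m > 0"
    \<comment> \<open>Without a zero-order term the gap must come from the distance: values
      differing by m force a distance of at least \<open>\<delta>\<close>, so
      \<open>\<theta> = \<delta>\<close> and \<open>KG = 1\<close> work.\<close>
    from torus_uniformly_continuous[OF u0 this] obtain \<delta> where \<delta>: "\<delta> > 0"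
      "\<And>x y. norm (x - y) < \<delta> \<Longrightarrow> \<bar>u0 x - u0 y\<bar> < m" by blast
    have "\<delta> - 1 * norm (a - b) \<le> 0 - 0" if "u0 a - u0 b \<ge> m" for a b using \<delta>(2)[of a b] that by fastforce
    then show "\<exists>\<theta>>0. \<forall>a b. m \<le> u0 a - u0 b \<longrightarrow> \<theta> - 1 * norm (a - b) \<le> 0 - 0" using \<delta>(1) by blast
  qed (use u0 u0_sub u0_super S0 in \<open>auto simp: torus_fun_def\<close>)
  then obtain L0 where L0: "L0 \<ge> 0" "\<And>x y. u0 x - u0 y \<le> L0 * norm (x - y)" by blast
  have u0_lip: "\<bar>u0 x - u0 y\<bar> \<le> L0 * norm (x - y)" for x y
    using L0(2)[of x y] L0(2)[of y x] by (simp add: abs_le_iff norm_minus_commute)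
  define a where "a x = deriv (f x) 0" for x
  \<comment> \<open>The barriers deviate from \<open>u0\<close> by at most 1 and lam is at most 1,
    so arguments of f stay in this range.\<close>
  have "S0 + 1 \<ge> 0" using S0 by simp
  from discount_bounds[OF assms(10-13) this] obtain \<kappa> K1 where \<kappa>: "\<kappa> > 0" and K1: "K1 \<ge> 0"
    and quad: "\<And>x r. \<bar>r\<bar> \<le> S0 + 1 \<Longrightarrow> \<bar>f x r - a x * r\<bar> \<le> K1 * r\<^sup>2"
    and a\<kappa>: "\<And>x. \<kappa> \<le> a x" and aK: "\<And>x. \<bar>a x\<bar> \<le> K1" and aL: "\<And>x y. \<bar>a x - a y\<bar> \<le> K1 * norm (x - y)"
    unfolding a_def by blast
  define V0 where "V0 x = - (a x * u0 x)" for x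
  define LV where "LV = K1 * L0 + S0 * K1"
  have LV0: "LV \<ge> 0" using K1 L0 S0 by (simp add: LV_def)
  have V0_lip: "\<bar>V0 x - V0 y\<bar> \<le> LV * norm (x - y)" for x y
  proof -
    have "V0 x - V0 y = - (a x * (u0 x - u0 y)) - u0 y * (a x - a y)" by (simp add: V0_def algebra_simps)
    then have "\<bar>V0 x - V0 y\<bar> \<le> \<bar>a x\<bar> * \<bar>u0 x - u0 y\<bar> + \<bar>u0 y\<bar> * \<bar>a x - a y\<bar>"
      using abs_triangle_ineq4[of "- (a x * (u0 x - u0 y))" "u0 y * (a x - a y)"] by (simp add: abs_mult)
    also have "\<dots> \<le> K1 * (L0 * norm (x - y)) + S0 * (K1 * norm (x - y))"
      using K1 S0 by (intro add_mono mult_mono aK u0_lip aL S0) auto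
    finally show ?thesis by (simp add: LV_def algebra_simps)
  qed
  have V0_per: "torus_fun V0"
    using u0(1) assms(10) by (simp add: torus_fun_def V0_def a_def)
  have V0_Lip: "torus_Lip V0"
  proof (rule torus_LipI[OF V0_per LV0])
    show "V0 x - V0 y \<le> LV * norm (x - y)" for x y using V0_lip[of x y] by (simp add: abs_le_iff)
  qed
  have V0_cont: "continuous_on UNIV V0"
    using V0_Lip lipschitz_on_continuous_on unfolding torus_Lip_def by blast
  \<comment> \<open>Chosen so that the gain \<open>\<kappa> * Kb * lam\<^sup>2\<close> from shifting
    \<open>u0\<close> by \<open>Kb * lam\<close> equals the bound for the Taylor error of f.\<close>
  define Kb where "Kb = K1 * (S0 + 1)\<^sup>2 / \<kappa>"
  have Kb: "Kb \<ge> 0" "\<kappa> * Kb = K1 * (S0 + 1)\<^sup>2" using K1 \<kappa> by (auto simp: Kb_def)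
  \<comment> \<open>Ensures both \<open>lam \<le> 1\<close> and
    \<open>Kb * lam \<le> 1\<close>.\<close>
  define lam0 where "lam0 = 1 / (Kb + 1)"
  have lam0: "lam0 > 0" using Kb by (simp add: lam0_def add_nonneg_pos)
  define G where "G lam x r = f x (lam * r) + lam * V0 x" for lam x r
  have G_per: "torus_fun (G lam)" for lam
    using assms(10) V0_per by (simp add: torus_fun_def G_def fun_eq_iff)
  have f_cont: "continuous_on UNIV (\<lambda>(x, r). f x r)"
  proof -
    obtain f' where "\<And>z. ((\<lambda>(x, r). f x r) has_derivative blinfun_apply (f' z)) (at z)"
      using assms(11) unfolding C11_loc_def by blast
    then have "isCont (\<lambda>(x, r). f x r) z" for z by (rule has_derivative_continuous)
    then show ?thesis by (simp add: continuous_at_imp_continuous_on)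
  qed
  have G_cont: "continuous_on UNIV (\<lambda>(x, r). G lam x r)" for lam
  proof -
    have "continuous_on UNIV (\<lambda>z :: (real ^ 'n) \<times> real. (fst z, lam * snd z))" by (intro continuous_intros)
    from continuous_on_compose2[OF f_cont this] have "continuous_on UNIV (\<lambda>z. f (fst z) (lam * snd z))" by simp
    moreover have "continuous_on UNIV (\<lambda>z :: (real ^ 'n) \<times> real. V0 (fst z))"
      by (rule continuous_on_compose2[OF V0_cont]) (auto intro!: continuous_intros)
    ultimately show ?thesis unfolding G_def split_beta by (intro continuous_intros)
  qed
  have compare: "\<exists>L\<ge>0. \<forall>x y. u x - v y \<le> L * norm (x - y)"
    if lam: "lam > 0" and usc: "usc u" "usc (\<lambda>x. - v x)" and per: "torus_fun u" "torus_fun v"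
      and bdd: "\<And>x. \<bar>u x\<bar> \<le> S" "\<And>x. \<bar>v x\<bar> \<le> S"
      and sub: "subsol A (\<lambda>x r p. H x p + G lam x r - c) u"
      and super: "subsol A (\<lambda>x r p. - (H x (- p) + G lam x (- r) - c)) (\<lambda>x. - v x)"
    for lam u v S
  proof -
    have S: "S \<ge> 0" using bdd(1)[of 0] by linarith
    then have "lam * S \<ge> 0" using lam by simp
    from discount_bounds[OF assms(10-13) this] obtain \<kappa>' K' where \<kappa>': "\<kappa>' > 0" and K': "K' \<ge> 0"
      and mono: "\<And>x r s. \<bar>r\<bar> \<le> lam * S \<Longrightarrow> \<bar>s\<bar> \<le> lam * S \<Longrightarrow> s \<le> r \<Longrightarrow> f x r - f x s \<ge> \<kappa>' * (r - s)"
      and lip: "\<And>x y r. \<bar>r\<bar> \<le> lam * S \<Longrightarrow> \<bar>f x r - f y r\<bar> \<le> K' * norm (x - y)" by blast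
    have "K' + lam * LV \<ge> 0" using K' lam LV0 by simp
    then show ?thesis
    proof (rule doubling_discount[OF assms(1,2,4,5,6,7,8,9) G_per G_cont usc per bdd sub super, rotated])
      fix m :: real assume m: "m > 0"
      \<comment> \<open>The gap is \<open>\<kappa>' * lam * m\<close>, from monotonicity in r; the
        dependence of f and \<open>V0\<close> on x goes into the Lipschitz term.\<close>
      have "\<kappa>' * (lam * m) - (K' + lam * LV) * norm (x - y) \<le> G lam x (u x) - G lam y (v y)"
        if uv: "m \<le> u x - v y" for x y
      proof -
        have b: "\<bar>lam * u x\<bar> \<le> lam * S" "\<bar>lam * v y\<bar> \<le> lam * S"
          using bdd(1)[of x] bdd(2)[of y] lam by (simp_all add: abs_mult)
        have "lam * m \<le> lam * (u x - v y)" using uv lam by (intro mult_left_mono) auto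
        then have l: "lam * m \<le> lam * u x - lam * v y" by (simp add: right_diff_distrib)
        have "\<kappa>' * (lam * u x - lam * v y) \<le> f x (lam * u x) - f x (lam * v y)"
        proof (rule mono[OF b])
          have "lam * m > 0" using lam m by simp
          then show "lam * v y \<le> lam * u x" using l by linarith
        qed
        moreover have "\<kappa>' * (lam * m) \<le> \<kappa>' * (lam * u x - lam * v y)" using l \<kappa>' by (intro mult_left_mono) auto
        moreover have "- (K' * norm (x - y)) \<le> f x (lam * v y) - f y (lam * v y)"
          using lip[OF b(2), of x y] by (simp add: abs_le_iff)
        moreover have "lam * (- (LV * norm (x - y))) \<le> lam * (V0 x - V0 y)"
          using V0_lip[of x y] lam by (intro mult_left_mono) (auto simp: abs_le_iff)
        ultimately show ?thesis by (simp add: G_def algebra_simps)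
      qed
      moreover have "\<kappa>' * (lam * m) > 0" using \<kappa>' lam m by simp
      ultimately show "\<exists>\<theta>>0. \<forall>x y. m \<le> u x - v y \<longrightarrow>
        \<theta> - (K' + lam * LV) * norm (x - y) \<le> G lam x (u x) - G lam y (v y)" by blast
    qed
  qed
  define P where "P lam w \<longleftrightarrow> torus_Lip w \<and> discounted_solution f H A c V0 lam w \<and>
    (\<forall>v. discounted_solution f H A c V0 lam v \<longrightarrow> v = w) \<and> (\<forall>x. \<bar>w x - u0 x\<bar> \<le> Kb * lam)" for lam w
  have ex: "\<exists>w. P lam w" if lam: "0 < lam" "lam < lam0" for lam
  proof -
    have sol: "discounted_solution f H A c V0 lam w \<longleftrightarrow> torus_fun w \<and> continuous_on UNIV w \<and>
      subsol A (\<lambda>x r p. H x p + G lam x r - c) w \<and>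
      subsol A (\<lambda>x r p. - (H x (- p) + G lam x (- r) - c)) (\<lambda>x. - w x)" for w
      by (simp add: discounted_solution_iff G_def)
    have lam1: "lam * (Kb + 1) \<le> 1" using lam Kb by (simp add: lam0_def field_simps)
    have "lam * Kb \<ge> 0" using lam Kb by simp
    then have lam2: "Kb * lam \<le> 1" "lam \<le> 1" "0 \<le> Kb * lam" using lam1 lam by (auto simp: algebra_simps)
    have barrier: "0 \<le> G lam x (u0 x + Kb * lam)" "G lam x (u0 x - Kb * lam) \<le> 0" for x
    proof -
      have est: "\<bar>f x (lam * (u0 x + t)) - a x * (lam * (u0 x + t))\<bar> \<le> \<kappa> * Kb * lam\<^sup>2" if t: "\<bar>t\<bar> \<le> 1" for t
      proof -
        have b: "\<bar>u0 x + t\<bar> \<le> S0 + 1" using S0(2)[of x] t by linarith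
        have "\<bar>lam * (u0 x + t)\<bar> \<le> 1 * (S0 + 1)" unfolding abs_mult using b lam lam2 by (intro mult_mono) auto
        then have "\<bar>f x (lam * (u0 x + t)) - a x * (lam * (u0 x + t))\<bar> \<le> K1 * (lam * (u0 x + t))\<^sup>2"
          using quad by simp
        also have "\<dots> = K1 * (lam\<^sup>2 * \<bar>u0 x + t\<bar>\<^sup>2)" by (simp add: power_mult_distrib)
        also have "\<dots> \<le> K1 * (lam\<^sup>2 * (S0 + 1)\<^sup>2)" using b K1 by (intro mult_left_mono power_mono) auto
        also have "\<dots> = (\<kappa> * Kb) * lam\<^sup>2" unfolding Kb(2) by (simp only: mult_ac)
        finally show ?thesis .
      qed
      \<comment> \<open>In the linear part of f the term with \<open>u0\<close> cancels against
        \<open>lam * V0 x\<close>. What remains at \<open>u0\<close> shifted by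
        \<open>Kb * lam\<close> is \<open>a x * Kb * lam\<^sup>2\<close>, up to sign.\<close>
      have "\<kappa> * (Kb * lam\<^sup>2) \<le> a x * (Kb * lam\<^sup>2)" using a\<kappa> Kb by (intro mult_right_mono) auto
      then show "0 \<le> G lam x (u0 x + Kb * lam)" "G lam x (u0 x - Kb * lam) \<le> 0"
        using est[of "Kb * lam"] est[of "- (Kb * lam)"] lam2
        by (auto simp: G_def V0_def abs_le_iff algebra_simps power2_eq_square)
    qed
    define B where "B x r p = H x p + G lam x r - c" for x r p
    have B_cont: "continuous_on UNIV (\<lambda>(x, r, p). B x r p)"
      unfolding B_def split_beta
      by (intro continuous_intros
          continuous_on_compose2[OF C2_continuous[OF assms(2)], where f="\<lambda>z. (fst z, snd (snd z))", simplified]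
          continuous_on_compose2[OF G_cont, where f="\<lambda>z. (fst z, fst (snd z))", simplified])
    have B_per: "torus_fun B" using assms(1) G_per[of lam] by (simp add: torus_fun_def B_def fun_eq_iff)
    have lo: "subsol A B (\<lambda>x. u0 x + - (Kb * lam))"
    proof (rule subsol_add_const[OF u0_sub])
      fix x g t assume "H x g + 0 - c \<le> t"
      then show "B x (u0 x + - (Kb * lam)) g \<le> t" using barrier(2)[of x] by (simp add: B_def)
    qed
    have hi: "subsol A (\<lambda>x r p. - B x (- r) (- p)) (\<lambda>x. - u0 x + - (Kb * lam))"
    proof (rule subsol_add_const[OF u0_super])
      fix x g t assume "- (H x (- g) + 0 - c) \<le> t"
      then show "- B x (- (- u0 x + - (Kb * lam))) (- g) \<le> t" using barrier(1)[of x] by (simp add: B_def add.commute)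
    qed
    have "\<exists>W Z. usc W \<and> usc (\<lambda>x. - Z x) \<and> torus_fun W \<and> torus_fun Z \<and>
      (\<forall>x. u0 x + - (Kb * lam) \<le> Z x \<and> Z x \<le> W x \<and> W x \<le> u0 x + Kb * lam) \<and>
      subsol A B W \<and> subsol A (\<lambda>x r p. - B x (- r) (- p)) (\<lambda>x. - Z x)"
    proof (rule perron[OF C2_continuous[OF assms(8)] assms(9,7) B_cont B_per, where M="S0 + 1"])
      show "subsol A (\<lambda>x r p. - B x (- r) (- p)) (\<lambda>x. - (u0 x + Kb * lam))" using hi by simp
      show "torus_fun (\<lambda>x. u0 x + Kb * lam)" using u0(1) by (simp add: torus_fun_def)
      show "\<bar>u0 x + - (Kb * lam)\<bar> \<le> S0 + 1" "\<bar>u0 x + Kb * lam\<bar> \<le> S0 + 1"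
        "u0 x + - (Kb * lam) \<le> u0 x + Kb * lam" for x
        using S0(2)[of x] lam2 by linarith+
    qed (intro continuous_intros u0 lo)+
    then obtain W Z where W: "usc W" "usc (\<lambda>x. - Z x)" "torus_fun W" "torus_fun Z"
      and WZ: "\<And>x. u0 x + - (Kb * lam) \<le> Z x \<and> Z x \<le> W x \<and> W x \<le> u0 x + Kb * lam"
      and Ws: "subsol A (\<lambda>x r p. H x p + G lam x r - c) W"
      and Zs: "subsol A (\<lambda>x r p. - (H x (- p) + G lam x (- r) - c)) (\<lambda>x. - Z x)"
      unfolding B_def by blast
    have Wb: "\<bar>W x\<bar> \<le> S0 + 1" "\<bar>Z x\<bar> \<le> S0 + 1" for x using WZ[of x] S0(2)[of x] lam2 by linarith+
    obtain L where L: "L \<ge> 0" "\<And>x y. W x - Z y \<le> L * norm (x - y)"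
      using compare[OF lam(1) W Wb Ws Zs] by blast
    \<comment> \<open>On the diagonal the estimate says that W is at most Z, which is the missing
      inequality. Off the diagonal it has become a Lipschitz bound for W.\<close>
    have WeqZ: "Z = W" using L(2)[of x x for x] WZ by (simp add: fun_eq_iff antisym)
    have W_Lip: "torus_Lip W" by (rule torus_LipI[OF W(3) L(1)]) (use L(2) WeqZ in simp)
    have W_cont: "continuous_on UNIV W"
      using W_Lip lipschitz_on_continuous_on unfolding torus_Lip_def by blast
    have Wsup: "subsol A (\<lambda>x r p. - (H x (- p) + G lam x (- r) - c)) (\<lambda>x. - W x)" using Zs WeqZ by simp
    have "discounted_solution f H A c V0 lam W" using sol W(3) W_cont Ws Wsup by blast
    moreover have "v = W" if v: "discounted_solution f H A c V0 lam v" for v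
    proof -
      have v': "torus_fun v" "continuous_on UNIV v" "subsol A (\<lambda>x r p. H x p + G lam x r - c) v"
        "subsol A (\<lambda>x r p. - (H x (- p) + G lam x (- r) - c)) (\<lambda>x. - v x)" using v sol by blast+
      obtain Sv where Sv: "\<And>x. \<bar>v x\<bar> \<le> Sv" using torus_fun_bounded[OF v'(1,2)] by auto
      \<comment> \<open>A competitor is merely continuous with its own bound, which is why
        \<open>compare\<close> allows an arbitrary S.\<close>
      define S where "S = max Sv (S0 + 1)"
      have b: "\<bar>v x\<bar> \<le> S" "\<bar>W x\<bar> \<le> S" for x using Sv[of x] Wb(1)[of x] by (simp_all add: S_def le_max_iff_disj)
      have uv: "usc v" "usc (\<lambda>x. - v x)" "usc (\<lambda>x. - W x)"
        by (intro usc_continuous continuous_intros v'(2) W_cont)+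
      obtain L1 where "\<And>x y. v x - W y \<le> L1 * norm (x - y)"
        using compare[OF lam(1) uv(1,3) v'(1) W(3) b v'(3) Wsup] by blast
      from this[of x x for x] have "v x \<le> W x" for x by simp
      moreover obtain L2 where "\<And>x y. W x - v y \<le> L2 * norm (x - y)"
        using compare[OF lam(1) W(1) uv(2) W(3) v'(1) b(2,1) Ws v'(4)] by blast
      from this[of x x for x] have "W x \<le> v x" for x by simp
      ultimately show ?thesis by (simp add: fun_eq_iff antisym)
    qed
    moreover have "\<bar>W x - u0 x\<bar> \<le> Kb * lam" for x using WZ[of x] by linarith
    ultimately show ?thesis using W_Lip unfolding P_def by blast
  qed
  \<comment> \<open>For lam outside the interval from 0 to \<open>lam0\<close> this is an
    unspecified function; the claims concern small positive lam only.\<close>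
  define u where "u lam = (SOME w. P lam w)" for lam
  have Pu: "P lam (u lam)" if "0 < lam" "lam < lam0" for lam
    unfolding u_def using ex[OF that] by (rule someI_ex)
  have lim: "uniform_limit UNIV u u0 (at_right 0)"
    unfolding uniform_limit_iff
  proof (intro allI impI)
    fix e :: real assume e: "e > 0"
    have "min lam0 (e / (Kb + 1)) > 0" using lam0 e Kb by (simp add: add_nonneg_pos)
    moreover have "\<forall>x\<in>UNIV. dist (u lam x) (u0 x) < e" if "0 < lam" "lam < min lam0 (e / (Kb + 1))" for lam
    proof
      fix x
      have "\<bar>u lam x - u0 x\<bar> \<le> Kb * lam" using Pu[of lam] that by (simp add: P_def)
      also have "\<dots> < (Kb + 1) * lam" using that by (simp add: distrib_right)
      also have "\<dots> < e" using that Kb by (simp add: pos_less_divide_eq mult.commute add_nonneg_pos)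
      finally show "dist (u lam x) (u0 x) < e" by (simp add: dist_real_def)
    qed
    ultimately show "\<forall>\<^sub>F lam in at_right 0. \<forall>x\<in>UNIV. dist (u lam x) (u0 x) < e"
      unfolding eventually_at_right_field by blast
  qed
  show ?thesis
    unfolding c_def[symmetric]
  proof (rule exI[of _ V0], rule conjI[OF V0_Lip], rule exI[of _ lam0], rule conjI[OF lam0],
      rule exI[of _ Kb], rule exI[of _ u], rule conjI[OF _ lim], intro allI impI)
    fix lam assume "0 < lam \<and> lam < lam0"
    then show "torus_Lip (u lam) \<and> discounted_solution f H A c V0 lam (u lam) \<and>
      (\<forall>v. discounted_solution f H A c V0 lam v \<longrightarrow> v = u lam) \<and> (\<forall>x. \<bar>u lam x - u0 x\<bar> \<le> Kb * lam)"
      using Pu[of lam] unfolding P_def by blast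
  qed
qed

end
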